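(* Let $0<p<\infty$, let $\omega\in B_\infty$ and let $Z$ be a sequence in $\mathbb{D}$. Then the following statements are equivalent: (a) $Z\in\mathcal{Z}(A^p_\omega)$; (b) any subsequence of $Z$ belongs to $\mathcal{Z}(A^p_\omega)$; (c) $\sum_{a\in Z}(1-|a|)^2<\infty$ and there is a nowhere zero function $F\in\mathcal{H}(\mathbb{D})$ such that $FW_Z\in L^p_\omega$; (d) $\sum_{a\in Z}(1-|a|)^2<\infty$ and there is a nonzero (i.e. not identically zero) function $F\in\mathcal{H}(\mathbb{D})$ such that $FW_Z\in L^p_\omega$. Moreover, if (a) is true, then the mapping $f\mapsto f/\psi_Z$ is a continuous isomorphism from $\{f\in A^p_\omega: Z\subset\mathcal{Z}(f)\}$ onto $\{F\in\mathcal{H}(\mathbb{D}): FW_Z\in L^p_\omega\}$.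
   Context: $\mathbb{D}=\{z\in\mathbb{C}:|z|<1\}$, $\mathcal{H}(\mathbb{D})$ is the space of analytic functions in $\mathbb{D}$, and $dA(z)=\frac{dx\,dy}{\pi}$. A weight is a function $\omega:\mathbb{D}\to[0,\infty)$ integrable over $\mathbb{D}$ (with respect to $dA$). $L^p_\omega=L^p(\mathbb{D},\omega\,dA)$, and the weighted Bergman space $A^p_\omega$ consists of $f\in\mathcal{H}(\mathbb{D})$ with $\|f\|_{A^p_\omega}^p=\int_{\mathbb{D}}|f|^p\omega\,dA<\infty$. Carleson squares are the sets $S(z)=\{re^{i\theta}\in\mathbb{D}:|z|<r<1,\ |\arg(ze^{-i\theta})|<\frac{1-|z|}{2}\}$, $z\in\mathbb{D}\setminus\{0\}$; $|S|$ denotes Euclidean area. For $1<q<\infty$, $\omega\in B_q$ means that the weight $\omega$ is strictly positive almost everywhere and $$\sup_S\left(\frac1{|S|^2}\int_S\omega(z)(1-|z|^2)^{2q}\,dA(z)\right)\left(\frac1{|S|^2}\int_S\omega(z)^{-\frac1{q-1}}\,dA(z)\right)^{q-1}<\infty,$$ the supremum being over all Carleson squares $S$. $B_\infty=\bigcup_{q>1}B_q$. Zero sets are sequences in which points are repeated according to multiplicity: for $f\not\equiv0$, $\mathcal{Z}(f)$ is the sequence of all zeros of $f$ in $\mathbb{D}$ counted with multiplicities. $\mathcal{Z}(A^p_\omega)$ is the set of all sequences $Z$ such that $Z=\mathcal{Z}(f)$ for some nonzero $f\in A^p_\omega$. $\{f\in A^p_\omega:Z\subset\mathcal{Z}(f)\}$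 is the space of $f\in A^p_\omega$ vanishing on $Z$ counting multiplicities (including $f\equiv0$), equipped with $\|\cdot\|_{A^p_\omega}$; $\{F\in\mathcal{H}(\mathbb{D}):FW_Z\in L^p_\omega\}$ is equipped with $\|FW_Z\|_{L^p_\omega}$. For a sequence $Z\subset\mathbb{D}$, $$\psi_Z(z)=\prod_{a\in Z}\overline a\,\frac{a-z}{1-\overline az}\exp\left(1-\overline a\,\frac{a-z}{1-\overline az}\right),\qquad W_Z(z)=e^{k_Z(z)},\qquad k_Z(z)=\frac{|z|^2}{2}\sum_{a\in Z}\frac{(1-|a|^2)^2}{|1-\overline az|^2},\quad z\in\mathbb{D},$$ where in $\psi_Z$ each factor corresponding to $a=0$ is replaced by $z$. *)

theory Defs
  imports "HOL-Complex_Analysis.Complex_Analysis"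
begin

abbreviation disc :: "complex set" where
  "disc \<equiv> ball 0 1"

definition dA :: "complex measure" where
  "dA = scale_measure (ennreal (1 / pi)) (lebesgue_on disc)"

(* Functions on the disc are represented by functions on the plane that are 0 off the disc,
   so that equality of functions on the disc is equality in HOL and pointwise vector space
   operations stay inside the space. *)
definition holo_disc :: "(complex \<Rightarrow> complex) set" where
  "holo_disc = {f. f holomorphic_on disc \<and> (\<forall>z. z \<notin> disc \<longrightarrow> f z = 0)}"

definition weight :: "(complex \<Rightarrow> real) \<Rightarrow> bool" where
  "weight \<omega> \<longleftrightarrow> (\<forall>z\<in>disc. 0 \<le> \<omega> z) \<and> integrable dA \<omega>"

definition Lp :: "real \<Rightarrow> (complex \<Rightarrow> real) \<Rightarrow> (complex \<Rightarrow> complex) set" where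
  "Lp p \<omega> = {f. f \<in> borel_measurable dA \<and> integrable dA (\<lambda>z. cmod (f z) powr p * \<omega> z)}"

definition Lp_norm :: "real \<Rightarrow> (complex \<Rightarrow> real) \<Rightarrow> (complex \<Rightarrow> complex) \<Rightarrow> real" where
  "Lp_norm p \<omega> f = (\<integral>z. cmod (f z) powr p * \<omega> z \<partial>dA) powr (1 / p)"

definition Bergman :: "real \<Rightarrow> (complex \<Rightarrow> real) \<Rightarrow> (complex \<Rightarrow> complex) set" where
  "Bergman p \<omega> = holo_disc \<inter> Lp p \<omega>"

definition Carleson_square :: "complex \<Rightarrow> complex set" where
  "Carleson_square z = {complex_of_real r * cis \<theta> | r \<theta>.
     cmod z < r \<and> r < 1 \<and> \<bar>Arg (z * cis (- \<theta>))\<bar> < (1 - cmod z) / 2}"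

(* For exponents s > 0. *)
definition ennpowr :: "ennreal \<Rightarrow> real \<Rightarrow> ennreal" where
  "ennpowr x s = (if x = \<infinity> then \<infinity> else ennreal (enn2real x powr s))"

(* The integrals take values in [0, \<infinity>]. Off the null set where \<omega> vanishes, the powers are the
   ordinary ones; on that set HOL's 0 powr s = 0 applies, which does not affect the integral. *)
definition Bq_weight :: "real \<Rightarrow> (complex \<Rightarrow> real) \<Rightarrow> bool" where
  "Bq_weight q \<omega> \<longleftrightarrow> weight \<omega> \<and> (AE z in dA. 0 < \<omega> z) \<and>
     (SUP S \<in> Carleson_square ` (disc - {0}).
        (ennreal (1 / (measure lebesgue S)\<^sup>2) *
           (\<integral>\<^sup>+z\<in>S. ennreal (\<omega> z * (1 - (cmod z)\<^sup>2) powr (2 * q)) \<partial>dA)) *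
        ennpowr
          (ennreal (1 / (measure lebesgue S)\<^sup>2) *
             (\<integral>\<^sup>+z\<in>S. ennreal (\<omega> z powr (- 1 / (q - 1))) \<partial>dA))
          (q - 1)) < \<infinity>"

definition Binf_weight :: "(complex \<Rightarrow> real) \<Rightarrow> bool" where
  "Binf_weight \<omega> \<longleftrightarrow> (\<exists>q>1. Bq_weight q \<omega>)"

(* A finite or infinite sequence (a_i), i \<in> I, of points with repetitions is the pair (I, a),
   where I is an arbitrary set of natural numbers; values of a off I are irrelevant.
   A subsequence of (I, a) is (J, a) with J \<subseteq> I. *)
type_synonym zseq = "nat set \<times> (nat \<Rightarrow> complex)"

definition seq_in_disc :: "zseq \<Rightarrow> bool" where
  "seq_in_disc Z \<longleftrightarrow> (\<forall>i\<in>fst Z. snd Z i \<in> disc)"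

definition subsequence :: "zseq \<Rightarrow> zseq \<Rightarrow> bool" where
  "subsequence Y Z \<longleftrightarrow> fst Y \<subseteq> fst Z \<and> snd Y = snd Z"

definition occurrences :: "zseq \<Rightarrow> complex \<Rightarrow> nat set" where
  "occurrences Z w = {i \<in> fst Z. snd Z i = w}"

(* Z is the sequence of zeros of f in the disc, up to the order of enumeration;
   meaningful for holomorphic f that is not identically zero. *)
definition is_zero_seq :: "(complex \<Rightarrow> complex) \<Rightarrow> zseq \<Rightarrow> bool" where
  "is_zero_seq f Z \<longleftrightarrow> seq_in_disc Z \<and>
     (\<forall>w\<in>disc. finite (occurrences Z w) \<and> int (card (occurrences Z w)) = zorder f w)"

definition zero_sets :: "(complex \<Rightarrow> complex) set \<Rightarrow> zseq set" where
  "zero_sets X = {Z. \<exists>f\<in>X. (\<exists>z\<in>disc. f z \<noteq> 0) \<and> is_zero_seq f Z}"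

definition vanishes_on :: "(complex \<Rightarrow> complex) \<Rightarrow> zseq \<Rightarrow> bool" where
  "vanishes_on f Z \<longleftrightarrow> (\<forall>z\<in>disc. f z = 0) \<or>
     (\<forall>w\<in>disc. finite (occurrences Z w) \<and> int (card (occurrences Z w)) \<le> zorder f w)"

definition square_summable :: "zseq \<Rightarrow> bool" where
  "square_summable Z \<longleftrightarrow> (\<lambda>i. (1 - cmod (snd Z i))\<^sup>2) summable_on fst Z"

definition psi_factor :: "complex \<Rightarrow> complex \<Rightarrow> complex" where
  "psi_factor a z = (if a = 0 then z else
     cnj a * ((a - z) / (1 - cnj a * z)) * exp (1 - cnj a * ((a - z) / (1 - cnj a * z))))"

(* The product and the sum below converge on the disc when Z is a square summable sequence
   in the disc; they are not meaningful otherwise. *)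
definition psi_seq :: "zseq \<Rightarrow> complex \<Rightarrow> complex" where
  "psi_seq Z z = (\<Prod>i. if i \<in> fst Z then psi_factor (snd Z i) z else 1)"

definition k_seq :: "zseq \<Rightarrow> complex \<Rightarrow> real" where
  "k_seq Z z = (cmod z)\<^sup>2 / 2 *
     (\<Sum>\<^sub>\<infinity>i\<in>fst Z. (1 - (cmod (snd Z i))\<^sup>2)\<^sup>2 / (cmod (1 - cnj (snd Z i) * z))\<^sup>2)"

definition W_seq :: "zseq \<Rightarrow> complex \<Rightarrow> real" where
  "W_seq Z z = exp (k_seq Z z)"

(* The quotient f / psi as a function on the disc, with removable singularities removed. *)
definition divide_psi :: "zseq \<Rightarrow> (complex \<Rightarrow> complex) \<Rightarrow> complex \<Rightarrow> complex" where
  "divide_psi Z f z = (if z \<in> disc then remove_sings (\<lambda>w. f w / psi_seq Z w) z else 0)"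

(* Continuity is with respect to the topology of the (quasi-)norms N and M;
   they need not satisfy the triangle inequality. *)
definition cont_between ::
  "(complex \<Rightarrow> complex) set \<Rightarrow> ((complex \<Rightarrow> complex) \<Rightarrow> real) \<Rightarrow> ((complex \<Rightarrow> complex) \<Rightarrow> real) \<Rightarrow>
   ((complex \<Rightarrow> complex) \<Rightarrow> complex \<Rightarrow> complex) \<Rightarrow> bool" where
  "cont_between V N M T \<longleftrightarrow>
     (\<forall>f\<in>V. \<forall>\<epsilon>>0. \<exists>\<delta>>0. \<forall>g\<in>V. N (\<lambda>z. g z - f z) < \<delta> \<longrightarrow> M (\<lambda>z. T g z - T f z) < \<epsilon>)"

definition continuous_isomorphism ::
  "(complex \<Rightarrow> complex) set \<Rightarrow> ((complex \<Rightarrow> complex) \<Rightarrow> real) \<Rightarrow>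
   (complex \<Rightarrow> complex) set \<Rightarrow> ((complex \<Rightarrow> complex) \<Rightarrow> real) \<Rightarrow>
   ((complex \<Rightarrow> complex) \<Rightarrow> complex \<Rightarrow> complex) \<Rightarrow> bool" where
  "continuous_isomorphism V N W M T \<longleftrightarrow>
     (\<forall>f\<in>V. \<forall>g\<in>V. T (\<lambda>z. f z + g z) = (\<lambda>z. T f z + T g z)) \<and>
     (\<forall>c. \<forall>f\<in>V. T (\<lambda>z. c * f z) = (\<lambda>z. c * T f z)) \<and>
     bij_betw T V W \<and>
     cont_between V N M T \<and>
     cont_between W M N (inv_into V T)"

end

theory Submission
  imports Defs
begin

text \<open>Let \<open>\<phi>\<^sub>a(z) = (a - z) / (1 - cnj a * z)\<close>. The factor \<open>\<psi>\<^sub>a\<close> of the product and the factor \<open>exp k\<^sub>a\<close> of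
  \<open>W\<close> satisfy the exact identity
  \<open>|\<psi>\<^sub>a| = exp (c\<^sub>a + k\<^sub>a) * |\<phi>\<^sub>a| * exp ((1 - |\<phi>\<^sub>a|\<^sup>2) / 2)\<close> with \<open>c\<^sub>a \<le> 0\<close> and \<open>c\<^sub>a = O((1 - |a|)\<^sup>2)\<close>,
  so \<open>|\<psi>| \<le> W\<close> and \<open>F W \<in> L\<^sup>p\<close> implies \<open>F \<psi> \<in> A\<^sup>p\<close>.

  Conversely let \<open>f = F \<psi>\<close> and \<open>s = p / q\<close>, where \<open>\<omega>\<close> satisfies the $B_q$ condition. Jensen's formula and the mean
  value \<open>- (1 - b\<^sup>2) / 2\<close> of \<open>ln (max |w| b)\<close> over the disc give, after a disc automorphism,
  that a constant times \<open>|F W|\<^sup>s\<close> is bounded by the Berezin transform of \<open>|f|\<^sup>s\<close>. The Berezin kernel acts boundedly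
  from \<open>L\<^sup>q(\<omega>)\<close> to itself: the measures with densities \<open>\<omega> (1 - |z|\<^sup>2)\<^bsup>2q\<^esup>\<close> and
  \<open>\<omega>\<^bsup>-1/(q-1)\<^esup>\<close> are doubling on Carleson boxes, which allows a Schur test. Hence the norms of
  \<open>f\<close> and \<open>F W\<close> are comparable. The same pointwise bound at a single point with \<open>f z \<noteq> 0\<close> shows that the zeros
  of \<open>f\<close> are square summable.

  The equivalences follow since \<open>W\<close> only grows when points are added to the sequence: given \<open>F\<close> with
  \<open>F W\<^sub>Z \<in> L\<^sup>p\<close>, divide \<open>F \<psi>\<^sub>Z\<close> by the product \<open>\<psi>\<^sub>Y\<close> over all its zeros \<open>Y\<close> to get a zero-free function.\<close>

section \<open>The area measure and disc automorphisms\<close>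

text \<open>The exponent \<open>s = p / q\<close> turns \<open>f\<close> in
  \<open>L^p(\<omega>)\<close> into \<open>|f|^s\<close> in \<open>L^q(\<omega>)\<close>. Since
  \<open>|f|^s\<close> is subharmonic for every \<open>s > 0\<close>, small \<open>p\<close> costs
  nothing, and the kernel operator acts where Hoelder's inequality is available, as
  \<open>q > 1\<close>. The Berezin kernel carries the factor \<open>(1 - |z|^2)^2\<close>. Moved to
  the other side of the pointwise bound, it becomes the factor \<open>(1 - |z|^2)^(2 q)\<close> of
  the B_q condition: what has to be bounded is the bare kernel \<open>1 / |1 - cnj z w|^4\<close>
  from \<open>L^q(\<omega>)\<close> to \<open>L^q\<close> of
  \<open>\<omega> (1 - |z|^2)^(2 q)\<close>. Two obstacles shape the proof. The weight has no
  pointwise regularity, so only masses of boxes can be compared; doubling makes them decay towards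
  the circle, and this decay is what renders a small negative power of \<open>1 - |w|\<close>
  integrable, the test function of the Schur test. And near a zero of \<open>f\<close> the function
  \<open>F W\<close> is not small, so it can be dominated by averages of \<open>|f|^s\<close> only.
  Infinitely many zeros are reached through finite subsets, with constants independent of their
  number; this is where the convergent sum of the \<open>c_a\<close> enters.\<close>

definition cvec :: "complex \<Rightarrow> real^2" where "cvec z = vector [Re z, Im z]"
definition vecc :: "real^2 \<Rightarrow> complex" where "vecc v = Complex (v$1) (v$2)"

lemma vecc_cvec [simp]: "vecc (cvec z) = z" by (simp add: cvec_def vecc_def)
lemma cvec_vecc [simp]: "cvec (vecc z) = z" by (simp add: cvec_def vecc_def vec_eq_iff forall_2)

lemma linear_cvec: "linear cvec"
  by (rule linearI) (simp_all add: cvec_def vec_eq_iff forall_2)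
lemma linear_vecc: "linear vecc"
  by (rule linearI) (simp_all add: vecc_def complex_eq_iff)

lemma measurable_vecc [measurable]: "vecc \<in> borel_measurable borel"
  by (intro borel_measurable_continuous_onI linear_continuous_on linear_conv_bounded_linear[THEN iffD1] linear_vecc)

lemma Basis_real2: "(Basis :: (real^2) set) = {axis 1 1, axis 2 1}"
  by (auto simp: Basis_vec_def UNIV_2)

text \<open>The change of variables theorem \<open>has_measure_differentiable_image\<close> speaks
  of \<open>real^n\<close>, so area in the complex plane is identified with Lebesgue measure on
  \<open>real^2\<close>; agreement on boxes suffices.\<close>

lemma lborel_vecc: "distr lborel borel vecc = lborel"
proof (rule lborel_eqI[symmetric])
  fix l u :: complex
  assume le: "\<And>b. b \<in> Basis \<Longrightarrow> l \<bullet> b \<le> u \<bullet> b"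
  have eq: "vecc -` box l u = box (cvec l) (cvec u)"
    by (auto simp: box_def Basis_real2 Basis_complex_def inner_axis vecc_def cvec_def inner_complex_def)
  have ne: "axis 1 1 \<noteq> (axis 2 1 :: real^2)"
    by (simp add: axis_eq_axis)
  have le2: "Re l \<le> Re u" "Im l \<le> Im u"
    using le[of 1] le[of \<i>] by (auto simp: Basis_complex_def inner_complex_def)
  have "emeasure (distr lborel borel vecc) (box l u) = emeasure lborel (box (cvec l) (cvec u))"
    by (subst emeasure_distr) (auto simp: eq)
  also have "\<dots> = (\<Prod>b\<in>Basis. (u - l) \<bullet> b)"
    using le2 ne by (subst emeasure_lborel_box)
      (auto simp: Basis_real2 Basis_complex_def inner_axis cvec_def inner_complex_def)
  finally show "emeasure (distr lborel borel vecc) (box l u) = (\<Prod>b\<in>Basis. (u - l) \<bullet> b)" .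
qed simp

text \<open>Multiplication by \<open>x + i y\<close> has the rows \<open>(x, -y)\<close> and
  \<open>(y, x)\<close>, so a holomorphic map scales area by the squared modulus of its
  derivative.\<close>

lemma det_complex_mult:
  "det (matrix (\<lambda>h. cvec (c * vecc h))) = (cmod c)\<^sup>2"
  unfolding cmod_power2 by (simp add: det_2 matrix_def cvec_def vecc_def axis_def power2_eq_square)

lemma emeasure_conformal_image:
  fixes g :: "complex \<Rightarrow> complex"
  assumes S: "S \<in> sets borel" and der: "\<And>x. x \<in> S \<Longrightarrow> (g has_field_derivative g' x) (at x)"
    and inj: "inj_on g S" and gS: "g ` S \<in> sets borel" and g': "g' \<in> borel_measurable borel"
    and fin: "emeasure lborel (g ` S) < \<infinity>"
  shows "emeasure lborel (g ` S) = (\<integral>\<^sup>+x\<in>S. ennreal ((cmod (g' x))\<^sup>2) \<partial>lborel)"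
proof -
  define S' where "S' = vecc -` S"
  define G where "G = (\<lambda>x. cvec (g (vecc x)))"
  have S': "S' \<in> sets borel"
    unfolding S'_def using measurable_sets[OF measurable_vecc S] by simp
  have im: "G ` S' = vecc -` (g ` S)"
  proof (intro set_eqI iffI)
    fix x assume "x \<in> vecc -` (g ` S)"
    then obtain y where y: "y \<in> S" "vecc x = g y" by auto
    then have "x = G (cvec y)" "cvec y \<in> S'" unfolding G_def S'_def by (metis cvec_vecc vecc_cvec, simp)
    then show "x \<in> G ` S'" by blast
  qed (auto simp: G_def S'_def)
  have em: "emeasure lborel (vecc -` A) = emeasure lborel A" if "A \<in> sets borel" for A
    using that by (subst lborel_vecc[symmetric]) (simp add: emeasure_distr)
  have der': "(G has_derivative (\<lambda>h. cvec (g' (vecc x) * vecc h))) (at x within S')" if "x \<in> S'" for x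
  proof -
    have "(g has_derivative (\<lambda>h. g' (vecc x) * h)) (at (vecc x))"
      using der[of "vecc x"] that unfolding S'_def has_field_derivative_def by simp
    moreover have "(vecc has_derivative vecc) (at x)"
      by (rule linear_imp_has_derivative[OF linear_vecc])
    ultimately have "((\<lambda>x. g (vecc x)) has_derivative (\<lambda>h. g' (vecc x) * vecc h)) (at x)"
      by (rule has_derivative_compose[rotated])
    from has_derivative_compose[OF this linear_imp_has_derivative[OF linear_cvec]]
    have "(G has_derivative (\<lambda>h. cvec (g' (vecc x) * vecc h))) (at x)"
      unfolding G_def .
    then show ?thesis by (rule has_derivative_at_withinI)
  qed
  have inj': "inj_on G S'"
  proof (rule inj_onI)
    fix x y assume xy: "x \<in> S'" "y \<in> S'" "G x = G y"
    then have "g (vecc x) = g (vecc y)" unfolding G_def by (metis vecc_cvec)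
    with inj xy have "vecc x = vecc y" unfolding S'_def inj_on_def by blast
    then show "x = y" by (metis cvec_vecc)
  qed
  have fin': "emeasure lborel (G ` S') < \<infinity>"
    using fin em[OF gS] by (simp add: im)
  have GS: "G ` S' \<in> sets borel"
    using measurable_sets[OF measurable_vecc gS] by (simp add: im)
  let ?D = "\<lambda>x. \<bar>det (matrix (\<lambda>h. cvec (g' (vecc x) * vecc h)))\<bar>"
  have Deq: "?D x = (cmod (g' (vecc x)))\<^sup>2" for x
    by (simp add: det_complex_mult)
  have lm: "G ` S' \<in> lmeasurable"
    using fin' GS by (auto simp: fmeasurable_def)
  have "((\<lambda>x. ?D x) has_integral measure lebesgue (G ` S')) S'"
    using has_measure_differentiable_image[of S' G "\<lambda>x h. cvec (g' (vecc x) * vecc h)"] S' der' inj' lm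
    by auto
  then have "(\<integral>\<^sup>+x. ennreal (?D x) * indicator S' x \<partial>lborel) = ennreal (measure lebesgue (G ` S'))"
    by (intro nn_integral_has_integral_lebesgue') auto
  also have "\<dots> = emeasure lborel (G ` S')"
    using lm GS fin' by (subst emeasure_eq_measure2[symmetric]) (auto simp: measure_completion emeasure_eq_ennreal_measure)
  also have "\<dots> = emeasure lborel (g ` S)"
    using em[OF gS] by (simp add: im)
  finally have "emeasure lborel (g ` S) = (\<integral>\<^sup>+x. ennreal ((cmod (g' (vecc x)))\<^sup>2) * indicator S (vecc x) \<partial>lborel)"
    unfolding Deq S'_def by (simp add: indicator_vimage)
  also have "\<dots> = (\<integral>\<^sup>+x. ennreal ((cmod (g' x))\<^sup>2) * indicator S x \<partial>distr lborel borel vecc)"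
    using S g' by (subst nn_integral_distr) auto
  finally show ?thesis by (simp add: lborel_vecc)
qed

text \<open>By the area formula, the density \<open>|g'|^2\<close> on \<open>S\<close>, pushed
  forward by \<open>g\<close>, is Lebesgue measure on the image; \<open>f\<close> is then integrated
  against both. Boundedness of the image keeps all areas involved finite.\<close>

lemma nn_integral_conformal_image:
  fixes g g' :: "complex \<Rightarrow> complex" and f :: "complex \<Rightarrow> ennreal"
  assumes S: "S \<in> sets borel" and der: "\<And>x. x \<in> S \<Longrightarrow> (g has_field_derivative g' x) (at x)"
    and inj: "inj_on g S" and gS: "g ` S \<in> sets borel" and g': "g' \<in> borel_measurable borel"
    and fin: "bounded (g ` S)" and f [measurable]: "f \<in> borel_measurable borel"
  shows "(\<integral>\<^sup>+x\<in>g ` S. f x \<partial>lborel) = (\<integral>\<^sup>+x\<in>S. f (g x) * ennreal ((cmod (g' x))\<^sup>2) \<partial>lborel)"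
proof -
  note [measurable] = S gS g'
  have cont: "continuous_on S g"
    using der by (meson continuous_at_imp_continuous_on DERIV_isCont)
  \<comment> \<open>The density vanishes off \<open>S\<close>, so the value 0 there is harmless and
    makes the map Borel on the whole plane.\<close>
  define G where "G = (\<lambda>x. if x \<in> S then g x else 0)"
  have G [measurable]: "G \<in> borel_measurable borel"
    unfolding G_def by (rule borel_measurable_continuous_on_if[OF S cont]) auto
  have "distr (density lborel (\<lambda>x. ennreal ((cmod (g' x))\<^sup>2) * indicator S x)) borel G
      = density lborel (indicator (g ` S))"
  proof (rule measure_eqI)
    fix B assume "B \<in> sets (distr (density lborel (\<lambda>x. ennreal ((cmod (g' x))\<^sup>2) * indicator S x)) borel G)"
    then have B [measurable]: "B \<in> sets borel" by simp
    define A where "A = S \<inter> G -` B"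
    have A [measurable]: "A \<in> sets borel"
      unfolding A_def using measurable_sets[OF G B] by auto
    have [measurable]: "G -` B \<in> sets borel"
      using measurable_sets[OF G B] by simp
    have im: "g ` A = g ` S \<inter> B" by (auto simp: A_def G_def)
    have "emeasure lborel (g ` A) \<le> emeasure lborel (g ` S)"
      by (intro emeasure_mono) (auto simp: A_def)
    also have "\<dots> < \<infinity>" by (rule emeasure_bounded_finite[OF fin])
    finally have "emeasure lborel (g ` A) = (\<integral>\<^sup>+x\<in>A. ennreal ((cmod (g' x))\<^sup>2) \<partial>lborel)"
      using der inj_on_subset[OF inj, of A]
      by (intro emeasure_conformal_image) (auto simp: im g', auto simp: A_def)
    also have "\<dots> = (\<integral>\<^sup>+x. ennreal ((cmod (g' x))\<^sup>2) * indicator S x * indicator (G -` B) x \<partial>lborel)"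
      by (intro nn_integral_cong) (auto simp: A_def split: split_indicator)
    also have "\<dots> = emeasure (distr (density lborel (\<lambda>x. ennreal ((cmod (g' x))\<^sup>2) * indicator S x)) borel G) B"
      by (simp add: emeasure_distr emeasure_density)
    finally show "emeasure (distr (density lborel (\<lambda>x. ennreal ((cmod (g' x))\<^sup>2) * indicator S x)) borel G) B
        = emeasure (density lborel (indicator (g ` S))) B"
      by (simp add: emeasure_density im flip: indicator_inter_arith)
  qed simp
  then have "(\<integral>\<^sup>+x. f x \<partial>density lborel (indicator (g ` S))) =
     (\<integral>\<^sup>+x. f x \<partial>distr (density lborel (\<lambda>x. ennreal ((cmod (g' x))\<^sup>2) * indicator S x)) borel G)"
    by simp
  then have "(\<integral>\<^sup>+x\<in>g ` S. f x \<partial>lborel) = (\<integral>\<^sup>+x. (ennreal ((cmod (g' x))\<^sup>2) * indicator S x) * f (G x) \<partial>lborel)"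
    by (simp add: nn_integral_density nn_integral_distr mult.commute)
  also have "\<dots> = (\<integral>\<^sup>+x\<in>S. f (g x) * ennreal ((cmod (g' x))\<^sup>2) \<partial>lborel)"
    by (intro nn_integral_cong) (auto simp: G_def mult_ac split: split_indicator)
  finally show ?thesis .
qed

section \<open>The normalised area measure\<close>

lemma space_dA [simp]: "space dA = disc"
  by (simp add: dA_def space_scale_measure)

lemma sets_dA: "sets dA = sets (lebesgue_on disc)"
  by (simp add: dA_def)

lemma measurable_dA_cong: "measurable dA N = measurable (lebesgue_on disc) N"
  by (rule measurable_cong_sets) (simp_all add: sets_dA)

lemma borel_imp_measurable_dA [measurable (raw)]: "f \<in> measurable borel N \<Longrightarrow> f \<in> measurable dA N"
  unfolding measurable_dA_cong by (intro measurable_restrict_space1 measurable_completion) simp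

lemma nn_integral_dA:
  "f \<in> borel_measurable borel \<Longrightarrow> (\<integral>\<^sup>+x. f x \<partial>dA) = ennreal (1/pi) * (\<integral>\<^sup>+x\<in>disc. f x \<partial>lborel)"
  unfolding dA_def
  by (subst nn_integral_scale_measure)
     (auto intro!: measurable_restrict_space1 measurable_completion simp: nn_integral_restrict_space nn_integral_completion)

lemma emeasure_dA_ball:
  assumes "0 \<le> r" "ball c r \<subseteq> disc"
  shows "emeasure dA (ball c r) = ennreal (r\<^sup>2)"
proof -
  have "emeasure dA (ball c r) = ennreal (1/pi) * emeasure lborel (ball c r)"
    using assms(2) unfolding dA_def
    by (subst emeasure_scale_measure) (auto simp: emeasure_restrict_space emeasure_completion sets_restrict_space)
  also have "\<dots> = ennreal (1/pi) * ennreal (pi * r\<^sup>2)"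
    using assms(1) by (simp add: emeasure_ball eval_unit_ball_vol)
  also have "\<dots> = ennreal (1/pi * (pi * r\<^sup>2))"
    by (rule ennreal_mult[symmetric]) auto
  finally show ?thesis by simp
qed

lemma emeasure_dA_disc [simp]: "emeasure dA disc = 1"
  using emeasure_dA_ball[of 1 0] by simp

interpretation dA: finite_measure dA
  by (rule finite_measureI) simp

section \<open>The quasi-distance |1 - cnj z w| and disc automorphisms\<close>

lemma cmod_one_minus_ge:
  assumes "cmod z \<le> 1" "cmod w \<le> 1"
  shows "1 - cmod z \<le> cmod (1 - cnj z * w)" "1 - cmod w \<le> cmod (1 - cnj z * w)"
    "cmod (1 - cnj z * w) \<le> 2"
proof -
  have "1 - cmod z * cmod w \<le> cmod (1 - cnj z * w)"
    using norm_triangle_ineq2[of 1 "cnj z * w"] by (simp add: norm_mult)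
  moreover have "cmod z * cmod w \<le> cmod z" "cmod z * cmod w \<le> cmod w"
    using assms by (auto intro: mult_left_le mult_left_le_one_le)
  ultimately show "1 - cmod z \<le> cmod (1 - cnj z * w)" "1 - cmod w \<le> cmod (1 - cnj z * w)" by auto
  have "cmod z * cmod w \<le> 1" using assms by (simp add: mult_le_one)
  then show "cmod (1 - cnj z * w) \<le> 2"
    using norm_triangle_ineq4[of 1 "cnj z * w"] by (simp add: norm_mult)
qed

lemma one_minus_cnj_mult_nz:
  assumes "z \<in> disc" "w \<in> disc"
  shows "1 - cnj z * w \<noteq> 0" "0 < cmod (1 - cnj z * w)"
  using cmod_one_minus_ge(1)[of z w] assms by (auto simp del: norm_eq_zero)

lemma cmod_one_minus_commute: "cmod (1 - cnj z * w) = cmod (1 - cnj w * z)"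
  by (metis complex_cnj_cnj complex_cnj_diff complex_cnj_mult complex_cnj_one complex_mod_cnj mult.commute)

definition mob :: "complex \<Rightarrow> complex \<Rightarrow> complex" where "mob z w = (z - w) / (1 - cnj z * w)"

lemma cmod_sq_one_minus: "(cmod (1 - cnj z * w))\<^sup>2 = (cmod (z - w))\<^sup>2 + (1 - (cmod z)\<^sup>2) * (1 - (cmod w)\<^sup>2)"
  unfolding cmod_power2 by (simp add: power2_eq_square) algebra

lemma one_minus_mob:
  assumes "z \<in> disc" "w \<in> disc"
  shows "1 - (cmod (mob z w))\<^sup>2 = (1 - (cmod z)\<^sup>2) * (1 - (cmod w)\<^sup>2) / (cmod (1 - cnj z * w))\<^sup>2"
proof -
  have "(cmod (1 - cnj z * w))\<^sup>2 > 0" using one_minus_cnj_mult_nz[OF assms] by simp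
  then show ?thesis using cmod_sq_one_minus[of z w]
    by (simp add: mob_def norm_divide power_divide field_simps)
qed

lemma mob_in_disc: "z \<in> disc \<Longrightarrow> w \<in> disc \<Longrightarrow> mob z w \<in> disc"
  using Moebius_function_norm_lt_1[of z w 0]
  by (simp add: mob_def Moebius_function_def norm_divide norm_minus_commute)

lemma mob_mob:
  assumes "z \<in> disc" "w \<in> disc"
  shows "mob z (mob z w) = w"
proof -
  have "1 - cnj z * w \<noteq> 0" "1 - cnj z * z \<noteq> 0"
    using one_minus_cnj_mult_nz[of z] assms by auto
  moreover have "z - (z - w) / (1 - cnj z * w) = w * (1 - cnj z * z) / (1 - cnj z * w)"
    using calculation by (simp add: field_simps)
  moreover have "1 - cnj z * ((z - w) / (1 - cnj z * w)) = (1 - cnj z * z) / (1 - cnj z * w)"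
    using calculation by (simp add: field_simps)
  ultimately show ?thesis by (simp add: mob_def)
qed

lemma mob_has_derivative:
  assumes "z \<in> disc" "w \<in> disc"
  shows "(mob z has_field_derivative (- (1 - cnj z * z) / (1 - cnj z * w)\<^sup>2)) (at w)"
  unfolding mob_def using one_minus_cnj_mult_nz[OF assms]
  by (auto intro!: derivative_eq_intros simp: field_simps power2_eq_square)

lemma mob_holomorphic [holomorphic_intros]:
  "z \<in> disc \<Longrightarrow> f holomorphic_on A \<Longrightarrow> f ` A \<subseteq> disc \<Longrightarrow> (\<lambda>w. mob z (f w)) holomorphic_on A"
  unfolding mob_def using one_minus_cnj_mult_nz by (intro holomorphic_intros) auto

text \<open>In the disc \<open>|w - u| <= |1 - cnj w u|\<close>. Hence \<open>|1 - cnj z w|\<close>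
  obeys a triangle inequality, although it does not vanish for \<open>w = z\<close>.\<close>

lemma cmod_one_minus_triangle:
  assumes "z \<in> disc" "w \<in> disc" "u \<in> disc"
  shows "cmod (1 - cnj z * u) \<le> cmod (1 - cnj z * w) + cmod (1 - cnj w * u)"
proof -
  have "(cmod (w - u))\<^sup>2 \<le> (cmod (1 - cnj w * u))\<^sup>2"
    using assms unfolding cmod_sq_one_minus[of w u] by (auto simp: power_le_one)
  then have le: "cmod (w - u) \<le> cmod (1 - cnj w * u)"
    using power2_le_imp_le by fastforce
  have "1 - cnj z * u = (1 - cnj z * w) + cnj z * (w - u)" by (simp add: algebra_simps)
  then have "cmod (1 - cnj z * u) \<le> cmod (1 - cnj z * w) + cmod z * cmod (w - u)"
    by (metis norm_triangle_ineq norm_mult complex_mod_cnj)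
  also have "cmod z * cmod (w - u) \<le> 1 * cmod (w - u)"
    using assms by (intro mult_right_mono) auto
  finally show ?thesis using le by simp
qed

text \<open>\<open>mob z\<close> is its own inverse, so the substitution leaves only its Jacobian,
  which is the Berezin kernel. This moves estimates from the origin to \<open>z\<close>.\<close>

lemma nn_integral_dA_mob:
  assumes z: "z \<in> disc" and f [measurable]: "f \<in> borel_measurable borel"
  shows "(\<integral>\<^sup>+w. f (mob z w) \<partial>dA) =
     (\<integral>\<^sup>+w. f w * ennreal ((1 - (cmod z)\<^sup>2)\<^sup>2 / cmod (1 - cnj z * w) ^ 4) \<partial>dA)"
proof -
  have [measurable]: "mob z \<in> borel_measurable borel"
    unfolding mob_def by measurable
  have im: "mob z ` disc = disc"
  proof (intro equalityI subsetI)
    fix w assume "w \<in> disc"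
    then show "w \<in> mob z ` disc"
      by (intro image_eqI[of _ _ "mob z w"] mob_mob[OF z, symmetric] mob_in_disc[OF z])
  qed (use mob_in_disc[OF z] in blast)
  have inj: "inj_on (mob z) disc"
    using mob_mob[OF z] by (rule inj_on_inverseI)
  define g' where "g' = (\<lambda>w. - (1 - cnj z * z) / (1 - cnj z * w)\<^sup>2)"
  have [measurable]: "g' \<in> borel_measurable borel" unfolding g'_def by measurable
  have g'2: "(cmod (g' w))\<^sup>2 = (1 - (cmod z)\<^sup>2)\<^sup>2 / cmod (1 - cnj z * w) ^ 4" for w
  proof -
    have "1 - cnj z * z = of_real (1 - (cmod z)\<^sup>2)"
      using complex_norm_square[of z] by (simp add: mult.commute)
    then have "cmod (1 - cnj z * z) = 1 - (cmod z)\<^sup>2"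
      using z by (simp add: power_le_one abs_if del: of_real_diff) (smt (verit) power_le_one norm_ge_zero)
    then show ?thesis unfolding g'_def by (simp add: norm_divide norm_power power_divide norm_minus_commute)
  qed
  have "(\<integral>\<^sup>+w\<in>disc. f (mob z w) \<partial>lborel) = (\<integral>\<^sup>+w\<in>mob z ` disc. f (mob z w) \<partial>lborel)"
    by (simp add: im)
  also have "\<dots> = (\<integral>\<^sup>+w\<in>disc. f (mob z (mob z w)) * ennreal ((cmod (g' w))\<^sup>2) \<partial>lborel)"
    by (rule nn_integral_conformal_image) (use mob_has_derivative[OF z] inj in \<open>auto simp: im g'_def\<close>)
  also have "\<dots> = (\<integral>\<^sup>+w\<in>disc. f w * ennreal ((1 - (cmod z)\<^sup>2)\<^sup>2 / cmod (1 - cnj z * w) ^ 4) \<partial>lborel)"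
    by (intro nn_integral_cong) (auto simp: mob_mob[OF z] g'2 split: split_indicator)
  finally show ?thesis by (simp add: nn_integral_dA)
qed

lemma nn_integral_dA_rotate:
  assumes c: "cmod c = 1" and f [measurable]: "f \<in> borel_measurable borel"
  shows "(\<integral>\<^sup>+w. f (c * w) \<partial>dA) = (\<integral>\<^sup>+w. f w \<partial>dA)"
proof -
  have "c \<noteq> 0" using c by auto
  then have im: "(*) c ` disc = disc"
    using c by (auto simp: norm_mult norm_divide image_iff simp del: mem_ball intro!: bexI[of _ "_ / c"])
  have "(\<integral>\<^sup>+w\<in>(*) c ` disc. f w \<partial>lborel) = (\<integral>\<^sup>+w\<in>disc. f (c * w) * ennreal ((cmod c)\<^sup>2) \<partial>lborel)"
    using \<open>c \<noteq> 0\<close> by (intro nn_integral_conformal_image) (auto simp: im inj_on_def intro!: derivative_eq_intros)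
  then show ?thesis using c by (simp add: nn_integral_dA im)
qed

section \<open>Jensen's inequality against the Berezin kernel\<close>

lemma nn_integral_Icc_continuous:
  fixes f :: "real \<Rightarrow> real"
  assumes "continuous_on {a..b} f" "\<And>x. x \<in> {a..b} \<Longrightarrow> 0 \<le> f x"
  shows "(\<integral>\<^sup>+x\<in>{a..b}. ennreal (f x) \<partial>lborel) = ennreal (integral {a..b} f)"
  by (rule nn_integral_has_integral_lebesgue') (use assms integrable_continuous_real in \<open>auto simp: has_integral_integral\<close>)

text \<open>A zero-free \<open>h\<close> is \<open>exp g\<close> on a slightly larger disc, so
  \<open>|h|^s\<close> is the modulus of the holomorphic function \<open>exp (s * g)\<close>, which
  has the mean value property.\<close>

lemma circle_mean_powr_zero_free:
  assumes h: "h holomorphic_on ball 0 R" and r: "0 < r" "r < R" and s: "0 < s"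
    and nz: "\<And>w. w \<in> cball 0 r \<Longrightarrow> h w \<noteq> 0"
  shows "ennreal (cmod (h 0) powr s) \<le> (\<integral>\<^sup>+t\<in>{0..1}. ennreal (cmod (h (r * cis (2*pi*t))) powr s) \<partial>lborel)"
proof -
  have conth: "continuous_on (ball 0 R) h" by (rule holomorphic_on_imp_continuous_on[OF h])
  define U where "U = {w \<in> ball 0 R. h w \<noteq> 0}"
  have "open U"
  proof -
    have "open (ball 0 R \<inter> h -` (- {0}))"
      using conth by (intro continuous_open_preimage) auto
    then show ?thesis by (simp add: U_def Int_def vimage_def)
  qed
  moreover have "cball 0 r \<subseteq> U" using nz r by (auto simp: U_def)
  \<comment> \<open>The logarithm is taken on an open disc; compactness enlarges the closed disc by
    a zero-free margin \<open>e\<close>.\<close>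
  ultimately obtain e where e: "e > 0" "(\<Union>x\<in>cball 0 r. ball x e) \<subseteq> U"
    using compact_subset_open_imp_ball_epsilon_subset[of "cball (0::complex) r" U] by auto
  have sub: "ball 0 (r + e) \<subseteq> U"
  proof
    fix w :: complex assume w: "w \<in> ball 0 (r + e)"
    show "w \<in> U"
    proof (cases "cmod w \<le> r")
      case False
      \<comment> \<open>The radial projection of \<open>w\<close> to the circle of radius
        \<open>r\<close>; its distance to \<open>w\<close> is \<open>|w| - r < e\<close>.\<close>
      define x where "x = of_real (r / cmod w) * w"
      have "w - x = of_real (1 - r / cmod w) * w" by (simp add: x_def algebra_simps)
      then have "cmod (w - x) = \<bar>1 - r / cmod w\<bar> * cmod w" by (simp only: norm_mult norm_of_real)
      also have "\<dots> = cmod w - r" using False r by (auto simp: abs_if field_simps)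
      finally have "w \<in> ball x e" using w by (simp add: dist_norm norm_minus_commute)
      moreover have "x \<in> cball 0 r" using r False by (auto simp: x_def norm_mult norm_divide)
      ultimately show ?thesis using e by blast
    qed (use e in \<open>force\<close>)
  qed
  obtain g where g: "g holomorphic_on ball 0 (r + e)" "\<And>w. w \<in> ball 0 (r + e) \<Longrightarrow> h w = exp (g w)"
  proof (rule holomorphic_logarithm_exists[of "ball 0 (r + e)" h 0])
    show "h holomorphic_on ball 0 (r + e)"
      by (rule holomorphic_on_subset[OF h]) (use sub in \<open>auto simp: U_def\<close>)
  qed (use sub e r in \<open>auto simp: U_def\<close>)
  define H where "H = (\<lambda>w. exp (of_real s * g w))"
  have H: "H holomorphic_on ball 0 (r + e)"
    unfolding H_def by (intro holomorphic_intros g)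
  have Habs: "cmod (H w) = cmod (h w) powr s" if "w \<in> ball 0 (r + e)" for w
    using g(2)[OF that] by (simp add: H_def powr_def)
  have "((\<lambda>u. H u / (u - 0)) has_contour_integral (2 * of_real pi * \<i> * H 0)) (circlepath 0 r)"
    by (rule Cauchy_integral_circlepath_simple) (use r e in \<open>auto intro!: holomorphic_on_subset[OF H]\<close>)
  then have "((\<lambda>t. H (circlepath 0 r t) / circlepath 0 r t * vector_derivative (circlepath 0 r) (at t))
      has_integral (2 * of_real pi * \<i> * H 0)) {0..1}"
    by (simp add: has_contour_integral)
  also have "(\<lambda>t. H (circlepath 0 r t) / circlepath 0 r t * vector_derivative (circlepath 0 r) (at t))
      = (\<lambda>t. (2 * of_real pi * \<i>) * H (r * cis (2*pi*t)))"
    using r by (intro ext) (simp add: vector_derivative_circlepath, simp add: circlepath cis_conv_exp field_simps)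
  finally have "((\<lambda>t. (1 / (2 * of_real pi * \<i>)) * ((2 * of_real pi * \<i>) * H (r * cis (2*pi*t)))) has_integral (1 / (2 * of_real pi * \<i>)) * (2 * of_real pi * \<i> * H 0)) {0..1}"
    by (rule has_integral_mult_right)
  then have int: "((\<lambda>t. H (r * cis (2*pi*t))) has_integral H 0) {0..1}"
    by simp
  have contH: "continuous_on {0..1} (\<lambda>t. H (r * cis (2*pi*t)))"
    by (rule continuous_on_compose2[OF holomorphic_on_imp_continuous_on[OF H]])
       (use r e in \<open>auto intro!: continuous_intros simp: norm_mult\<close>)
  have "cmod (H 0) \<le> integral {0..1} (\<lambda>t. cmod (H (r * cis (2*pi*t))))"
    using int integral_norm_bound_integral[of "\<lambda>t. H (r * cis (2*pi*t))" "{0..1}" "\<lambda>t. cmod (H (r * cis (2*pi*t)))"]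
      integrable_continuous_real[OF continuous_on_norm[OF contH]]
    by (auto simp: has_integral_iff)
  then have "ennreal (cmod (H 0)) \<le> (\<integral>\<^sup>+t\<in>{0..1}. ennreal (cmod (H (r * cis (2*pi*t)))) \<partial>lborel)"
    by (subst nn_integral_Icc_continuous) (auto intro!: continuous_intros contH ennreal_leI)
  then show ?thesis
    using r e by (simp add: Habs norm_mult)
qed

text \<open>Only circles that avoid the zeros are treated. These are almost all circles, and the
  inequality is later integrated over the disc, where the exceptional radii form a null set.\<close>

lemma circle_mean_powr:
  assumes h: "h holomorphic_on disc" and r: "0 < r" "r < 1" and s: "0 < s"
    and nz: "\<And>w. cmod w = r \<Longrightarrow> h w \<noteq> 0" and h0: "h 0 \<noteq> 0"
  shows "ennreal (cmod (h 0) powr s) \<le> (\<integral>\<^sup>+t\<in>{0..1}. ennreal (cmod (h (r * cis (2*pi*t))) powr s) \<partial>lborel)"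
proof -
  have nconst: "\<not> h constant_on disc \<or> (\<forall>w\<in>disc. h w \<noteq> 0)"
    using h0 unfolding constant_on_def by (metis centre_in_ball zero_less_one)
  define B where "B = {b \<in> cball 0 r. h b = 0}"
  have fin: "finite {b \<in> cball 0 ((1 + r) / 2). h b = 0}"
    using nconst
  proof
    assume "\<not> h constant_on disc"
    then show ?thesis
      using r by (intro holomorphic_compact_finite_zeros[OF h]) auto
  next
    assume *: "\<forall>w\<in>disc. h w \<noteq> 0"
    have "{b \<in> cball 0 ((1 + r) / 2). h b = 0} = {}" using r * by force
    then show ?thesis by (metis finite.emptyI)
  qed
  have finB: "finite B"
    by (rule finite_subset[OF _ fin]) (use r in \<open>auto simp: B_def\<close>)
  have Bin: "b \<in> B \<Longrightarrow> cmod b < r" "b \<in> B \<Longrightarrow> b \<noteq> 0" for b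
    using nz h0 by (force simp: B_def le_less)+
  \<comment> \<open>There are finitely many zeros up to radius \<open>(1 + r) / 2\<close>, which
    leaves a gap beyond \<open>r\<close>: the factorisation can be made on an open disc that
    contains the closed one. The entry \<open>(1 + r) / 2\<close> makes \<open>V\<close> non-empty
    and keeps \<open>R\<close> below 1.\<close>
  have "\<exists>R>r. R \<le> 1 \<and> (\<forall>w\<in>ball 0 R. h w = 0 \<longrightarrow> w \<in> B)"
  proof -
    define V where "V = insert ((1 + r) / 2) (cmod ` {b \<in> cball 0 ((1 + r) / 2). h b = 0 \<and> r < cmod b})"
    have V: "finite V" "V \<noteq> {}"
      unfolding V_def by (auto intro!: finite_imageI intro: finite_subset[OF _ fin])
    have "Min V > r" using V r by (auto simp: V_def)
    moreover have le: "Min V \<le> (1 + r) / 2" using V by (intro Min_le) (auto simp: V_def)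
    moreover have "w \<in> B" if w: "w \<in> ball 0 (Min V)" "h w = 0" for w
    proof (rule ccontr)
      assume "w \<notin> B"
      then have "cmod w \<in> V" using w le r by (auto simp: V_def B_def)
      then have "Min V \<le> cmod w" using V by simp
      then show False using w by simp
    qed
    ultimately show ?thesis using r by (intro exI[of _ "Min V"]) auto
  qed
  then obtain R where R: "r < R" "R \<le> 1" "\<And>w. w \<in> ball 0 R \<Longrightarrow> h w = 0 \<Longrightarrow> w \<in> B" by blast
  define n where "n = (\<lambda>b. nat (zorder h b))"
  define P where "P = (\<lambda>w. \<Prod>b\<in>B. (w - b) ^ n b)"
  have ana: "h analytic_on {w}" if "w \<in> disc" for w
    using h that by (meson analytic_at open_ball)
  have freq: "\<exists>\<^sub>F w in at z. h w \<noteq> 0" if "z \<in> disc" for z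
    using non_zero_neighbour_alt[OF h open_ball connected_ball that, of 0] h0
    by (intro eventually_frequently) (auto elim: eventually_mono)
  have npos: "n b > 0" "zorder h b = int (n b)" if "b \<in> B" for b
  proof -
    have "zorder h b > 0"
      using that Bin[OF that] r zorder_pos_iff'[OF ana freq, of b] by (auto simp: B_def)
    then show "n b > 0" "zorder h b = int (n b)" by (auto simp: n_def)
  qed
  have P0: "P w = 0 \<longleftrightarrow> w \<in> B" for w
    using finB npos by (auto simp: P_def)
  have zP: "zorder P z = zorder h z" if z: "z \<in> ball 0 R" for z
  proof (cases "z \<in> B")
    case True
    have "zorder P z = int (n z)"
    proof (rule zorder_eqI[of UNIV _ "\<lambda>w. \<Prod>b\<in>B - {z}. (w - b) ^ n b"])
      show "(\<Prod>b\<in>B - {z}. (z - b) ^ n b) \<noteq> 0" using finB by auto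
      show "P w = (\<Prod>b\<in>B - {z}. (w - b) ^ n b) * (w - z) powi int (n z)" for w
        unfolding P_def using prod.remove[OF finB True, of "\<lambda>b. (w - b) ^ n b"] by (simp add: mult.commute)
    qed (auto intro!: holomorphic_intros)
    then show ?thesis using npos[OF True] by simp
  next
    case False
    then have "h z \<noteq> 0" using R z by auto
    moreover have "z \<in> disc" using z R by auto
    ultimately have "zorder h z = 0" by (intro zorder_eq_0I ana)
    moreover have "zorder P z = 0"
      by (rule zorder_eq_0I) (use False P0 in \<open>auto simp: P_def intro!: analytic_intros\<close>)
    ultimately show ?thesis by simp
  qed
  obtain k where k: "k holomorphic_on ball 0 R" "\<And>w. w \<in> ball 0 R \<Longrightarrow> k w \<noteq> 0"
      "\<And>w. w \<in> ball 0 R \<Longrightarrow> h w = k w * P w"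
  proof (rule holomorphic_zorder_factorization[of h "ball 0 R" P])
    show "h holomorphic_on ball 0 R" by (rule holomorphic_on_subset[OF h]) (use R in auto)
    show "P z = 0 \<longleftrightarrow> h z = 0" if "z \<in> ball 0 R" for z
      using that R P0 by (auto simp: B_def)
  qed (use zP in \<open>auto simp: P_def intro!: holomorphic_intros\<close>)
  \<comment> \<open>reflecting the zeros in the circle keeps the modulus there and increases it at 0\<close>
  define Q where "Q = (\<lambda>w. \<Prod>b\<in>B. ((r\<^sup>2 - cnj b * w) / r) ^ n b)"
  have Qabs: "cmod (Q w) = cmod (P w)" if "cmod w = r" for w
  proof -
    have "cmod (r\<^sup>2 - cnj b * w) = r * cmod (w - b)" for b
    proof -
      have "r\<^sup>2 - cnj b * w = w * cnj (w - b)"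
        using that complex_norm_square[of w] by (simp add: algebra_simps)
      then show ?thesis using that by (simp add: norm_mult del: complex_cnj_diff)
    qed
    then show ?thesis using r by (simp add: Q_def P_def norm_divide norm_power norm_mult flip: prod_norm)
  qed
  have Qnz: "Q w \<noteq> 0" if "w \<in> cball 0 r" for w
  proof -
    have "r\<^sup>2 - cnj b * w \<noteq> 0" if "b \<in> B" for b
    proof
      assume "r\<^sup>2 - cnj b * w = 0"
      then have "r\<^sup>2 = cmod (cnj b * w)"
        by (metis eq_iff_diff_eq_0 norm_of_real abs_power2)
      also have "\<dots> \<le> cmod b * r" using \<open>w \<in> cball 0 r\<close> by (auto simp: norm_mult intro!: mult_left_mono)
      also have "\<dots> < r * r" using Bin[OF that] r by (intro mult_strict_right_mono) auto
      finally show False by (simp add: power2_eq_square)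
    qed
    then show ?thesis using finB r by (auto simp: Q_def)
  qed
  have Qhol: "Q holomorphic_on ball 0 R"
    unfolding Q_def using r by (intro holomorphic_intros) auto
  have "cmod (P 0) \<le> cmod (Q 0)"
  proof -
    have "cmod (P 0) = (\<Prod>b\<in>B. cmod b ^ n b)" by (simp add: P_def norm_power flip: prod_norm)
    also have "\<dots> \<le> (\<Prod>b\<in>B. r ^ n b)" by (intro prod_mono conjI power_mono less_imp_le[OF Bin(1)]) auto
    also have "\<dots> = cmod (Q 0)"
      using r by (simp add: Q_def norm_power norm_divide power2_eq_square flip: prod_norm)
    finally show ?thesis .
  qed
  then have "cmod (h 0) \<le> cmod (k 0 * Q 0)"
    using k(3)[of 0] r R by (simp add: norm_mult mult_left_mono)
  then have "ennreal (cmod (h 0) powr s) \<le> ennreal (cmod (k 0 * Q 0) powr s)"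
    using s by (intro ennreal_leI powr_mono2) auto
  also have "\<dots> \<le> (\<integral>\<^sup>+t\<in>{0..1}. ennreal (cmod (k (r * cis (2*pi*t)) * Q (r * cis (2*pi*t))) powr s) \<partial>lborel)"
    by (rule circle_mean_powr_zero_free[of "\<lambda>w. k w * Q w" R])
       (use k Qhol Qnz r R s in \<open>auto intro!: holomorphic_intros\<close>)
  also have "\<dots> = (\<integral>\<^sup>+t\<in>{0..1}. ennreal (cmod (h (r * cis (2*pi*t))) powr s) \<partial>lborel)"
    using r R by (intro nn_integral_cong) (simp add: k(3) norm_mult Qabs)
  finally show ?thesis .
qed

lemma ennreal_integral_le_nn_integral:
  fixes f :: "'a \<Rightarrow> real"
  assumes "integrable M f"
  shows "ennreal (\<integral>x. f x \<partial>M) \<le> (\<integral>\<^sup>+x. ennreal (f x) \<partial>M)"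
proof -
  have "ennreal (\<integral>x. f x \<partial>M) \<le> ennreal (\<integral>x. max 0 (f x) \<partial>M)"
    using assms by (intro ennreal_leI integral_mono) auto
  also have "\<dots> = (\<integral>\<^sup>+x. ennreal (max 0 (f x)) \<partial>M)"
    using assms by (intro nn_integral_eq_integral[symmetric]) auto
  finally show ?thesis by (simp add: ennreal_max_0)
qed

lemma AE_dA:
  assumes "AE w in lborel. P w"
  shows "AE w in dA. P w"
proof -
  obtain N where N: "{w. \<not> P w} \<subseteq> N" "emeasure lborel N = 0" "N \<in> sets borel"
    using AE_E[OF assms] by auto
  have "emeasure lborel (disc \<inter> N) \<le> emeasure lborel N"
    using N by (intro emeasure_mono) auto
  then have "emeasure dA (disc \<inter> N) = 0"
    using N unfolding dA_def
    by (subst emeasure_scale_measure) (auto simp: emeasure_restrict_space emeasure_completion sets_restrict_space)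
  moreover have "disc \<inter> N \<in> sets dA"
    using N by (auto simp: sets_dA sets_restrict_space intro!: imageI)
  ultimately have "disc \<inter> N \<in> null_sets dA" by (auto simp: null_sets_def)
  then show ?thesis
    using N by (intro AE_I'[of "disc \<inter> N"]) auto
qed

text \<open>A countable union of circles is a null set; this discards the circles that meet a
  zero.\<close>

lemma AE_dA_cmod_notin:
  assumes "countable C"
  shows "AE w in dA. cmod w \<notin> C"
proof -
  have "(\<Union>r\<in>C. sphere 0 r) \<in> null_sets (lborel :: complex measure)"
  proof (rule null_sets_UN'[OF assms])
    fix r assume "r \<in> C"
    show "sphere 0 r \<in> null_sets (lborel :: complex measure)"
      using negligible_sphere[of "0::complex" r]
      by (auto simp: negligible_iff_null_sets null_sets_completion_iff)
  qed
  then have "AE w in lborel. w \<notin> (\<Union>r\<in>C. sphere (0::complex) r)"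
    by (rule AE_not_in)
  then show ?thesis
    by (intro AE_dA) (auto elim!: eventually_mono)
qed

text \<open>Layer cake: \<open>- ln (max |w| b)\<close> is the integral of \<open>1 / t\<close> over
  those \<open>t\<close> in \<open>[b, 1]\<close> with \<open>t > |w|\<close>, and
  \<open>{|w| < t}\<close> has normalised area \<open>t^2\<close>. What remains is the integral of
  \<open>t\<close> over \<open>[b, 1]\<close>.\<close>

lemma nn_integral_dA_ln_max:
  assumes "0 < b" "b < 1"
  shows "(\<integral>\<^sup>+w. ennreal (- ln (max (cmod w) b)) \<partial>dA) = ennreal ((1 - b\<^sup>2) / 2)"
proof -
  interpret pair_sigma_finite dA "lborel :: real measure"
    by unfold_locales
  have inner: "ennreal (- ln (max (cmod w) b)) = (\<integral>\<^sup>+t. ennreal (1 / t) * indicator {b..1} t * indicator {..<t} (cmod w) \<partial>lborel)"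
    if w: "w \<in> disc" for w
  proof -
    have "(\<integral>\<^sup>+t. ennreal (1 / t) * indicator {b..1} t * indicator {..<t} (cmod w) \<partial>lborel)
       = (\<integral>\<^sup>+t. ennreal (1 / t) * indicator {max (cmod w) b..1} t \<partial>lborel)"
      by (intro nn_integral_cong_AE eventually_mono[OF AE_lborel_singleton[of "cmod w"]]) (auto split: split_indicator)
    also have "\<dots> = ennreal (ln 1 - ln (max (cmod w) b))"
      using assms w by (intro nn_integral_FTC_Icc) (auto intro!: derivative_eq_intros simp: less_max_iff_disj max_def split: if_splits)
    finally show ?thesis by simp
  qed
  have meas: "(\<integral>\<^sup>+w. indicator {..<t} (cmod w) \<partial>dA) = ennreal (t\<^sup>2)" if "0 < t" "t \<le> 1" for t
  proof -
    have "(\<integral>\<^sup>+w. indicator {..<t} (cmod w) \<partial>dA) = (\<integral>\<^sup>+w. indicator (ball 0 t) w \<partial>dA)"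
      by (intro nn_integral_cong) (auto split: split_indicator)
    also have "\<dots> = emeasure dA (ball 0 t)"
      using that by (intro nn_integral_indicator) (auto simp: sets_dA sets_restrict_space intro!: image_eqI[of _ _ "ball 0 t"])
    also have "\<dots> = ennreal (t\<^sup>2)"
      by (rule emeasure_dA_ball) (use that in auto)
    finally show ?thesis .
  qed
  have "(\<integral>\<^sup>+w. ennreal (- ln (max (cmod w) b)) \<partial>dA)
     = (\<integral>\<^sup>+w. (\<integral>\<^sup>+t. ennreal (1 / t) * indicator {b..1} t * indicator {..<t} (cmod w) \<partial>lborel) \<partial>dA)"
    by (intro nn_integral_cong inner) simp
  also have "\<dots> = (\<integral>\<^sup>+t. (\<integral>\<^sup>+w. ennreal (1 / t) * indicator {b..1} t * indicator {..<t} (cmod w) \<partial>dA) \<partial>lborel)"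
  proof (rule Fubini'[symmetric])
    have [measurable]: "(\<lambda>x. cmod (fst x)) \<in> borel_measurable (dA \<Otimes>\<^sub>M (lborel::real measure))"
      by (rule measurable_compose[OF measurable_fst]) (rule borel_imp_measurable_dA, simp)
    have "(\<lambda>(x, t). ennreal (1 / t) * indicator {b..1} t * (if cmod x < t then 1 else 0)) \<in> borel_measurable (dA \<Otimes>\<^sub>M (lborel::real measure))"
      unfolding split_beta' by measurable
    also have "(\<lambda>(x, t). ennreal (1 / t) * indicator {b..1} t * (if cmod x < t then 1 else 0)) =
       (\<lambda>(x, t). ennreal (1 / t) * indicator {b..1} t * indicator {..<t} (cmod x))"
      by (auto simp: fun_eq_iff)
    finally show "(\<lambda>(x, t). ennreal (1 / t) * indicator {b..1} t * indicator {..<t} (cmod x)) \<in> borel_measurable (dA \<Otimes>\<^sub>M lborel)" .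
  qed
  also have "\<dots> = (\<integral>\<^sup>+t. ennreal t * indicator {b..1} t \<partial>lborel)"
  proof (intro nn_integral_cong)
    fix t :: real
    have "(\<integral>\<^sup>+w. ennreal (1 / t) * indicator {b..1} t * indicator {..<t} (cmod w) \<partial>dA)
       = ennreal (1 / t) * indicator {b..1} t * (\<integral>\<^sup>+w. indicator {..<t} (cmod w) \<partial>dA)"
      by (intro nn_integral_cmult borel_imp_measurable_dA) auto
    also have "\<dots> = ennreal t * indicator {b..1} t"
      using assms by (auto simp: meas power2_eq_square split: split_indicator simp flip: ennreal_mult)
    finally show "(\<integral>\<^sup>+w. ennreal (1 / t) * indicator {b..1} t * indicator {..<t} (cmod w) \<partial>dA) = ennreal t * indicator {b..1} t" .
  qed
  also have "\<dots> = ennreal (1\<^sup>2 / 2 - b\<^sup>2 / 2)"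
    using assms by (intro nn_integral_FTC_Icc) (auto intro!: derivative_eq_intros)
  finally show ?thesis by (simp add: diff_divide_distrib)
qed

text \<open>The circle is parametrised by rotating a given point \<open>w\<close>, so that an area
  integral over \<open>w\<close> can follow without polar coordinates.\<close>

lemma circle_mean_powr_at:
  assumes h: "h holomorphic_on disc" and w: "w \<noteq> 0" "w \<in> disc" and s: "0 < s"
    and nz: "\<And>u. cmod u = cmod w \<Longrightarrow> h u \<noteq> 0" and h0: "h 0 \<noteq> 0"
  shows "ennreal (cmod (h 0) powr s) \<le> (\<integral>\<^sup>+t\<in>{0..1}. ennreal (cmod (h (cis (2*pi*t) * w)) powr s) \<partial>lborel)"
proof -
  define c where "c = w / cmod w"
  have c: "cmod c = 1" "w = c * cmod w" using w by (auto simp: c_def norm_divide)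
  have "ennreal (cmod (h (c * 0)) powr s)
      \<le> (\<integral>\<^sup>+t\<in>{0..1}. ennreal (cmod (h (c * (cmod w * cis (2*pi*t)))) powr s) \<partial>lborel)"
  proof (rule circle_mean_powr[of "\<lambda>u. h (c * u)"])
    show "(\<lambda>u. h (c * u)) holomorphic_on disc"
      by (rule holomorphic_on_compose_gen[OF _ h, unfolded o_def])
         (use c in \<open>auto intro!: holomorphic_intros simp: norm_mult\<close>)
  qed (use assms c in \<open>auto simp: norm_mult\<close>)
  also have "\<dots> = (\<integral>\<^sup>+t\<in>{0..1}. ennreal (cmod (h (cis (2*pi*t) * w)) powr s) \<partial>lborel)"
    by (subst (2) c(2)) (simp add: mult_ac)
  finally show ?thesis by simp
qed

text \<open>Replacing the disc factors of the points inside the circle by those of the smaller disc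
  leaves the modulus on the circle unchanged.\<close>

lemma circle_mean_powr_zeros:
  assumes G: "G holomorphic_on disc" and I: "finite I" and a: "\<And>i. i \<in> I \<Longrightarrow> a i \<in> disc" "\<And>i. i \<in> I \<Longrightarrow> a i \<noteq> 0"
    and w: "w \<noteq> 0" "w \<in> disc" and s: "0 < s"
    and f: "\<And>u. u \<in> disc \<Longrightarrow> f u = G u * (\<Prod>i\<in>I. mob (a i) u)"
    and nz: "\<And>u. cmod u = cmod w \<Longrightarrow> f u \<noteq> 0" and G0: "G 0 \<noteq> 0"
  shows "ennreal ((cmod (G 0) * (\<Prod>i\<in>I. max (cmod w) (cmod (a i)))) powr s)
    \<le> (\<integral>\<^sup>+t\<in>{0..1}. ennreal (cmod (f (cis (2*pi*t) * w)) powr s) \<partial>lborel)"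
proof -
  define r where "r = cmod w"
  have r: "0 < r" "r < 1" using w by (auto simp: r_def)
  define k where "k = (\<lambda>i u. if cmod (a i) < r then (r\<^sup>2 - cnj (a i) * u) / (r * (1 - cnj (a i) * u)) else mob (a i) u)"
  define h where "h = (\<lambda>u. G u * (\<Prod>i\<in>I. k i u))"
  have den: "1 - cnj (a i) * u \<noteq> 0" if "i \<in> I" "u \<in> disc" for i u
    using one_minus_cnj_mult_nz[OF a(1)[OF that(1)] that(2)] by simp
  have khol: "k i holomorphic_on disc" if "i \<in> I" for i
    using r a(1)[OF that] den[OF that]
    by (cases "cmod (a i) < r") (auto simp: k_def intro!: holomorphic_intros)
  have kabs: "cmod (k i u) = cmod (mob (a i) u)" if "cmod u = r" "i \<in> I" for i u
  proof -
    have "r\<^sup>2 - cnj (a i) * u = u * cnj (u - a i)"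
      using that complex_norm_square[of u] by (simp add: algebra_simps)
    then show ?thesis using that r by (simp add: k_def mob_def norm_mult norm_divide norm_minus_commute del: complex_cnj_diff)
  qed
  have habs: "cmod (h u) = cmod (f u)" if "cmod u = r" for u
    using that r f[of u] by (simp add: h_def norm_mult kabs flip: prod_norm)
  \<comment> \<open>At 0 a factor of the smaller disc has modulus \<open>r\<close>, an unchanged one
    modulus \<open>|a i|\<close>; this produces the maximum.\<close>
  have k0: "cmod (k i 0) = max r (cmod (a i))" for i
    using r by (simp add: k_def mob_def power2_eq_square)
  have h0: "cmod (h 0) = cmod (G 0) * (\<Prod>i\<in>I. max r (cmod (a i)))"
    by (simp add: h_def norm_mult k0 flip: prod_norm)
  have "ennreal (cmod (h 0) powr s) \<le> (\<integral>\<^sup>+t\<in>{0..1}. ennreal (cmod (h (cis (2*pi*t) * w)) powr s) \<partial>lborel)"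
  proof (rule circle_mean_powr_at)
    show "h holomorphic_on disc" unfolding h_def by (intro holomorphic_intros G khol)
    show "h u \<noteq> 0" if "cmod u = cmod w" for u
      using habs[of u] nz[OF that] that by (auto simp: r_def)
    have "cmod (h 0) > 0"
      unfolding h0 using G0 r by (intro mult_pos_pos prod_pos) (auto simp: less_max_iff_disj)
    then show "h 0 \<noteq> 0" by auto
  qed (use w s in auto)
  also have "\<dots> = (\<integral>\<^sup>+t\<in>{0..1}. ennreal (cmod (f (cis (2*pi*t) * w)) powr s) \<partial>lborel)"
    by (intro nn_integral_cong) (simp add: habs norm_mult r_def)
  finally show ?thesis by (simp add: h0 r_def)
qed

lemma countable_zeros_disc:
  assumes "f holomorphic_on disc" "z0 \<in> disc" "f z0 \<noteq> 0"
  shows "countable {z \<in> disc. f z = 0}"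
proof (cases "f constant_on disc")
  case True
  then have "{z \<in> disc. f z = 0} = {}" using assms by (auto simp: constant_on_def)
  then show ?thesis by (metis countable_empty)
next
  case False
  have "finite {z \<in> cball 0 (1 - inverse (real (Suc n))). f z = 0}" for n
  proof (rule holomorphic_compact_finite_zeros[OF assms(1) open_ball connected_ball _ _ False])
    have lt: "1 - inverse (real (Suc n)) < 1" by simp
    show "cball 0 (1 - inverse (real (Suc n))) \<subseteq> disc"
      using le_less_trans[OF _ lt] by (auto simp del: of_nat_Suc)
  qed simp
  then have "countable (\<Union>n. {z \<in> cball 0 (1 - inverse (real (Suc n))). f z = 0})"
    by (intro countable_UN countableI_type countable_finite)
  moreover have "{z \<in> disc. f z = 0} \<subseteq> (\<Union>n. {z \<in> cball 0 (1 - inverse (real (Suc n))). f z = 0})"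
  proof
    fix z assume z: "z \<in> {z \<in> disc. f z = 0}"
    then obtain n where "inverse (real (Suc n)) < 1 - cmod z"
      using reals_Archimedean[of "1 - cmod z"] by auto
    then show "z \<in> (\<Union>n. {z \<in> cball 0 (1 - inverse (real (Suc n))). f z = 0})"
      using z by (intro UN_I[of n]) auto
  qed
  ultimately show ?thesis by (rule countable_subset[rotated])
qed

text \<open>The circle inequality is averaged over \<open>w\<close>. On the left, convexity of
  \<open>exp\<close> bounds the average of \<open>exp (s * X)\<close> from below through the mean
  \<open>m\<close> of \<open>X\<close>. On the right, the mean over rotations disappears because
  \<open>dA\<close> is rotation invariant.\<close>

lemma jensen_disc_origin:
  assumes G: "G holomorphic_on disc" and I: "finite I" and a: "\<And>i. i \<in> I \<Longrightarrow> a i \<in> disc" "\<And>i. i \<in> I \<Longrightarrow> a i \<noteq> 0"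
    and s: "0 < s" and f: "\<And>u. u \<in> disc \<Longrightarrow> f u = G u * (\<Prod>i\<in>I. mob (a i) u)" and G0: "G 0 \<noteq> 0"
    and [measurable]: "f \<in> borel_measurable borel"
  shows "ennreal ((cmod (G 0) * (\<Prod>i\<in>I. exp (- (1 - (cmod (a i))\<^sup>2) / 2))) powr s)
    \<le> (\<integral>\<^sup>+w. ennreal (cmod (f w) powr s) \<partial>dA)"
proof -
  interpret pair_sigma_finite dA "lborel :: real measure"
    by unfold_locales
  define F where "F = (\<lambda>w. ennreal (cmod (f w) powr s))"
  have F [measurable]: "F \<in> borel_measurable borel" unfolding F_def by measurable
  have fhol: "f holomorphic_on disc"
    by (rule holomorphic_cong[THEN iffD2, OF refl f])
       (use a in \<open>auto intro!: holomorphic_intros G\<close>)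
  have f0: "f 0 \<noteq> 0" using f[of 0] G0 a I by (auto simp: mob_def)
  have "countable (insert 0 (cmod ` {z \<in> disc. f z = 0}))"
    using countable_zeros_disc[OF fhol _ f0] by simp
  from AE_dA_cmod_notin[OF this]
  have ae: "AE w in dA. w \<noteq> 0 \<and> (\<forall>u\<in>disc. cmod u = cmod w \<longrightarrow> f u \<noteq> 0)"
    by eventually_elim (auto simp: image_iff)
  define X where "X = (\<lambda>w. ln (cmod (G 0)) + (\<Sum>i\<in>I. ln (max (cmod w) (cmod (a i)))))"
  have Xexp: "(cmod (G 0) * (\<Prod>i\<in>I. max (cmod w) (cmod (a i)))) powr s = exp (s * X w)" for w
  proof -
    have pos: "max (cmod w) (cmod (a i)) > 0" if "i \<in> I" for i using a(2)[OF that] by (auto simp: less_max_iff_disj)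
    then have "(\<Prod>i\<in>I. max (cmod w) (cmod (a i))) > 0" by (intro prod_pos) auto
    then have "ln (cmod (G 0) * (\<Prod>i\<in>I. max (cmod w) (cmod (a i)))) = X w"
      using G0 pos I unfolding X_def by (subst ln_mult) (auto simp: ln_prod less_imp_neq[THEN not_sym])
    then show ?thesis using G0 \<open>(\<Prod>i\<in>I. max (cmod w) (cmod (a i))) > 0\<close> by (simp add: powr_def)
  qed
  define y where "y = (\<lambda>i. (1 - (cmod (a i))\<^sup>2) / 2)"
  define m where "m = ln (cmod (G 0)) - (\<Sum>i\<in>I. y i)"
  have "(\<Prod>i\<in>I. exp (- (1 - (cmod (a i))\<^sup>2) / 2)) = (\<Prod>i\<in>I. exp (- y i))"
    by (simp only: y_def minus_divide_left)
  also have "\<dots> = exp (- (\<Sum>i\<in>I. y i))"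
    using I by (simp only: exp_sum[symmetric] sum_negf)
  finally have mexp: "(cmod (G 0) * (\<Prod>i\<in>I. exp (- (1 - (cmod (a i))\<^sup>2) / 2))) powr s = exp (s * m)"
    using G0 by (simp add: powr_def m_def ln_mult)
  have intln: "integrable dA (\<lambda>w. - ln (max (cmod w) (cmod (a i))))"
       "(\<integral>w. - ln (max (cmod w) (cmod (a i))) \<partial>dA) = (1 - (cmod (a i))\<^sup>2) / 2" if i: "i \<in> I" for i
  proof -
    have nn: "(\<integral>\<^sup>+w. ennreal (- ln (max (cmod w) (cmod (a i)))) \<partial>dA) = ennreal ((1 - (cmod (a i))\<^sup>2) / 2)"
      using a[OF i] by (intro nn_integral_dA_ln_max) auto
    have ge: "AE w in dA. 0 \<le> - ln (max (cmod w) (cmod (a i)))"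
      by (rule AE_I2) (use a[OF i] in \<open>auto simp: ln_le_zero_iff less_max_iff_disj\<close>)
    have me: "(\<lambda>w. - ln (max (cmod w) (cmod (a i)))) \<in> borel_measurable dA"
      by (rule borel_imp_measurable_dA) measurable
    show "integrable dA (\<lambda>w. - ln (max (cmod w) (cmod (a i))))"
      using integrableI_nn_integral_finite[OF me ge nn] a[OF i] by (simp add: power_le_one)
    show "(\<integral>w. - ln (max (cmod w) (cmod (a i))) \<partial>dA) = (1 - (cmod (a i))\<^sup>2) / 2"
      using nn a[OF i] by (subst integral_eq_nn_integral[OF me ge]) (simp add: power_le_one)
  qed
  have dA1: "measure dA disc = 1" by (simp add: measure_def)
  have Xint: "integrable dA X" "(\<integral>w. X w \<partial>dA) = m"
  proof -
    have X: "X = (\<lambda>w. ln (cmod (G 0)) - (\<Sum>i\<in>I. - ln (max (cmod w) (cmod (a i)))))"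
      by (simp add: X_def fun_eq_iff sum_negf)
    show "integrable dA X" unfolding X by (intro Bochner_Integration.integrable_diff Bochner_Integration.integrable_sum intln dA.integrable_const)
    show "(\<integral>w. X w \<partial>dA) = m"
    proof -
      have "(\<integral>w. X w \<partial>dA) = ln (cmod (G 0)) - (\<Sum>i\<in>I. (\<integral>w. - ln (max (cmod w) (cmod (a i))) \<partial>dA))"
        unfolding X
        by (subst Bochner_Integration.integral_diff, rule dA.integrable_const,
            intro Bochner_Integration.integrable_sum intln, assumption,
            subst Bochner_Integration.integral_sum, rule intln, assumption, simp add: dA1)
      also have "(\<Sum>i\<in>I. (\<integral>w. - ln (max (cmod w) (cmod (a i))) \<partial>dA)) = (\<Sum>i\<in>I. y i)"
        unfolding y_def by (intro sum.cong refl intln(2))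
      finally have "(\<integral>w. X w \<partial>dA) = m" unfolding m_def .
      then show ?thesis .
    qed
  qed
  \<comment> \<open>Jensen's inequality through the tangent of \<open>exp\<close> at
    \<open>s * m\<close>: the linear term integrates to 0, as \<open>dA\<close> has mass 1 and
    \<open>X\<close> has mean \<open>m\<close>.\<close>
  have "ennreal (exp (s * m)) = ennreal (\<integral>w. exp (s * m) * (1 + s * (X w - m)) \<partial>dA)"
    using Xint by (simp add: dA1)
  also have "\<dots> \<le> (\<integral>\<^sup>+w. ennreal (exp (s * m) * (1 + s * (X w - m))) \<partial>dA)"
    using Xint by (intro ennreal_integral_le_nn_integral) auto
  also have "\<dots> \<le> (\<integral>\<^sup>+w. ennreal (exp (s * X w)) \<partial>dA)"
  proof (intro nn_integral_mono ennreal_leI)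
    fix w
    have "1 + (s * X w - s * m) \<le> exp (s * X w - s * m)" by (rule exp_ge_add_one_self)
    then have "exp (s * m) * (1 + (s * X w - s * m)) \<le> exp (s * m) * exp (s * X w - s * m)"
      by (intro mult_left_mono) auto
    then show "exp (s * m) * (1 + s * (X w - m)) \<le> exp (s * X w)"
      by (simp add: right_diff_distrib flip: exp_add)
  qed
  also have "\<dots> \<le> (\<integral>\<^sup>+w. (\<integral>\<^sup>+t. F (cis (2*pi*t) * w) * indicator {0..1} t \<partial>lborel) \<partial>dA)"
  proof (rule nn_integral_mono_AE)
    have sp: "AE w in dA. w \<in> disc" by (rule AE_I2) simp
    show "AE w in dA. ennreal (exp (s * X w)) \<le> (\<integral>\<^sup>+t. F (cis (2*pi*t) * w) * indicator {0..1} t \<partial>lborel)"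
      using ae sp
    proof eventually_elim
      case (elim w)
      show ?case unfolding F_def Xexp[symmetric]
        by (rule circle_mean_powr_zeros[OF G I a]) (use elim s f G0 in auto)
    qed
  qed
  also have "\<dots> = (\<integral>\<^sup>+t. (\<integral>\<^sup>+w. F (cis (2*pi*t) * w) * indicator {0..1} t \<partial>dA) \<partial>lborel)"
  proof (rule Fubini'[symmetric])
    have [measurable]: "(\<lambda>x. fst x) \<in> measurable (dA \<Otimes>\<^sub>M (lborel::real measure)) borel"
      by (rule measurable_compose[OF measurable_fst]) (rule borel_imp_measurable_dA, simp)
    have [measurable]: "cis \<in> borel_measurable borel"
      by (intro borel_measurable_continuous_onI continuous_intros)
    show "(\<lambda>(w, t). F (cis (2*pi*t) * w) * indicator {0..1} t) \<in> borel_measurable (dA \<Otimes>\<^sub>M lborel)"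
      unfolding split_beta' by measurable
  qed
  also have "\<dots> = (\<integral>\<^sup>+t. (\<integral>\<^sup>+w. F w \<partial>dA) * indicator {0..1} (t::real) \<partial>lborel)"
  proof (intro nn_integral_cong)
    fix t :: real
    have "(\<integral>\<^sup>+w. F (cis (2*pi*t) * w) * indicator {0..1} t \<partial>dA) = (\<integral>\<^sup>+w. F (cis (2*pi*t) * w) \<partial>dA) * indicator {0..1} t"
      by (intro nn_integral_multc borel_imp_measurable_dA) measurable
    then show "(\<integral>\<^sup>+w. F (cis (2*pi*t) * w) * indicator {0..1} t \<partial>dA) = (\<integral>\<^sup>+w. F w \<partial>dA) * indicator {0..1} t"
      by (simp add: nn_integral_dA_rotate)
  qed
  also have "\<dots> = (\<integral>\<^sup>+w. F w \<partial>dA)"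
    by (simp add: nn_integral_cmult_indicator)
  finally have "ennreal (exp (s * m)) \<le> (\<integral>\<^sup>+w. F w \<partial>dA)" .
  then show ?thesis unfolding mexp F_def .
qed

text \<open>A composite of two automorphisms is an automorphism, fixed by its zero up to a
  unimodular constant; here the zero is \<open>mob z a\<close>. So the substitution
  \<open>mob z\<close> replaces the factor of \<open>a\<close> by that of
  \<open>mob z a\<close>.\<close>

lemma mob_mob_eq:
  assumes "z \<in> disc" "a \<in> disc" "w \<in> disc"
  shows "mob a (mob z w) = - ((1 - cnj z * a) / (1 - cnj a * z)) * mob (mob z a) w"
proof -
  have nz: "1 - cnj z * w \<noteq> 0" "1 - cnj z * a \<noteq> 0" "1 - cnj a * z \<noteq> 0"
    "1 - cnj a * mob z w \<noteq> 0" "1 - cnj (mob z a) * w \<noteq> 0"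
    by (intro one_minus_cnj_mult_nz(1) assms mob_in_disc)+
  have c: "cnj (1 - cnj z * a) = 1 - cnj a * z" by simp
  have 1: "1 - cnj a * mob z w = ((1 - cnj z * w) - cnj a * (z - w)) / (1 - cnj z * w)"
    using nz by (simp add: mob_def field_simps)
  have 2: "1 - cnj (mob z a) * w = ((1 - cnj a * z) - cnj (z - a) * w) / (1 - cnj a * z)"
    using nz c by (simp add: mob_def field_simps)
  have 3: "a - mob z w = (a * (1 - cnj z * w) - (z - w)) / (1 - cnj z * w)"
    using nz by (simp add: mob_def field_simps)
  have 4: "mob z a - w = ((z - a) - w * (1 - cnj z * a)) / (1 - cnj z * a)"
    using nz by (simp add: mob_def field_simps)
  have d: "(1 - cnj z * w) - cnj a * (z - w) = (1 - cnj a * z) - cnj (z - a) * w"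
    by (simp add: algebra_simps)
  have m1: "mob a (mob z w) = (a * (1 - cnj z * w) - (z - w)) / ((1 - cnj a * z) - cnj (z - a) * w)"
    unfolding mob_def[of a] 1 3 d using nz(1) by simp
  have m2: "mob (mob z a) w = ((z - a) - w * (1 - cnj z * a)) / (1 - cnj z * a) * ((1 - cnj a * z) / ((1 - cnj a * z) - cnj (z - a) * w))"
    unfolding mob_def[of "mob z a"] 2 4 by simp
  have e: "a * (1 - cnj z * w) - (z - w) = - ((z - a) - w * (1 - cnj z * a))" by (simp add: algebra_simps)
  have q: "- N / D = - (x / y) * (N / x * (y / D))" if "x \<noteq> 0" "y \<noteq> 0" for N D x y :: complex
    using that by simp
  show ?thesis unfolding m1 m2 e by (rule q[OF nz(2,3)])
qed

lemma cmod_mob_commute: "cmod (mob a z) = cmod (mob z a)"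
  by (simp add: mob_def norm_divide norm_minus_commute[of a] cmod_one_minus_commute[of a])

text \<open>The factor \<open>exp (- (1 - b\<^sup>2) / 2)\<close> is the exponential of the area mean of \<open>ln (max |w| b)\<close>.\<close>

lemma jensen_disc:
  assumes G: "G holomorphic_on disc" and I: "finite I" and a: "\<And>i. i \<in> I \<Longrightarrow> a i \<in> disc" "\<And>i. i \<in> I \<Longrightarrow> a i \<noteq> z"
    and z: "z \<in> disc" and s: "0 < s" and f: "\<And>u. u \<in> disc \<Longrightarrow> f u = G u * (\<Prod>i\<in>I. mob (a i) u)"
  shows "ennreal ((cmod (G z) * (\<Prod>i\<in>I. exp (- (1 - (cmod (mob (a i) z))\<^sup>2) / 2))) powr s)
    \<le> (\<integral>\<^sup>+w. ennreal (cmod (f w) powr s * ((1 - (cmod z)\<^sup>2)\<^sup>2 / cmod (1 - cnj z * w) ^ 4)) \<partial>dA)"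
proof (cases "G z = 0")
  case False
  define F where "F = (\<lambda>u. if u \<in> disc then f u else 0)"
  have fhol: "f holomorphic_on disc"
    by (rule holomorphic_cong[THEN iffD2, OF refl f])
       (use a in \<open>auto intro!: holomorphic_intros G\<close>)
  have [measurable]: "F \<in> borel_measurable borel" unfolding F_def
    by (rule borel_measurable_continuous_on_if) (auto intro!: holomorphic_on_imp_continuous_on fhol)
  have [measurable]: "mob z \<in> borel_measurable borel" unfolding mob_def by measurable
  define b where "b = (\<lambda>i. mob z (a i))"
  \<comment> \<open>The unimodular constants of \<open>mob_mob_eq\<close>; their product is absorbed
    by \<open>G'\<close> and does not change its modulus.\<close>
  define \<eta> where "\<eta> = (\<lambda>i. - ((1 - cnj z * a i) / (1 - cnj (a i) * z)))"
  have eta: "cmod (\<eta> i) = 1" if "i \<in> I" for i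
    using one_minus_cnj_mult_nz(2)[OF z a(1)[OF that]] unfolding \<eta>_def norm_minus_cancel norm_divide
    by (subst cmod_one_minus_commute[of "a i"]) auto
  define G' where "G' = (\<lambda>w. (\<Prod>i\<in>I. \<eta> i) * G (mob z w))"
  have mz0: "mob z 0 = z" by (simp add: mob_def)
  have "ennreal ((cmod (G' 0) * (\<Prod>i\<in>I. exp (- (1 - (cmod (b i))\<^sup>2) / 2))) powr s)
    \<le> (\<integral>\<^sup>+w. ennreal (cmod (F (mob z w)) powr s) \<partial>dA)"
  proof (rule jensen_disc_origin[OF _ I])
    show "G' holomorphic_on disc" unfolding G'_def
      by (intro holomorphic_intros holomorphic_on_compose_gen[OF _ G, unfolded o_def]) (use z mob_in_disc[OF z] in auto)
    show "F (mob z u) = G' u * (\<Prod>i\<in>I. mob (b i) u)" if "u \<in> disc" for u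
    proof -
      have "mob (a i) (mob z u) = \<eta> i * mob (b i) u" if "i \<in> I" for i
        unfolding b_def \<eta>_def by (rule mob_mob_eq[OF z a(1)[OF that] \<open>u \<in> disc\<close>])
      then have "(\<Prod>i\<in>I. mob (a i) (mob z u)) = (\<Prod>i\<in>I. \<eta> i) * (\<Prod>i\<in>I. mob (b i) u)"
        by (simp add: prod.distrib)
      then show ?thesis
        using f[OF mob_in_disc[OF z that]] mob_in_disc[OF z that] by (simp add: F_def G'_def)
    qed
    show "b i \<in> disc" "b i \<noteq> 0" if "i \<in> I" for i
      using mob_in_disc[OF z a(1)[OF that]] one_minus_cnj_mult_nz[OF z a(1)[OF that]] a(2)[OF that]
      by (auto simp: b_def mob_def)
    have "cmod (\<Prod>i\<in>I. \<eta> i) = 1" by (simp add: eta flip: prod_norm)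
    then show "G' 0 \<noteq> 0" using False by (auto simp: G'_def mz0)
  qed (use s in auto)
  also have "(\<integral>\<^sup>+w. ennreal (cmod (F (mob z w)) powr s) \<partial>dA)
     = (\<integral>\<^sup>+w. ennreal (cmod (F w) powr s) * ennreal ((1 - (cmod z)\<^sup>2)\<^sup>2 / cmod (1 - cnj z * w) ^ 4) \<partial>dA)"
    by (rule nn_integral_dA_mob[OF z, of "\<lambda>w. ennreal (cmod (F w) powr s)"]) measurable
  also have "\<dots> = (\<integral>\<^sup>+w. ennreal (cmod (f w) powr s * ((1 - (cmod z)\<^sup>2)\<^sup>2 / cmod (1 - cnj z * w) ^ 4)) \<partial>dA)"
    by (intro nn_integral_cong, subst ennreal_mult) (auto simp: F_def)
  also have "cmod (G' 0) = cmod (G z)"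
    by (simp add: G'_def mz0 norm_mult eta flip: prod_norm)
  finally show ?thesis by (simp add: b_def cmod_mob_commute)
qed (use s in simp)

section \<open>Carleson boxes\<close>

lemma measurable_Arg [measurable]: "Arg \<in> borel_measurable borel"
proof -
  have "Arg = (\<lambda>z. if z = 0 then 0 else Im (Ln z))"
    by (rule ext) (simp add: Arg_def)
  also have "\<dots> \<in> borel_measurable borel" by measurable
  finally show ?thesis .
qed

lemma Arg_shift:
  assumes "u \<noteq> 0" "- pi < Arg u + c" "Arg u + c \<le> pi"
  shows "Arg (u * cis c) = Arg u + c"
proof -
  have "u * cis c = rcis (cmod u) (Arg u + c)"
    by (metis rcis_cmod_Arg rcis_def cis_mult mult.assoc)
  then show ?thesis using assms by (simp add: Arg_rcis)
qed

lemma Arg_cis_shift: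
  assumes "w \<noteq> 0" "- pi < Arg (w * cis a) + c" "Arg (w * cis a) + c \<le> pi"
  shows "Arg (w * cis (a + c)) = Arg (w * cis a) + c"
  using Arg_shift[of "w * cis a" c] assms by (simp add: cis_mult mult.assoc)

text \<open>The angular interval is half-open, so that a sector is the disjoint union of two of half
  the aperture and \<open>n = 0\<close> is the full circle. Height and aperture are independent,
  which allows thin strips over wide arcs.\<close>

definition sector :: "real \<Rightarrow> nat \<Rightarrow> real \<Rightarrow> complex set" where
  "sector \<beta> n h = {w \<in> disc. 1 - h < cmod w \<and> \<bar>Arg (w * cis (- \<beta>))\<bar> \<le> pi / 2 ^ n \<and> Arg (w * cis (- \<beta>)) \<noteq> - pi / 2 ^ n}"

text \<open>For \<open>n = 0\<close> this is the disc without the origin, because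
  \<open>1 - h = 0\<close>; hence the sets \<open>insert 0\<close> and the null set
  \<open>{0}\<close> further on.\<close>

definition carleson_box :: "real \<Rightarrow> nat \<Rightarrow> complex set" where
  "carleson_box \<beta> n = sector \<beta> n (1 / 2 ^ n)"

lemma sector_iff:
  "w \<in> sector \<beta> n h \<longleftrightarrow> w \<in> disc \<and> 1 - h < cmod w \<and> Arg (w * cis (- \<beta>)) \<in> {- (pi / 2 ^ n) <.. pi / 2 ^ n}"
  by (auto simp: sector_def)

lemma sets_dA_borel: "A \<subseteq> disc \<Longrightarrow> A \<in> sets borel \<Longrightarrow> A \<in> sets dA"
  by (auto simp: sets_dA sets_restrict_space intro!: image_eqI[of _ _ A])

lemma sector_borel [measurable]: "sector \<beta> n h \<in> sets borel"
proof -
  have "sector \<beta> n h = {w \<in> space borel. cmod w < 1 \<and> 1 - h < cmod w \<and> \<bar>Arg (w * cis (- \<beta>))\<bar> \<le> pi / 2 ^ n \<and> Arg (w * cis (- \<beta>)) \<noteq> - pi / 2 ^ n}"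
    by (auto simp: sector_def)
  also have "\<dots> \<in> sets borel" by measurable
  finally show ?thesis .
qed

lemma sector_subset_disc: "sector \<beta> n h \<subseteq> disc" by (auto simp: sector_def)

lemma sets_sector [simp]: "sector \<beta> n h \<in> sets dA"
  by (intro sets_dA_borel sector_subset_disc sector_borel)

lemma sector_mono: "h \<le> h' \<Longrightarrow> sector \<beta> n h \<subseteq> sector \<beta> n h'"
  by (auto simp: sector_def)

text \<open>The bound on \<open>h\<close> keeps out the origin, where the convention
  \<open>Arg 0 = 0\<close> is not compatible with rotations.\<close>

lemma sector_halves:
  assumes "h \<le> 1"
  shows "sector \<beta> n h = sector (\<beta> + pi / 2 ^ Suc n) (Suc n) h \<union> sector (\<beta> - pi / 2 ^ Suc n) (Suc n) h"
    "sector (\<beta> + pi / 2 ^ Suc n) (Suc n) h \<inter> sector (\<beta> - pi / 2 ^ Suc n) (Suc n) h = {}"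
proof -
  define d where "d = pi / 2 ^ Suc n"
  have d: "0 < d" "pi / 2 ^ n = 2 * d" by (auto simp: d_def)
  have "pi / 2 ^ n \<le> pi" by (simp add: field_simps)
  then have d2: "2 * d \<le> pi" using d by simp
  have plus: "Arg (w * cis (- (\<beta> + d))) \<in> {- d <.. d} \<longleftrightarrow> Arg (w * cis (- \<beta>)) \<in> {0 <.. 2 * d}" if "w \<noteq> 0" for w
    using Arg_cis_shift[OF that, of "- (\<beta> + d)" d] Arg_cis_shift[OF that, of "- \<beta>" "- d"] d d2
    by (auto simp: algebra_simps)
  have minus: "Arg (w * cis (- (\<beta> - d))) \<in> {- d <.. d} \<longleftrightarrow> Arg (w * cis (- \<beta>)) \<in> {- (2 * d) <.. 0}" if "w \<noteq> 0" for w
    using Arg_cis_shift[OF that, of "- (\<beta> - d)" "- d"] Arg_cis_shift[OF that, of "- \<beta>" d] d d2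
    by (auto simp: algebra_simps)
  show "sector \<beta> n h = sector (\<beta> + pi / 2 ^ Suc n) (Suc n) h \<union> sector (\<beta> - pi / 2 ^ Suc n) (Suc n) h"
  proof (rule set_eqI)
    fix w
    show "w \<in> sector \<beta> n h \<longleftrightarrow> w \<in> sector (\<beta> + pi / 2 ^ Suc n) (Suc n) h \<union> sector (\<beta> - pi / 2 ^ Suc n) (Suc n) h"
    proof (cases "w = 0")
      case False
      show ?thesis
        unfolding Un_iff sector_iff d_def[symmetric] d(2) plus[OF False] minus[OF False] using d by auto
    qed (use assms in \<open>simp add: sector_iff\<close>)
  qed
  show "sector (\<beta> + pi / 2 ^ Suc n) (Suc n) h \<inter> sector (\<beta> - pi / 2 ^ Suc n) (Suc n) h = {}"
  proof (rule equals0I)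
    fix w assume w: "w \<in> sector (\<beta> + pi / 2 ^ Suc n) (Suc n) h \<inter> sector (\<beta> - pi / 2 ^ Suc n) (Suc n) h"
    then have "w \<noteq> 0" using assms by (auto simp: sector_iff)
    with w show False
      unfolding Int_iff sector_iff d_def[symmetric] plus[OF \<open>w \<noteq> 0\<close>] minus[OF \<open>w \<noteq> 0\<close>] by auto
  qed
qed

text \<open>\<open>sin (x / 2)\<close> is concave on \<open>[0, pi]\<close> and lies above its
  chord.\<close>

lemma sin_half_ge:
  assumes "0 \<le> x" "x \<le> pi"
  shows "x / pi \<le> sin (x / 2)"
proof -
  define f where "f = (\<lambda>x::real. sin (x / 2))"
  have "convex_on {0..pi} (\<lambda>x. - f x)"
  proof (rule f''_ge0_imp_convex)
    show "((\<lambda>x. - f x) has_real_derivative - cos (x / 2) / 2) (at x)" for x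
      unfolding f_def by (auto intro!: derivative_eq_intros)
    show "((\<lambda>x. - cos (x / 2) / 2) has_real_derivative sin (x / 2) / 4) (at x)" for x
      by (auto intro!: derivative_eq_intros)
  qed (auto intro!: sin_ge_zero)
  from convex_onD[OF this, of "x / pi" 0 pi] show ?thesis
    using assms by (simp add: f_def)
qed

text \<open>With \<open>cnj z * w = \<rho> * cis \<theta>\<close> one has \<open>|1 - cnj z w|^2 =
  (1 - \<rho>)^2 + 4 \<rho> sin^2 (\<theta> / 2)\<close>, so this quantity controls the angle as
  well as the height. For \<open>n >= 1\<close> both moduli exceed 1/2, hence
  \<open>4 \<rho> >= 1\<close>, and the chord bound for the sine gives
  \<open>|\<theta>| / pi <= |1 - cnj z w|\<close>.\<close>

lemma near_subset_box:
  assumes z: "z \<in> disc" and w: "w \<in> disc" and lt: "cmod (1 - cnj z * w) < 1 / 2 ^ n"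
  shows "w \<in> insert 0 (carleson_box (Arg z) n)"
proof -
  define \<theta> where "\<theta> = Arg (w * cis (- Arg z))"
  have th: "- pi < \<theta>" "\<theta> \<le> pi" by (auto simp: \<theta>_def mpi_less_Arg Arg_le_pi)
  show ?thesis
  proof (cases n)
    case 0
    then show ?thesis using w th by (auto simp: carleson_box_def sector_iff \<theta>_def)
  next
    case (Suc m)
    have "(1::real) / 2 ^ n \<le> 1 / 2" unfolding Suc by (simp add: field_simps)
    moreover have "1 - cmod z \<le> cmod (1 - cnj z * w)" "1 - cmod w \<le> cmod (1 - cnj z * w)"
      using cmod_one_minus_ge[of z w] z w by auto
    ultimately have half: "cmod z > 1 / 2" "cmod w > 1 / 2" and wh: "1 - 1 / 2 ^ n < cmod w"
      using lt by linarith+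
    define \<rho> where "\<rho> = cmod z * cmod w"
    have rho: "1 / 4 \<le> \<rho>"
      unfolding \<rho>_def using mult_mono[of "1/2" "cmod z" "1/2" "cmod w"] half by simp
    have "cnj z = cmod z * cis (- Arg z)"
      using rcis_cmod_Arg[of z] by (metis complex_cnj_complex_of_real complex_cnj_mult cis_cnj rcis_def)
    then have "cnj z * w = cmod z * (w * cis (- Arg z))" by simp
    also have "w * cis (- Arg z) = cmod w * cis \<theta>"
      using rcis_cmod_Arg[of "w * cis (- Arg z)"] unfolding \<theta>_def rcis_def by (simp add: norm_mult)
    finally have "cnj z * w = \<rho> * cis \<theta>" by (simp add: \<rho>_def)
    then have "(cmod (1 - cnj z * w))\<^sup>2 = (1 - \<rho> * cos \<theta>)\<^sup>2 + (\<rho> * sin \<theta>)\<^sup>2"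
      by (simp add: cmod_power2)
    also have "\<dots> = (1 - \<rho>)\<^sup>2 + 2 * \<rho> * (1 - cos \<theta>)"
      using sin_cos_squared_add[of \<theta>] by algebra
    also have "1 - cos \<theta> = 2 * (sin (\<bar>\<theta>\<bar> / 2))\<^sup>2"
      using cos_double_sin[of "\<bar>\<theta>\<bar> / 2"] by simp
    finally have "(cmod (1 - cnj z * w))\<^sup>2 \<ge> 4 * \<rho> * (sin (\<bar>\<theta>\<bar> / 2))\<^sup>2" by simp
    moreover have "4 * \<rho> * (sin (\<bar>\<theta>\<bar> / 2))\<^sup>2 \<ge> 1 * (sin (\<bar>\<theta>\<bar> / 2))\<^sup>2"
      using rho by (intro mult_right_mono) auto
    moreover have "(sin (\<bar>\<theta>\<bar> / 2))\<^sup>2 \<ge> (\<bar>\<theta>\<bar> / pi)\<^sup>2"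
      using th by (intro power_mono sin_half_ge) auto
    ultimately have "(\<bar>\<theta>\<bar> / pi)\<^sup>2 \<le> (cmod (1 - cnj z * w))\<^sup>2" by linarith
    then have "\<bar>\<theta>\<bar> / pi \<le> cmod (1 - cnj z * w)" by (rule power2_le_imp_le) simp
    with lt have "\<bar>\<theta>\<bar> / pi < 1 / 2 ^ n" by linarith
    then have "\<bar>\<theta>\<bar> < pi / 2 ^ n" by (simp add: field_simps)
    then show ?thesis using w wh by (auto simp: carleson_box_def sector_iff \<theta>_def[symmetric])
  qed
qed

text \<open>The balls of the quasi-distance \<open>|1 - cnj z w|\<close>. They are empty for
  \<open>r <= 1 - |z|\<close>; at larger scales they play the part of Carleson boxes in the
  direction of \<open>z\<close>.\<close>

definition near :: "complex \<Rightarrow> real \<Rightarrow> complex set" where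
  "near z r = {w \<in> disc. cmod (1 - cnj z * w) < r}"

lemma near_borel [measurable]: "near z r \<in> sets borel"
proof -
  have "near z r = {w \<in> space borel. cmod w < 1 \<and> cmod (1 - cnj z * w) < r}" by (auto simp: near_def)
  also have "\<dots> \<in> sets borel" by measurable
  finally show ?thesis .
qed

lemma sets_near [simp]: "near z r \<in> sets dA"
  by (intro sets_dA_borel near_borel) (auto simp: near_def)

lemma near_subset_disc: "near z r \<subseteq> disc" by (auto simp: near_def)

lemma near_mono: "r \<le> r' \<Longrightarrow> near z r \<subseteq> near z r'" by (auto simp: near_def)

text \<open>The centre is \<open>z\<close> pulled inwards by the factor \<open>1 - l / 4\<close>,
  which leaves room \<open>l / 4\<close> to the circle. The errors add up to
  \<open>2 l + l / 4 + l / 8 < 4 l\<close>.\<close>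

lemma ball_subset_near:
  assumes z: "z \<in> disc" and l: "1 - cmod z \<le> l" "l \<le> 2" "0 < l"
  shows "ball (of_real (1 - l / 4) * z) (l / 8) \<subseteq> near z (4 * l)" "l / 4 \<le> 1 - cmod (of_real (1 - l / 4) * z)"
proof -
  have n: "cmod (of_real (1 - l / 4) * z) = (1 - l / 4) * cmod z"
    using l by (simp only: norm_mult norm_of_real)
  have "(1 - l / 4) * cmod z \<le> (1 - l / 4) * 1"
    using l z by (intro mult_left_mono) auto
  then show le: "l / 4 \<le> 1 - cmod (of_real (1 - l / 4) * z)" using n by simp
  show "ball (of_real (1 - l / 4) * z) (l / 8) \<subseteq> near z (4 * l)"
  proof
    fix w assume w: "w \<in> ball (of_real (1 - l / 4) * z) (l / 8)"
    define \<xi> where "\<xi> = of_real (1 - l / 4) * z"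
    have d: "cmod (w - \<xi>) < l / 8" using w by (simp only: \<xi>_def mem_ball dist_norm norm_minus_commute)
    have "cmod w \<le> cmod \<xi> + cmod (w - \<xi>)" using norm_triangle_ineq[of \<xi> "w - \<xi>"] by simp
    then have wd: "w \<in> disc" using d le l unfolding \<xi>_def mem_ball_0 by linarith
    have "1 - cnj z * w = (1 - cnj z * \<xi>) - cnj z * (w - \<xi>)" by (simp add: algebra_simps)
    then have "cmod (1 - cnj z * w) \<le> cmod (1 - cnj z * \<xi>) + cmod z * cmod (w - \<xi>)"
      by (metis norm_triangle_ineq4 norm_mult complex_mod_cnj)
    also have "cmod z * cmod (w - \<xi>) \<le> 1 * cmod (w - \<xi>)" using z by (intro mult_right_mono) auto
    also have "1 - cnj z * \<xi> = of_real (1 - (1 - l / 4) * (cmod z)\<^sup>2)"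
    proof -
      have "cnj z * \<xi> = of_real (1 - l / 4) * of_real ((cmod z)\<^sup>2)"
        unfolding \<xi>_def complex_norm_square by (simp only: mult_ac)
      then show ?thesis by (simp only: of_real_mult of_real_diff of_real_1)
    qed
    also have "cmod \<dots> = 1 - (1 - l / 4) * (cmod z)\<^sup>2"
    proof -
      have "(1 - l / 4) * (cmod z)\<^sup>2 \<le> 1 * 1"
        using l z by (intro mult_mono power_le_one) auto
      then show ?thesis unfolding norm_of_real by simp
    qed
    also have "\<dots> \<le> 2 * l + l / 4"
    proof -
      have "1 - (1 - l / 4) * (cmod z)\<^sup>2 = (1 - cmod z) * (1 + cmod z) + l / 4 * (cmod z)\<^sup>2"
        by (simp add: power2_eq_square algebra_simps)
      also have "(1 - cmod z) * (1 + cmod z) \<le> l * 2"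
        using l z by (intro mult_mono) auto
      also have "l / 4 * (cmod z)\<^sup>2 \<le> l / 4 * 1"
        using l z by (intro mult_left_mono power_le_one) auto
      finally show ?thesis by simp
    qed
    finally have "cmod (1 - cnj z * w) < 4 * l" using d l by simp
    then show "w \<in> near z (4 * l)" using wd by (simp add: near_def)
  qed
qed

text \<open>The ball sits on the axis of the box at height \<open>h / 4\<close>. Its centre and
  radius contribute \<open>h / 2 + h / 8 < h\<close>, so \<open>near_subset_box\<close> applies. The
  last clause separates it from the strip of height \<open>h / 8\<close>.\<close>

lemma ball_subset_box:
  fixes \<beta> :: real and n :: nat
  defines "h \<equiv> 1 / 2 ^ n :: real" and "\<xi> \<equiv> of_real (1 - 1 / 2 ^ n / 4) * cis \<beta>"
  shows "cmod \<xi> = 1 - h / 4" "ball \<xi> (h / 8) \<subseteq> insert 0 (carleson_box \<beta> n)"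
    "\<And>w. w \<in> ball \<xi> (h / 8) \<Longrightarrow> cmod w < 1 - h / 8"
proof -
  have h: "0 < h" "h \<le> 1" by (auto simp: h_def)
  have xi: "\<xi> = of_real (1 - h / 4) * cis \<beta>" by (simp only: \<xi>_def h_def)
  have nx: "cmod \<xi> = 1 - h / 4" using h by (simp only: xi norm_mult norm_of_real norm_cis) simp
  \<comment> \<open>\<open>Arg \<xi>\<close> agrees with \<open>\<beta>\<close> only modulo
    \<open>2 * pi\<close>, but a box depends on \<open>cis \<beta>\<close> alone.\<close>
  have argx: "carleson_box (Arg \<xi>) n = carleson_box \<beta> n"
  proof -
    have "Arg \<xi> = Arg (cis \<beta>)" unfolding xi by (rule Arg_times_of_real) (use h in simp)
    then have "cis (Arg \<xi>) = cis \<beta>" by (simp add: cis_Arg sgn_eq)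
    then have "cis (- Arg \<xi>) = cis (- \<beta>)" by (metis cis_cnj)
    then show ?thesis by (simp only: carleson_box_def sector_def)
  qed
  have ub: "cmod w < 1 - h / 8" if "w \<in> ball \<xi> (h / 8)" for w
    using that norm_triangle_ineq[of \<xi> "w - \<xi>"] nx by (simp add: dist_norm norm_minus_commute)
  have sub: "ball \<xi> (h / 8) \<subseteq> insert 0 (carleson_box \<beta> n)"
  proof
    fix w assume w: "w \<in> ball \<xi> (h / 8)"
    have wd: "w \<in> disc" using ub[OF w] h by simp
    have xd: "\<xi> \<in> disc" using nx h by simp
    have "1 - cnj \<xi> * w = (1 - cnj \<xi> * \<xi>) - cnj \<xi> * (w - \<xi>)" by (simp add: algebra_simps)
    then have "cmod (1 - cnj \<xi> * w) \<le> cmod (1 - cnj \<xi> * \<xi>) + cmod \<xi> * cmod (w - \<xi>)"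
      by (metis norm_triangle_ineq4 norm_mult complex_mod_cnj)
    also have "cmod \<xi> * cmod (w - \<xi>) \<le> 1 * cmod (w - \<xi>)" using xd by (intro mult_right_mono) auto
    also have "cmod (w - \<xi>) < h / 8" using w by (simp add: dist_norm norm_minus_commute)
    also have "1 - cnj \<xi> * \<xi> = of_real (1 - (cmod \<xi>)\<^sup>2)"
      using complex_norm_square[of \<xi>] by (simp add: mult_ac)
    also have "cmod (of_real (1 - (cmod \<xi>)\<^sup>2)) = 1 - (1 - h / 4)\<^sup>2"
      unfolding norm_of_real nx using h by (simp add: abs_square_le_1 abs_le_iff power_le_one)
    also have "1 - (1 - h / 4)\<^sup>2 \<le> h / 2" by (simp add: power2_eq_square algebra_simps)
    finally have "cmod (1 - cnj \<xi> * w) < h" using h by linarith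
    then have "cmod (1 - cnj \<xi> * w) < 1 / 2 ^ n" by (simp only: h_def)
    from near_subset_box[OF xd wd this] show "w \<in> insert 0 (carleson_box \<beta> n)" by (simp add: argx)
  qed
  show "cmod \<xi> = 1 - h / 4" by (rule nx)
  show "ball \<xi> (h / 8) \<subseteq> insert 0 (carleson_box \<beta> n)" by (rule sub)
  show "\<And>w. w \<in> ball \<xi> (h / 8) \<Longrightarrow> cmod w < 1 - h / 8" by (rule ub)
qed

section \<open>Doubling measures\<close>

text \<open>Doubling in the form used below: a box is dominated by every ball in it that is not too
  small and not too close to the circle. The factor 64 admits radius \<open>l / 8\<close> with
  \<open>l\<close> down to an eighth of the height, as in \<open>shell_integral\<close>. The bound
  \<open>2 <= C\<close> keeps \<open>\<rho>\<close> away from 0, where its logarithm is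
  taken.\<close>

locale carleson_doubling = finite_measure \<mu> for \<mu> :: "complex measure" +
  fixes C :: real
  assumes sets_eq: "sets \<mu> = sets dA"
    and null_0: "measure \<mu> {0} = 0"
    and C2: "2 \<le> C"
    and box_le: "\<And>\<beta> n \<xi> t. ball \<xi> t \<subseteq> insert 0 (carleson_box \<beta> n) \<Longrightarrow> 2 * t \<le> 1 - cmod \<xi> \<Longrightarrow>
      1 / (64 * 2 ^ n) \<le> t \<Longrightarrow> measure \<mu> (carleson_box \<beta> n) \<le> C * measure \<mu> (ball \<xi> t)"
    and ball_pos: "\<And>\<xi> t. ball \<xi> t \<subseteq> disc \<Longrightarrow> 0 < t \<Longrightarrow> 0 < measure \<mu> (ball \<xi> t)"
begin

lemma space_eq [simp]: "space \<mu> = disc"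
  using sets_eq_imp_space_eq[OF sets_eq] by simp

lemma sets_sector' [simp, measurable]: "sector \<beta> n h \<in> sets \<mu>" "near z r \<in> sets \<mu>"
  unfolding sets_eq by (rule sets_sector sets_near)+

lemma borel_imp_measurable: "f \<in> measurable borel N \<Longrightarrow> f \<in> measurable \<mu> N"
  unfolding measurable_cong_sets[OF sets_eq refl, of N] by (rule borel_imp_measurable_dA)

lemma ball_sets: "ball \<xi> t \<subseteq> disc \<Longrightarrow> ball \<xi> t \<in> sets \<mu>"
  unfolding sets_eq by (rule sets_dA_borel) auto

lemma insert_0_sets: "insert 0 (sector \<beta> n h) \<in> sets \<mu>"
  unfolding sets_eq by (rule sets_dA_borel) (use sector_subset_disc in auto)

lemma measure_insert_0: "A \<in> sets \<mu> \<Longrightarrow> measure \<mu> (insert 0 A) = measure \<mu> A"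
proof -
  assume A: "A \<in> sets \<mu>"
  have 0: "{0} \<in> sets \<mu>" unfolding sets_eq by (rule sets_dA_borel) auto
  have "measure \<mu> (insert 0 A) \<le> measure \<mu> {0} + measure \<mu> A"
    using measure_Un_le[OF 0 A] by simp
  moreover have "measure \<mu> A \<le> measure \<mu> (insert 0 A)"
    using sets.Un[OF 0 A] by (intro finite_measure_mono) auto
  ultimately show ?thesis by (simp add: null_0)
qed

text \<open>The share of the mass that can remain in a box once a ball carrying at least the share
  \<open>1 / C\<close> is removed.\<close>

definition \<rho> where "\<rho> = 1 - 1 / C"

lemma rho: "1 / 2 \<le> \<rho>" "\<rho> < 1" using C2 by (auto simp: \<rho>_def field_simps)

lemma measure_sector_halves:
  assumes "h \<le> 1"
  shows "measure \<mu> (sector \<beta> n h) = measure \<mu> (sector (\<beta> + pi / 2 ^ Suc n) (Suc n) h) + measure \<mu> (sector (\<beta> - pi / 2 ^ Suc n) (Suc n) h)"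
  unfolding sector_halves(1)[OF assms, of \<beta> n]
  by (intro finite_measure_Union sector_halves(2) assms sets_sector')

text \<open>Repeated halving is additive for both heights, so a bound at the finer aperture sums up
  to the coarser one.\<close>

lemma sector_compare:
  assumes "h \<le> 1" "h' \<le> 1" "\<And>\<beta>. measure \<mu> (sector \<beta> (n + m) h) \<le> c * measure \<mu> (sector \<beta> (n + m) h')"
  shows "measure \<mu> (sector \<beta> n h) \<le> c * measure \<mu> (sector \<beta> n h')"
  using assms(3)
proof (induction m arbitrary: \<beta>)
  case (Suc m)
  show ?case
  proof (rule Suc.IH)
    show "measure \<mu> (sector \<beta> (n + m) h) \<le> c * measure \<mu> (sector \<beta> (n + m) h')" for \<beta>
      unfolding measure_sector_halves[OF assms(1), of \<beta> "n + m"] measure_sector_halves[OF assms(2), of \<beta> "n + m"]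
      using Suc.prems[of "\<beta> + pi / 2 ^ Suc (n + m)"] Suc.prems[of "\<beta> - pi / 2 ^ Suc (n + m)"]
      by (simp add: distrib_left)
  qed
qed simp

text \<open>The top part of the box contains a ball of comparable size, hence a fixed proportion of the mass.\<close>

lemma sector_decay_step:
  "measure \<mu> (sector \<beta> n (1 / 2 ^ (n + 3))) \<le> \<rho> * measure \<mu> (sector \<beta> n (1 / 2 ^ n))"
proof -
  define h where "h = (1::real) / 2 ^ n"
  have h: "0 < h" "h \<le> 1" by (auto simp: h_def)
  have h3: "1 / 2 ^ (n + 3) = h / 8" by (simp add: h_def power_add)
  define \<xi> where "\<xi> = of_real (1 - h / 4) * cis \<beta>"
  note bb = ball_subset_box[where n = n and \<beta> = \<beta>, folded h_def, folded \<xi>_def]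
  note nx = bb(1) and sub = bb(2) and ub = bb(3)
  have bd: "ball \<xi> (h / 8) \<subseteq> disc" using sub sector_subset_disc by (force simp: carleson_box_def)
  have "measure \<mu> (carleson_box \<beta> n) \<le> C * measure \<mu> (ball \<xi> (h / 8))"
    by (rule box_le[OF sub]) (use nx h in \<open>auto simp: h_def field_simps\<close>)
  then have 1: "measure \<mu> (sector \<beta> n h) / C \<le> measure \<mu> (ball \<xi> (h / 8))"
    using C2 by (simp add: carleson_box_def h_def field_simps)
  have "measure \<mu> (sector \<beta> n (h / 8)) + measure \<mu> (ball \<xi> (h / 8)) = measure \<mu> (sector \<beta> n (h / 8) \<union> ball \<xi> (h / 8))"
  proof (intro finite_measure_Union[symmetric] ball_sets bd)
    show "sector \<beta> n (h / 8) \<inter> ball \<xi> (h / 8) = {}"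
    proof (rule equals0I)
      fix w assume "w \<in> sector \<beta> n (h / 8) \<inter> ball \<xi> (h / 8)"
      then show False using ub[of w] by (simp add: sector_iff)
    qed
  qed simp
  also have "\<dots> \<le> measure \<mu> (insert 0 (sector \<beta> n h))"
  proof (intro finite_measure_mono insert_0_sets Un_least)
    show "sector \<beta> n (h / 8) \<subseteq> insert 0 (sector \<beta> n h)"
      using sector_mono[of "h / 8" h \<beta> n] h by auto
    show "ball \<xi> (h / 8) \<subseteq> insert 0 (sector \<beta> n h)"
      using sub by (simp only: carleson_box_def h_def)
  qed
  also have "\<dots> = measure \<mu> (sector \<beta> n h)" by (simp add: measure_insert_0)
  finally show ?thesis unfolding h3 h_def[symmetric] \<rho>_def using 1 by (simp add: left_diff_distrib)
qed

text \<open>A decay step starts from a box, where height and aperture match. After one step the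
  strip of height \<open>1 / 2 ^ (n + 3)\<close> is cut into boxes of aperture \<open>n + 3\<close>;
  the induction hypothesis applies to each of them and \<open>sector_compare\<close> reassembles the
  strip.\<close>

lemma sector_decay:
  "measure \<mu> (sector \<beta> n (1 / 2 ^ (n + 3 * j))) \<le> \<rho> ^ j * measure \<mu> (sector \<beta> n (1 / 2 ^ n))"
proof (induction j arbitrary: \<beta> n)
  case (Suc j)
  have "measure \<mu> (sector \<beta> n (1 / 2 ^ (n + 3 * Suc j))) \<le> \<rho> ^ j * measure \<mu> (sector \<beta> n (1 / 2 ^ (n + 3)))"
  proof (rule sector_compare[where m = 3])
    show "measure \<mu> (sector \<beta> (n + 3) (1 / 2 ^ (n + 3 * Suc j))) \<le> \<rho> ^ j * measure \<mu> (sector \<beta> (n + 3) (1 / 2 ^ (n + 3)))" for \<beta>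
      using Suc.IH[of \<beta> "n + 3"] by (simp add: algebra_simps)
  qed (auto simp: field_simps)
  also have "\<dots> \<le> \<rho> ^ j * (\<rho> * measure \<mu> (sector \<beta> n (1 / 2 ^ n)))"
    using rho by (intro mult_left_mono sector_decay_step) auto
  finally show ?case by (simp only: power_Suc2 mult.assoc)
qed simp

text \<open>Mass decays like \<open>\<rho> ^ j\<close> at relative height \<open>8 ^ -j\<close>,
  that is, with exponent \<open>- ln \<rho> / ln 8\<close>. Half of this exponent is spent, so that
  \<open>8 powr \<delta>0 * \<rho>\<close> is the square root of \<open>\<rho>\<close> and a
  geometric series still converges.\<close>

definition \<delta>0 where "\<delta>0 = - ln \<rho> / (2 * ln 8)"

lemma delta0_pos: "0 < \<delta>0"
proof -
  have "0 < - ln \<rho>" using rho by simp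
  then show ?thesis unfolding \<delta>0_def by (intro divide_pos_pos) auto
qed

definition A0 where "A0 = 8 powr \<delta>0 / (1 - 8 powr \<delta>0 * \<rho>)"

lemma delta0_rho: "8 powr \<delta>0 * \<rho> < 1"
proof -
  have "8 powr \<delta>0 * \<rho> = exp (\<delta>0 * ln 8) * exp (ln \<rho>)" using rho by (simp add: powr_def)
  also have "\<dots> = exp (ln \<rho> / 2)" by (simp add: \<delta>0_def flip: exp_add)
  also have "\<dots> < 1" using rho by simp
  finally show ?thesis .
qed

lemma A0_pos: "0 < A0" using delta0_rho by (simp add: A0_def)

text \<open>Where \<open>2 ^ n * (1 - |w|)\<close> lies between \<open>8 ^ -(j + 1)\<close> and
  \<open>8 ^ -j\<close>, the integrand is at most \<open>8 powr (\<delta>0 * (j + 1))\<close>, while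
  the mass is at most \<open>\<rho> ^ j\<close> times that of the box. The layers sum to the
  geometric series whose value defines \<open>A0\<close>.\<close>

lemma box_integral:
  assumes d: "0 < \<delta>" "\<delta> \<le> \<delta>0"
  shows "(\<integral>\<^sup>+w\<in>carleson_box \<beta> n. ennreal ((1 / (2 ^ n * (1 - cmod w))) powr \<delta>) \<partial>\<mu>)
     \<le> ennreal (A0 * measure \<mu> (carleson_box \<beta> n))"
proof -
  define E where "E = (\<lambda>j. sector \<beta> n (1 / 2 ^ (n + 3 * j)))"
  have pt: "ennreal ((1 / (2 ^ n * (1 - cmod w))) powr \<delta>) * indicator (carleson_box \<beta> n) w
     \<le> (\<Sum>j. ennreal (8 powr (\<delta>0 * (real j + 1))) * indicator (E j) w)" for w
  proof (cases "w \<in> carleson_box \<beta> n")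
    case True
    define x where "x = 2 ^ n * (1 - cmod w)"
    have x: "0 < x" "x < 1"
      using True by (auto simp: x_def carleson_box_def sector_def field_simps)
    define g where "g = (\<lambda>j. ennreal (8 powr (\<delta>0 * (real j + 1))) * indicator (E j) w)"
    \<comment> \<open>Ceiling minus one rather than floor: the strict inequality has to be
      \<open>j < log 8 (1 / x)\<close>, since membership in \<open>E j\<close> is strict.\<close>
    define j where "j = nat (\<lceil>log 8 (1 / x)\<rceil> - 1)"
    have lg: "0 < log 8 (1 / x)" using x by simp
    then have j: "real j < log 8 (1 / x)" "log 8 (1 / x) \<le> real j + 1"
      unfolding j_def by linarith+
    have xj: "8 powr real j < 1 / x" using j(1) x by (simp add: less_log_iff)
    then have "x < 1 / 8 ^ j" using x by (simp add: powr_realpow field_simps)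
    moreover have "(2::real) ^ (n + 3 * j) = 2 ^ n * 8 ^ j" by (simp add: power_add power_mult)
    ultimately have "1 - cmod w < 1 / 2 ^ (n + 3 * j)"
      by (simp add: x_def field_simps)
    then have wE: "w \<in> E j" using True by (auto simp: E_def carleson_box_def sector_def)
    have "1 / x \<le> 8 powr (real j + 1)" using j(2) x by (simp add: log_le_iff)
    then have "(1 / x) powr \<delta> \<le> (8 powr (real j + 1)) powr \<delta>"
      using d x by (intro powr_mono2) auto
    also have "\<dots> = 8 powr ((real j + 1) * \<delta>)" by (simp add: powr_powr)
    also have "\<dots> \<le> 8 powr ((real j + 1) * \<delta>0)" using d by (intro powr_mono mult_left_mono) auto
    finally have "ennreal ((1 / x) powr \<delta>) \<le> ennreal (8 powr (\<delta>0 * (real j + 1))) * indicator (E j) w"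
      using wE by (simp add: mult.commute ennreal_leI)
    also have "\<dots> = g j" by (simp only: g_def)
    also have "\<dots> \<le> suminf g" using sum_le_suminf[OF summableI, of "{j}" g] by simp
    finally show ?thesis using True by (simp add: x_def g_def)
  qed simp
  have "(\<integral>\<^sup>+w\<in>carleson_box \<beta> n. ennreal ((1 / (2 ^ n * (1 - cmod w))) powr \<delta>) \<partial>\<mu>)
     \<le> (\<integral>\<^sup>+w. (\<Sum>j. ennreal (8 powr (\<delta>0 * (real j + 1))) * indicator (E j) w) \<partial>\<mu>)"
    by (intro nn_integral_mono pt)
  also have "\<dots> = (\<Sum>j. ennreal (8 powr (\<delta>0 * (real j + 1))) * emeasure \<mu> (E j))"
  proof (subst nn_integral_suminf)
    have Em [measurable]: "E j \<in> sets \<mu>" for j by (simp add: E_def)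
    show "(\<lambda>w. ennreal (8 powr (\<delta>0 * (real j + 1))) * indicator (E j) w) \<in> borel_measurable \<mu>" for j
      by measurable
    show "(\<Sum>j. \<integral>\<^sup>+w. ennreal (8 powr (\<delta>0 * (real j + 1))) * indicator (E j) w \<partial>\<mu>) =
        (\<Sum>j. ennreal (8 powr (\<delta>0 * (real j + 1))) * emeasure \<mu> (E j))"
      by (intro suminf_cong nn_integral_cmult_indicator Em)
  qed
  also have "\<dots> \<le> (\<Sum>j. ennreal (8 powr \<delta>0 * measure \<mu> (carleson_box \<beta> n) * (8 powr \<delta>0 * \<rho>) ^ j))"
  proof (intro suminf_le summableI)
    fix j
    have "8 powr (\<delta>0 * (real j + 1)) = 8 powr \<delta>0 * (8 powr \<delta>0) ^ j"
      using powr_realpow[of "8 powr \<delta>0" j] by (simp add: distrib_left powr_add powr_powr mult.commute)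
    moreover have "8 powr \<delta>0 * (8 powr \<delta>0) ^ j * measure \<mu> (E j)
        \<le> 8 powr \<delta>0 * (8 powr \<delta>0) ^ j * (\<rho> ^ j * measure \<mu> (sector \<beta> n (1 / 2 ^ n)))"
      unfolding E_def by (intro mult_left_mono sector_decay) auto
    ultimately have "8 powr (\<delta>0 * (real j + 1)) * measure \<mu> (E j) \<le> 8 powr \<delta>0 * measure \<mu> (carleson_box \<beta> n) * (8 powr \<delta>0 * \<rho>) ^ j"
      unfolding carleson_box_def power_mult_distrib by (simp only: mult.assoc mult.commute mult.left_commute)
    then show "ennreal (8 powr (\<delta>0 * (real j + 1))) * emeasure \<mu> (E j) \<le> ennreal (8 powr \<delta>0 * measure \<mu> (carleson_box \<beta> n) * (8 powr \<delta>0 * \<rho>) ^ j)"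
      unfolding emeasure_eq_measure by (subst ennreal_mult[symmetric]) (auto intro: ennreal_leI)
  qed
  also have "\<dots> = ennreal (\<Sum>j. 8 powr \<delta>0 * measure \<mu> (carleson_box \<beta> n) * (8 powr \<delta>0 * \<rho>) ^ j)"
    using delta0_rho rho by (intro suminf_ennreal2 summable_mult summable_geometric) auto
  also have "(\<Sum>j. 8 powr \<delta>0 * measure \<mu> (carleson_box \<beta> n) * (8 powr \<delta>0 * \<rho>) ^ j)
     = 8 powr \<delta>0 * measure \<mu> (carleson_box \<beta> n) * (1 / (1 - 8 powr \<delta>0 * \<rho>))"
    using delta0_rho rho by (intro sums_unique[symmetric] sums_mult geometric_sums) simp
  also have "\<dots> = A0 * measure \<mu> (carleson_box \<beta> n)" by (simp add: A0_def)
  finally show ?thesis .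
qed

lemma measure_near_pos:
  assumes "z \<in> disc" "1 - cmod z \<le> r" "0 < r"
  shows "0 < measure \<mu> (near z (4 * r))"
proof -
  \<comment> \<open>The cap at 2 meets the hypothesis of \<open>ball_subset_near\<close> and only
    shrinks the set.\<close>
  define l where "l = min r 2"
  have l: "1 - cmod z \<le> l" "l \<le> 2" "0 < l" using assms norm_ge_zero[of z] unfolding l_def min_def by (auto simp del: norm_ge_zero)
  have "ball (of_real (1 - l / 4) * z) (l / 8) \<subseteq> near z (4 * r)"
    using ball_subset_near(1)[OF assms(1) l] near_mono[of "4 * l" "4 * r" z] by (auto simp: l_def)
  then have "measure \<mu> (ball (of_real (1 - l / 4) * z) (l / 8)) \<le> measure \<mu> (near z (4 * r))"
    by (intro finite_measure_mono) auto
  moreover have "0 < measure \<mu> (ball (of_real (1 - l / 4) * z) (l / 8))"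
    by (rule ball_pos) (use ball_subset_near(1)[OF assms(1) l] near_subset_disc l in auto)
  ultimately show ?thesis by simp
qed

text \<open>A box of height comparable to \<open>l\<close> covers \<open>near z (4 * l)\<close> up
  to the origin, so \<open>box_integral\<close> bounds the integral by the mass of that box.
  Doubling leads back to \<open>near z (4 * l)\<close> through the ball of radius
  \<open>l / 8\<close> inside it.\<close>

lemma shell_integral:
  assumes d: "0 < \<delta>" "\<delta> \<le> \<delta>0" and z: "z \<in> disc" and l: "1 - cmod z \<le> l" "l \<le> 2"
  shows "(\<integral>\<^sup>+w\<in>near z (2 * l). ennreal ((l / (1 - cmod w)) powr \<delta>) \<partial>\<mu>)
    \<le> ennreal (2 powr \<delta>0 * A0 * C * measure \<mu> (near z (4 * l)))"
proof -
  have l0: "0 < l" using z l by auto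
  \<comment> \<open>For \<open>4 * l <= 1\<close> the largest \<open>n\<close> with
    \<open>4 * l <= 1 / 2 ^ n\<close> is taken, so the height is below \<open>8 * l\<close>; for
    larger \<open>l\<close> the punctured disc itself, \<open>n = 0\<close>, is the box.\<close>
  obtain n where n: "1 / (8 * 2 ^ n) \<le> l" "l \<le> 2 / 2 ^ n" "n = 0 \<or> 4 * l \<le> 1 / 2 ^ n"
  proof (cases "4 * l \<le> 1")
    case True
    define L where "L = log 2 (1 / (4 * l))"
    define n where "n = nat \<lfloor>L\<rfloor>"
    have "0 \<le> L" using True l0 by (simp add: L_def)
    then have "real n \<le> L" "L < real n + 1" unfolding n_def by linarith+
    then have a: "2 powr real n \<le> 1 / (4 * l)" "1 / (4 * l) < 2 powr (real n + 1)"
      using l0 by (auto simp: L_def le_log_iff log_less_iff)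
    have b: "2 powr (real n + 1) = 2 * 2 ^ n" by (simp add: powr_add powr_realpow)
    have "4 * l \<le> 1 / 2 ^ n" using a(1) l0 by (simp add: powr_realpow field_simps)
    moreover have "1 / (8 * 2 ^ n) \<le> l" using a(2) l0 unfolding b by (simp add: field_simps)
    ultimately show ?thesis using l0 by (intro that[of n]) (auto simp: field_simps)
  qed (use l in \<open>auto intro!: that[of 0]\<close>)
  define \<xi> where "\<xi> = of_real (1 - l / 4) * z"
  have sub4: "near z (4 * l) \<subseteq> insert 0 (carleson_box (Arg z) n)"
  proof (cases "n = 0")
    case True
    have "insert 0 (carleson_box (Arg z) n) = disc"
      using True mpi_less_Arg Arg_le_pi by (auto simp: carleson_box_def sector_iff)
    then show ?thesis using near_subset_disc by simp
  next
    case False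
    then show ?thesis using near_subset_box[OF z] n(3) by (force simp: near_def)
  qed
  have ballsub: "ball \<xi> (l / 8) \<subseteq> near z (4 * l)" and xi: "l / 4 \<le> 1 - cmod \<xi>"
    unfolding \<xi>_def using ball_subset_near[OF z l l0] by auto
  have "measure \<mu> (carleson_box (Arg z) n) \<le> C * measure \<mu> (ball \<xi> (l / 8))"
    by (rule box_le) (use ballsub sub4 xi n(1) in auto)
  also have "\<dots> \<le> C * measure \<mu> (near z (4 * l))"
    using C2 ballsub by (intro mult_left_mono finite_measure_mono) auto
  finally have box: "measure \<mu> (carleson_box (Arg z) n) \<le> C * measure \<mu> (near z (4 * l))" .
  have "(\<integral>\<^sup>+w\<in>near z (2 * l). ennreal ((l / (1 - cmod w)) powr \<delta>) \<partial>\<mu>)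
     \<le> (\<integral>\<^sup>+w. ennreal (2 powr \<delta>0) * (ennreal ((1 / (2 ^ n * (1 - cmod w))) powr \<delta>) * indicator (carleson_box (Arg z) n) w) \<partial>\<mu>)"
  proof (rule nn_integral_mono_AE)
    have "{0} \<in> null_sets \<mu>"
      using sets_dA_borel[of "{0}"] by (intro null_setsI) (auto simp: emeasure_eq_measure null_0 sets_eq)
    from AE_not_in[OF this] have "AE w in \<mu>. w \<noteq> 0" by simp
    moreover have "AE w in \<mu>. w \<in> disc" by (rule AE_I2) simp
    ultimately show "AE w in \<mu>. ennreal ((l / (1 - cmod w)) powr \<delta>) * indicator (near z (2 * l)) w
       \<le> ennreal (2 powr \<delta>0) * (ennreal ((1 / (2 ^ n * (1 - cmod w))) powr \<delta>) * indicator (carleson_box (Arg z) n) w)"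
    proof eventually_elim
      case (elim w)
      show ?case
      proof (cases "w \<in> near z (2 * l)")
        case True
        then have "w \<in> carleson_box (Arg z) n" using sub4 near_mono[of "2 * l" "4 * l" z] l0 elim by auto
        moreover have "(l / (1 - cmod w)) powr \<delta> \<le> 2 powr \<delta>0 * (1 / (2 ^ n * (1 - cmod w))) powr \<delta>"
        proof -
          have w1: "0 < 1 - cmod w" using elim by simp
          have "l / (1 - cmod w) \<le> (2 / 2 ^ n) / (1 - cmod w)" using n(2) w1 by (intro divide_right_mono) auto
          also have "\<dots> = 2 * (1 / (2 ^ n * (1 - cmod w)))" by simp
          finally have "(l / (1 - cmod w)) powr \<delta> \<le> (2 * (1 / (2 ^ n * (1 - cmod w)))) powr \<delta>"
            using d l0 w1 by (intro powr_mono2) auto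
          also have "\<dots> = 2 powr \<delta> * (1 / (2 ^ n * (1 - cmod w))) powr \<delta>"
            using w1 by (subst powr_mult) auto
          also have "\<dots> \<le> 2 powr \<delta>0 * (1 / (2 ^ n * (1 - cmod w))) powr \<delta>"
            using d by (intro mult_right_mono powr_mono) auto
          finally show ?thesis .
        qed
        ultimately show ?thesis using True by (simp add: ennreal_leI flip: ennreal_mult)
      qed simp
    qed
  qed
  also have "\<dots> = ennreal (2 powr \<delta>0) * (\<integral>\<^sup>+w\<in>carleson_box (Arg z) n. ennreal ((1 / (2 ^ n * (1 - cmod w))) powr \<delta>) \<partial>\<mu>)"
  proof (rule nn_integral_cmult)
    have [measurable]: "carleson_box (Arg z) n \<in> sets \<mu>" by (simp add: carleson_box_def)
    have [measurable]: "(\<lambda>w. (1 / (2 ^ n * (1 - cmod w))) powr \<delta>) \<in> borel_measurable \<mu>"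
      by (rule borel_imp_measurable) measurable
    show "(\<lambda>w. ennreal ((1 / (2 ^ n * (1 - cmod w))) powr \<delta>) * indicator (carleson_box (Arg z) n) w) \<in> borel_measurable \<mu>"
      by measurable
  qed
  also have "\<dots> \<le> ennreal (2 powr \<delta>0) * ennreal (A0 * measure \<mu> (carleson_box (Arg z) n))"
    by (intro mult_left_mono box_integral d) auto
  also have "\<dots> = ennreal (2 powr \<delta>0 * (A0 * measure \<mu> (carleson_box (Arg z) n)))"
    using A0_pos by (intro ennreal_mult[symmetric]) auto
  also have "\<dots> \<le> ennreal (2 powr \<delta>0 * (A0 * (C * measure \<mu> (near z (4 * l)))))"
    using A0_pos box by (intro ennreal_leI mult_left_mono) auto
  finally show ?thesis by (simp only: mult.assoc)
qed

text \<open>The disc is cut into shells \<open>l k <= |1 - cnj z w| < 2 * l k\<close> with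
  \<open>l k = 2 ^ k * (1 - |z|)\<close>. On the k-th shell the numerator supplies
  \<open>2 powr (- \<delta> * k)\<close> and \<open>shell_integral\<close> bounds the rest, so the
  shells add up to a geometric series. This is the Schur condition for the test function
  \<open>(1 - |w|) powr (- \<delta>)\<close>.\<close>

lemma schur_integral:
  assumes d: "0 < \<delta>" "\<delta> \<le> \<delta>0"
  obtains K where "0 < K" "\<And>z. z \<in> disc \<Longrightarrow>
    (\<integral>\<^sup>+w. ennreal (((1 - cmod z) / (1 - cmod w)) powr \<delta> / measure \<mu> (near z (4 * cmod (1 - cnj z * w)))) \<partial>\<mu>) \<le> ennreal K"
proof -
  define B where "B = 2 powr \<delta>0 * A0 * C"
  have B: "0 < B" using A0_pos C2 by (simp add: B_def)
  define q where "q = 2 powr (- \<delta>)"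
  have q: "0 < q" "q < 1" using d by (auto simp: q_def powr_less_one)
  have "(\<integral>\<^sup>+w. ennreal (((1 - cmod z) / (1 - cmod w)) powr \<delta> / measure \<mu> (near z (4 * cmod (1 - cnj z * w)))) \<partial>\<mu>) \<le> ennreal (B / (1 - q))"
    if z: "z \<in> disc" for z
  proof -
    define \<tau> where "\<tau> = 1 - cmod z"
    have tau: "0 < \<tau>" "\<tau> \<le> 1" using z by (auto simp: \<tau>_def)
    define l where "l = (\<lambda>k::nat. 2 ^ k * \<tau>)"
    have l0: "0 < l k" "\<tau> \<le> l k" for k using tau by (auto simp: l_def)
    define M where "M = (\<lambda>k. measure \<mu> (near z (4 * l k)))"
    have M0: "0 < M k" for k unfolding M_def using l0 by (intro measure_near_pos z) (auto simp: \<tau>_def)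
    \<comment> \<open>Shells with \<open>l k > 2\<close> are empty, as
      \<open>|1 - cnj z w| <= 2\<close>; the value 0 there respects the range of
      \<open>shell_integral\<close>.\<close>
    define g where "g = (\<lambda>k w. if l k \<le> 2 then ennreal (q ^ k / M k) * (ennreal ((l k / (1 - cmod w)) powr \<delta>) * indicator (near z (2 * l k)) w) else 0)"
    have pt: "ennreal (((1 - cmod z) / (1 - cmod w)) powr \<delta> / measure \<mu> (near z (4 * cmod (1 - cnj z * w)))) \<le> (\<Sum>k. g k w)"
      if w: "w \<in> disc" for w
    proof -
      define r where "r = cmod (1 - cnj z * w)"
      have r: "\<tau> \<le> r" "r \<le> 2" using cmod_one_minus_ge[of z w] z w by (auto simp: r_def \<tau>_def)
      define k where "k = nat \<lfloor>log 2 (r / \<tau>)\<rfloor>"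
      have "0 \<le> log 2 (r / \<tau>)" using r tau by simp
      then have k: "real k \<le> log 2 (r / \<tau>)" "log 2 (r / \<tau>) < real k + 1" unfolding k_def by linarith+
      have "2 powr real k \<le> r / \<tau>" "r / \<tau> < 2 powr (real k + 1)"
        using k r tau by (auto simp: le_log_iff log_less_iff)
      then have lr: "l k \<le> r" "r < 2 * l k"
        using tau by (auto simp: l_def powr_realpow powr_add field_simps)
      have "((1 - cmod z) / (1 - cmod w)) powr \<delta> = (l k / (1 - cmod w) * (1 / 2 ^ k)) powr \<delta>"
        by (simp add: l_def \<tau>_def)
      also have "\<dots> = (l k / (1 - cmod w)) powr \<delta> * (1 / 2 ^ k) powr \<delta>"
        by (rule powr_mult)
      also have "(1 / 2 ^ k) powr \<delta> = q ^ k"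
        unfolding q_def by (simp add: powr_minus powr_divide powr_realpow[symmetric] powr_powr powr_power inverse_eq_divide mult.commute power_one_over)
      finally have e: "((1 - cmod z) / (1 - cmod w)) powr \<delta> = (l k / (1 - cmod w)) powr \<delta> * q ^ k" .
      have "M k \<le> measure \<mu> (near z (4 * r))"
        unfolding M_def using lr by (intro finite_measure_mono near_mono) auto
      then have "((1 - cmod z) / (1 - cmod w)) powr \<delta> / measure \<mu> (near z (4 * r)) \<le> ((l k / (1 - cmod w)) powr \<delta> * q ^ k) / M k"
        unfolding e using M0[of k] q by (intro divide_left_mono) auto
      then have "ennreal (((1 - cmod z) / (1 - cmod w)) powr \<delta> / measure \<mu> (near z (4 * r))) \<le> ennreal (((l k / (1 - cmod w)) powr \<delta> * q ^ k) / M k)"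
        by (rule ennreal_leI)
      also have "\<dots> = ennreal (q ^ k / M k) * ennreal ((l k / (1 - cmod w)) powr \<delta>)"
        using M0[of k] q by (subst ennreal_mult[symmetric]) (auto simp: mult.commute)
      also have "\<dots> = g k w"
        using lr r w by (simp add: g_def near_def r_def)
      also have "\<dots> \<le> (\<Sum>k. g k w)" using sum_le_suminf[OF summableI, of "{k}" "\<lambda>k. g k w"] by simp
      finally show ?thesis by (simp only: r_def)
    qed
    have [measurable]: "(\<lambda>w. (l k / (1 - cmod w)) powr \<delta>) \<in> borel_measurable \<mu>" for k
      by (rule borel_imp_measurable) measurable
    have gm: "g k \<in> borel_measurable \<mu>" for k
      unfolding g_def by measurable
    have "(\<integral>\<^sup>+w. ennreal (((1 - cmod z) / (1 - cmod w)) powr \<delta> / measure \<mu> (near z (4 * cmod (1 - cnj z * w)))) \<partial>\<mu>)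
       \<le> (\<integral>\<^sup>+w. (\<Sum>k. g k w) \<partial>\<mu>)"
      by (intro nn_integral_mono pt) simp
    also have "\<dots> = (\<Sum>k. \<integral>\<^sup>+w. g k w \<partial>\<mu>)" by (intro nn_integral_suminf gm)
    also have "\<dots> \<le> (\<Sum>k. ennreal (B * q ^ k))"
    proof (intro suminf_le summableI)
      fix k
      show "(\<integral>\<^sup>+w. g k w \<partial>\<mu>) \<le> ennreal (B * q ^ k)"
      proof (cases "l k \<le> 2")
        case True
        have "(\<integral>\<^sup>+w. g k w \<partial>\<mu>) = ennreal (q ^ k / M k) * (\<integral>\<^sup>+w\<in>near z (2 * l k). ennreal ((l k / (1 - cmod w)) powr \<delta>) \<partial>\<mu>)"
          unfolding g_def using True by (simp add: nn_integral_cmult)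
        also have "\<dots> \<le> ennreal (q ^ k / M k) * ennreal (B * M k)"
          unfolding B_def M_def using l0[of k] True by (intro mult_left_mono shell_integral d z) (auto simp: \<tau>_def)
        also have "\<dots> = ennreal (B * q ^ k)"
          using M0[of k] B q by (subst ennreal_mult[symmetric]) auto
        finally show ?thesis .
      qed (simp add: g_def)
    qed
    also have "\<dots> = ennreal (\<Sum>k. B * q ^ k)"
      using q B by (intro suminf_ennreal2 summable_mult summable_geometric) auto
    also have "(\<Sum>k. B * q ^ k) = B * (1 / (1 - q))"
      using q by (intro sums_unique[symmetric] sums_mult geometric_sums) simp
    finally show ?thesis by simp
  qed
  then show thesis using B q by (intro that[of "B / (1 - q)"]) auto
qed

end

section \<open>The $B_q$ condition\<close>

text \<open>Young's inequality for \<open>f / a\<close> and \<open>g / b\<close>, where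
  \<open>a\<close> and \<open>b\<close> are the roots of the given bounds. A bound equal to 0 cannot
  serve for normalising, but it makes the product vanish almost everywhere.\<close>

lemma nn_integral_Holder:
  fixes f g :: "'a \<Rightarrow> real"
  assumes pr: "1 < p" "1 < r" "1 / p + 1 / r = 1"
    and f: "f \<in> borel_measurable M" "\<And>x. x \<in> space M \<Longrightarrow> 0 \<le> f x"
    and g: "g \<in> borel_measurable M" "\<And>x. x \<in> space M \<Longrightarrow> 0 \<le> g x"
    and A: "(\<integral>\<^sup>+x. ennreal (f x powr p) \<partial>M) \<le> ennreal A" "0 \<le> A"
    and B: "(\<integral>\<^sup>+x. ennreal (g x powr r) \<partial>M) \<le> ennreal B" "0 \<le> B"
  shows "(\<integral>\<^sup>+x. ennreal (f x * g x) \<partial>M) \<le> ennreal (A powr (1 / p) * B powr (1 / r))"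
proof -
  note [measurable] = f(1) g(1)
  have zero: "(\<integral>\<^sup>+x. ennreal (f x * g x) \<partial>M) = 0"
    if "(\<integral>\<^sup>+x. ennreal (h x powr s) \<partial>M) = 0" "h = f \<or> h = g" for h s
  proof -
    have [measurable]: "h \<in> borel_measurable M" using that(2) by auto
    have "AE x in M. ennreal (h x powr s) = 0"
      using that(1) by (subst (asm) nn_integral_0_iff_AE) auto
    then have "AE x in M. ennreal (f x * g x) = 0"
      using that(2) by (auto simp: ennreal_eq_0_iff elim!: eventually_mono)
    then show ?thesis by (subst nn_integral_0_iff_AE) auto
  qed
  consider "A = 0" | "B = 0" | "0 < A" "0 < B" using A B by fastforce
  then show ?thesis
  proof cases
    case 1
    then show ?thesis using zero[of f p] A(1) by simp
  next
    case 2
    then show ?thesis using zero[of g r] B(1) by simp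
  next
    case 3
    define a where "a = A powr (1 / p)"
    define b where "b = B powr (1 / r)"
    have ab: "0 < a" "0 < b" "a powr p = A" "b powr r = B"
      using 3 pr by (auto simp: a_def b_def powr_powr)
    have pt: "ennreal (f x * g x) \<le> ennreal (a * b / (p * A)) * ennreal (f x powr p) + ennreal (a * b / (r * B)) * ennreal (g x powr r)"
      if x: "x \<in> space M" for x
    proof -
      have "(f x / a) * (g x / b) \<le> (f x / a) powr p / p + (g x / b) powr r / r"
        using pr f(2)[OF x] g(2)[OF x] ab by (intro Youngs_inequality) auto
      also have "\<dots> = f x powr p / (p * A) + g x powr r / (r * B)"
        using f(2)[OF x] g(2)[OF x] ab by (simp add: powr_divide mult.commute)
      finally have "a * b * ((f x / a) * (g x / b)) \<le> a * b * (f x powr p / (p * A) + g x powr r / (r * B))"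
        using ab by (intro mult_left_mono) auto
      then have "f x * g x \<le> a * b / (p * A) * f x powr p + a * b / (r * B) * g x powr r"
        using ab by (simp add: distrib_left)
      then have "ennreal (f x * g x) \<le> ennreal (a * b / (p * A) * f x powr p + a * b / (r * B) * g x powr r)"
        by (rule ennreal_leI)
      also have "\<dots> = ennreal (a * b / (p * A)) * ennreal (f x powr p) + ennreal (a * b / (r * B)) * ennreal (g x powr r)"
        using ab 3 pr by (subst ennreal_plus, simp, simp, subst (1 2) ennreal_mult) auto
      finally show ?thesis .
    qed
    have "(\<integral>\<^sup>+x. ennreal (f x * g x) \<partial>M) \<le> (\<integral>\<^sup>+x. ennreal (a * b / (p * A)) * ennreal (f x powr p) + ennreal (a * b / (r * B)) * ennreal (g x powr r) \<partial>M)"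
      by (intro nn_integral_mono pt)
    also have "\<dots> = ennreal (a * b / (p * A)) * (\<integral>\<^sup>+x. ennreal (f x powr p) \<partial>M) + ennreal (a * b / (r * B)) * (\<integral>\<^sup>+x. ennreal (g x powr r) \<partial>M)"
      by (simp add: nn_integral_add nn_integral_cmult)
    also have "\<dots> \<le> ennreal (a * b / (p * A)) * ennreal A + ennreal (a * b / (r * B)) * ennreal B"
      by (intro add_mono mult_left_mono A B) auto
    also have "\<dots> = ennreal (a * b / (p * A) * A + a * b / (r * B) * B)"
      using 3 ab pr by (subst ennreal_plus, simp, simp, subst (1 2) ennreal_mult) auto
    also have "a * b / (p * A) * A + a * b / (r * B) * B = a * b * (1 / p + 1 / r)"
      using 3 pr by (simp add: field_simps)
    finally show ?thesis by (simp add: pr a_def b_def)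
  qed
qed

section \<open>Carleson squares\<close>

lemma Carleson_square_iff:
  "w \<in> Carleson_square z \<longleftrightarrow> cmod z < cmod w \<and> cmod w < 1 \<and> \<bar>Arg (z * cis (- Arg w))\<bar> < (1 - cmod z) / 2"
proof
  assume "w \<in> Carleson_square z"
  then obtain r \<theta> where w: "w = of_real r * cis \<theta>" "cmod z < r" "r < 1" "\<bar>Arg (z * cis (- \<theta>))\<bar> < (1 - cmod z) / 2"
    by (auto simp: Carleson_square_def)
  have r: "0 < r" using w(2) norm_ge_zero[of z] by linarith
  have "cis (Arg w) = cis \<theta>"
    using r w(1) by (subst cis_Arg) (auto simp: sgn_eq norm_mult)
  then have "cis (- Arg w) = cis (- \<theta>)" by (metis cis_cnj)
  then show "cmod z < cmod w \<and> cmod w < 1 \<and> \<bar>Arg (z * cis (- Arg w))\<bar> < (1 - cmod z) / 2"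
    using w r by (simp add: norm_mult)
next
  assume *: "cmod z < cmod w \<and> cmod w < 1 \<and> \<bar>Arg (z * cis (- Arg w))\<bar> < (1 - cmod z) / 2"
  then show "w \<in> Carleson_square z"
    unfolding Carleson_square_def mem_Collect_eq
    by (intro exI[of _ "cmod w"] exI[of _ "Arg w"]) (use rcis_cmod_Arg[of w] in \<open>simp add: rcis_def\<close>)
qed

lemma Carleson_square_borel [measurable]: "Carleson_square z \<in> sets borel"
proof -
  have [measurable]: "cis \<in> borel_measurable borel"
    by (intro borel_measurable_continuous_onI continuous_intros)
  have "Carleson_square z = {w \<in> space borel. cmod z < cmod w \<and> cmod w < 1 \<and> \<bar>Arg (z * cis (- Arg w))\<bar> < (1 - cmod z) / 2}"
    by (auto simp: Carleson_square_iff)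
  also have "\<dots> \<in> sets borel" by measurable
  finally show ?thesis .
qed

lemma Carleson_square_subset_disc: "Carleson_square z \<subseteq> disc" by (auto simp: Carleson_square_iff)

lemma sets_Carleson_square [simp]: "Carleson_square z \<in> sets dA"
  by (intro sets_dA_borel Carleson_square_subset_disc Carleson_square_borel)

text \<open>A Carleson square has half-aperture \<open>(1 - r) / 2\<close>, a sector
  \<open>pi / 2 ^ n\<close>. The two sets rotate different points, which flips the sign of the
  angle; \<open>|x| < pi\<close> avoids the endpoint where \<open>Arg\<close> does not change
  sign.\<close>

lemma sector_subset_Carleson:
  assumes r: "0 < r" "r < 1" and h: "h \<le> 1 - r" and n: "pi / 2 ^ n < (1 - r) / 2"
  shows "sector \<beta> n h \<subseteq> Carleson_square (of_real r * cis \<beta>)"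
proof
  fix w assume w: "w \<in> sector \<beta> n h"
  have rw: "r < cmod w" "cmod w < 1" using w h by (auto simp: sector_iff)
  define x where "x = Arg (w * cis (- \<beta>))"
  have x: "\<bar>x\<bar> < (1 - r) / 2" using w n unfolding sector_iff x_def[symmetric] greaterThanAtMost_iff by linarith
  have xpi: "\<bar>x\<bar> < pi" using x r pi_gt3 by argo
  have "w * cis (- \<beta>) = cmod w * cis x"
    using rcis_cmod_Arg[of "w * cis (- \<beta>)"] unfolding x_def rcis_def by (simp add: norm_mult)
  moreover have "w = cmod w * cis (Arg w)" using rcis_cmod_Arg[of w] by (simp add: rcis_def)
  ultimately have "cmod w * (cis (Arg w) * cis (- \<beta>)) = cmod w * cis x" by (metis mult.assoc)
  moreover have "w \<noteq> 0" using rw r by auto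
  ultimately have "cis (Arg w - \<beta>) = cis x" by (simp add: cis_mult)
  then have "cis (\<beta> - Arg w) = cis (- x)" by (metis cis_cnj minus_diff_eq)
  then have "of_real r * cis \<beta> * cis (- Arg w) = rcis r (- x)" by (simp add: rcis_def cis_mult mult.assoc)
  then have "Arg (of_real r * cis \<beta> * cis (- Arg w)) = - x" using xpi r by (subst Arg_rcis[symmetric, of _ r]) auto
  then show "w \<in> Carleson_square (of_real r * cis \<beta>)"
    using rw x r by (simp add: Carleson_square_iff norm_mult)
qed

lemma Carleson_square_mono:
  assumes "0 < r" "r \<le> r'" "r' < 1"
  shows "Carleson_square (of_real r' * cis \<beta>) \<subseteq> Carleson_square (of_real r * cis \<beta>)"
proof
  fix w assume w: "w \<in> Carleson_square (of_real r' * cis \<beta>)"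
  have "Arg (of_real r' * (cis \<beta> * cis (- Arg w))) = Arg (of_real r * (cis \<beta> * cis (- Arg w)))"
    using assms by (simp add: Arg_times_of_real)
  then have "Arg (of_real r * cis \<beta> * cis (- Arg w)) = Arg (of_real r' * cis \<beta> * cis (- Arg w))"
    by (simp only: mult.assoc)
  then show "w \<in> Carleson_square (of_real r * cis \<beta>)"
    using w assms by (simp add: Carleson_square_iff norm_mult)
qed

lemma cmod_cis_diff_le: "cmod (cis x - 1) \<le> \<bar>x\<bar>"
proof -
  have "(cmod (cis x - 1))\<^sup>2 = 2 * (1 - cos x)"
    unfolding cmod_power2 using sin_cos_squared_add[of x] by (simp add: power2_eq_square algebra_simps)
  also have "1 - cos x = 2 * (sin (x / 2))\<^sup>2" using cos_double_sin[of "x / 2"] by simp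
  also have "2 * (2 * (sin (x / 2))\<^sup>2) \<le> 2 * (2 * (x / 2)\<^sup>2)"
    using abs_sin_x_le_abs_x[of "x / 2"] by (intro mult_left_mono) (auto simp only: abs_le_square_iff)
  also have "\<dots> = \<bar>x\<bar>\<^sup>2" by (simp add: power_divide)
  finally show ?thesis by (rule power2_le_imp_le) simp
qed

text \<open>With \<open>l = 1 - |z|\<close>, a point of the square differs from the boundary point
  \<open>cis (Arg z)\<close> by at most \<open>l\<close> radially and \<open>l / 2\<close> along the
  arc. The disc of radius \<open>3 / 2 * l\<close> has area at most \<open>9 * l^2\<close>, as
  \<open>pi < 4\<close>.\<close>

lemma measure_Carleson_square_le:
  assumes z: "z \<in> disc" "z \<noteq> 0"
  shows "measure lebesgue (Carleson_square z) \<le> 9 * (1 - cmod z)\<^sup>2"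
proof -
  define l where "l = 1 - cmod z"
  have l: "0 < l" using z by (simp add: l_def)
  have "Carleson_square z \<subseteq> cball (cis (Arg z)) (3 / 2 * l)"
  proof
    fix w assume w: "w \<in> Carleson_square z"
    define x where "x = Arg (z * cis (- Arg w))"
    have x: "\<bar>x\<bar> < l / 2" using w by (simp add: Carleson_square_iff x_def l_def)
    have "z * cis (- Arg w) = cmod z * cis x"
      using rcis_cmod_Arg[of "z * cis (- Arg w)"] unfolding x_def rcis_def by (simp add: norm_mult)
    moreover have "z = cmod z * cis (Arg z)" using rcis_cmod_Arg[of z] by (simp add: rcis_def)
    ultimately have "cmod z * (cis (Arg z) * cis (- Arg w)) = cmod z * cis x" by (metis mult.assoc)
    then have "cis (Arg z - Arg w) = cis x" using z by (simp add: cis_mult)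
    then have "cis (Arg w) * cis x = cis (Arg z)" by (metis cis_mult add_diff_cancel_left' diff_add_cancel add.commute)
    moreover have "w = cmod w * cis (Arg w)" using rcis_cmod_Arg[of w] by (simp add: rcis_def)
    ultimately have "cis (Arg z) - w = cis (Arg w) * (cis x - 1) + of_real (1 - cmod w) * cis (Arg w)"
      by (simp add: algebra_simps)
    then have "cmod (cis (Arg z) - w) \<le> cmod (cis (Arg w) * (cis x - 1)) + cmod (of_real (1 - cmod w) * cis (Arg w))"
      by (metis norm_triangle_ineq)
    also have "\<dots> = cmod (cis x - 1) + \<bar>1 - cmod w\<bar>" by (simp only: norm_mult norm_cis norm_of_real mult_1_left mult_1_right)
    also have "\<dots> \<le> l / 2 + l"
      using cmod_cis_diff_le[of x] x w unfolding Carleson_square_iff l_def by linarith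
    finally show "w \<in> cball (cis (Arg z)) (3 / 2 * l)" by (simp add: dist_norm)
  qed
  then have "measure lebesgue (Carleson_square z) \<le> measure lebesgue (cball (cis (Arg z)) (3 / 2 * l))"
    by (intro measure_mono_fmeasurable) auto
  also have "\<dots> = pi * (3 / 2 * l)\<^sup>2"
    using l by (simp add: content_cball eval_unit_ball_vol)
  also have "\<dots> = (pi * 9 / 4) * l\<^sup>2" by (simp add: power2_eq_square)
  also have "\<dots> \<le> 9 * l\<^sup>2"
    using pi_less_4 by (intro mult_right_mono) auto
  finally show ?thesis by (simp add: l_def)
qed

section \<open>The two weights of the B_q condition and their measures\<close>

locale bekolle_weight =
  fixes q :: real and \<omega> :: "complex \<Rightarrow> real"
  assumes q1: "1 < q" and bq: "Bq_weight q \<omega>"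
begin

text \<open>\<open>v\<close> and \<open>\<sigma>\<close> are the two integrands of the B_q
  condition; \<open>\<sigma>\<close> is the density dual to \<open>\<omega>\<close> in Hoelder's
  inequality with exponent \<open>q\<close>.\<close>

definition v where "v w = \<omega> w * (1 - (cmod w)\<^sup>2) powr (2 * q)"
definition \<sigma> where "\<sigma> w = \<omega> w powr (- 1 / (q - 1))"
definition V where "V = density dA (\<lambda>w. ennreal (v w))"
definition S where "S = density dA (\<lambda>w. ennreal (\<sigma> w))"

lemma omega: "\<And>w. w \<in> disc \<Longrightarrow> 0 \<le> \<omega> w" "integrable dA \<omega>" "AE w in dA. 0 < \<omega> w"
  using bq by (auto simp: Bq_weight_def weight_def)

lemma omega_measurable [measurable]: "\<omega> \<in> borel_measurable dA"
  using omega(2) by auto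

lemma one_minus_measurable [measurable]: "(\<lambda>w. (1 - (cmod w)\<^sup>2) powr s) \<in> borel_measurable dA"
  by (rule borel_imp_measurable_dA) measurable

lemma v_measurable [measurable]: "v \<in> borel_measurable dA"
  unfolding v_def by measurable

lemma sigma_measurable [measurable]: "\<sigma> \<in> borel_measurable dA"
  unfolding \<sigma>_def by measurable

lemma v_nonneg: "w \<in> disc \<Longrightarrow> 0 \<le> v w" by (simp add: v_def omega)

lemma sigma_nonneg: "0 \<le> \<sigma> w" by (simp add: \<sigma>_def)

lemma sets_VS [simp]: "sets V = sets dA" "sets S = sets dA" "space V = disc" "space S = disc"
  by (simp_all add: V_def S_def)

lemma emeasure_V: "A \<in> sets dA \<Longrightarrow> emeasure V A = (\<integral>\<^sup>+w\<in>A. ennreal (v w) \<partial>dA)"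
  unfolding V_def by (rule emeasure_density) auto

lemma emeasure_S: "A \<in> sets dA \<Longrightarrow> emeasure S A = (\<integral>\<^sup>+w\<in>A. ennreal (\<sigma> w) \<partial>dA)"
  unfolding S_def by (rule emeasure_density) auto

lemma finite_V: "finite_measure V"
proof (rule finite_measureI)
  have "emeasure V disc = (\<integral>\<^sup>+w\<in>disc. ennreal (v w) \<partial>dA)" by (rule emeasure_V) (auto intro!: sets_dA_borel)
  also have "\<dots> \<le> (\<integral>\<^sup>+w. ennreal (\<omega> w) \<partial>dA)"
  proof (rule nn_integral_mono)
    fix w assume "w \<in> space dA"
    then have w: "w \<in> disc" by simp
    have "(1 - (cmod w)\<^sup>2) powr (2 * q) \<le> 1 powr (2 * q)"
      using w q1 by (intro powr_mono2) (auto simp: power_le_one)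
    then have "v w \<le> \<omega> w" using omega(1)[OF w] unfolding v_def by (intro mult_left_le) auto
    then show "ennreal (v w) * indicator disc w \<le> ennreal (\<omega> w)" by (auto intro: ennreal_leI split: split_indicator)
  qed
  also have "\<dots> = ennreal (\<integral>w. \<omega> w \<partial>dA)"
    by (rule nn_integral_eq_integral[OF omega(2)]) (auto intro!: AE_I2 omega(1))
  also have "\<dots> < \<infinity>" by simp
  finally show "emeasure V (space V) \<noteq> \<infinity>" by simp
qed

lemma pos_measure:
  assumes A: "A \<in> sets dA" "0 < emeasure dA A"
  shows "0 < emeasure V A" "0 < emeasure S A"
proof -
  have key: "0 < (\<integral>\<^sup>+w\<in>A. ennreal (u w) \<partial>dA)" if [measurable]: "u \<in> borel_measurable dA" and u: "AE w in dA. 0 < u w" for u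
  proof (rule ccontr)
    note [measurable] = A(1)
    assume "\<not> 0 < (\<integral>\<^sup>+w\<in>A. ennreal (u w) \<partial>dA)"
    then have "AE w in dA. ennreal (u w) * indicator A w = 0"
      by (subst nn_integral_0_iff_AE[symmetric]) auto
    with u have "AE w in dA. w \<notin> A"
      by eventually_elim (auto split: split_indicator_asm simp: ennreal_eq_0_iff)
    then have "A \<in> null_sets dA" using A(1) by (simp add: AE_iff_null_sets)
    then show False using A(2) by (auto simp: null_sets_def)
  qed
  have "AE w in dA. 0 < v w"
  proof -
    have "AE w in dA. w \<in> disc" by (rule AE_I2) simp
    with omega(3) show ?thesis
    proof eventually_elim
      case (elim w)
      then have "(cmod w)\<^sup>2 < 1" by (simp add: abs_square_less_1)
      then show ?case using elim by (simp add: v_def)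
    qed
  qed
  then show "0 < emeasure V A" unfolding emeasure_V[OF A(1)] by (intro key) auto
  have "AE w in dA. 0 < \<sigma> w" using omega(3) by eventually_elim (simp add: \<sigma>_def)
  then show "0 < emeasure S A" unfolding emeasure_S[OF A(1)] by (intro key) auto
qed

text \<open>The supremum lives in \<open>[0, \<infinity>]\<close>. It becomes a real inequality
  because \<open>V\<close> of a square is positive, so an infinite \<open>S\<close> of it would make
  the product infinite. The powers of the area combine to
  \<open>|Q|^2 * (|Q|^2)^(q - 1) = |Q|^(2 q)\<close>.\<close>

lemma Carleson_bound:
  obtains K where "0 < K" "\<And>z. z \<in> disc \<Longrightarrow> z \<noteq> 0 \<Longrightarrow> 0 < emeasure dA (Carleson_square z) \<Longrightarrow>
    emeasure S (Carleson_square z) < \<infinity> \<and>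
    measure V (Carleson_square z) * measure S (Carleson_square z) powr (q - 1) \<le> K * measure lebesgue (Carleson_square z) powr (2 * q)"
proof -
  interpret V: finite_measure V by (rule finite_V)
  let ?F = "\<lambda>Q. (ennreal (1 / (measure lebesgue Q)\<^sup>2) * emeasure V Q) *
        ennpowr (ennreal (1 / (measure lebesgue Q)\<^sup>2) * emeasure S Q) (q - 1)"
  define s where "s = (SUP Q \<in> Carleson_square ` (disc - {0}). ?F Q)"
  have "s = (SUP Q \<in> Carleson_square ` (disc - {0}).
        (ennreal (1 / (measure lebesgue Q)\<^sup>2) *
           (\<integral>\<^sup>+z\<in>Q. ennreal (\<omega> z * (1 - (cmod z)\<^sup>2) powr (2 * q)) \<partial>dA)) *
        ennpowr
          (ennreal (1 / (measure lebesgue Q)\<^sup>2) *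
             (\<integral>\<^sup>+z\<in>Q. ennreal (\<omega> z powr (- 1 / (q - 1))) \<partial>dA))
          (q - 1))"
    unfolding s_def by (intro SUP_cong refl) (auto simp: emeasure_V emeasure_S v_def \<sigma>_def)
  then have "s < \<infinity>" using bq unfolding Bq_weight_def by simp
  define K where "K = enn2real s + 1"
  have K: "0 < K" "s \<le> ennreal K" using \<open>s < \<infinity>\<close> by (auto simp: K_def add_nonneg_pos ennreal_enn2real_if intro: order_trans[OF _ ennreal_leI[of "enn2real s"]])
  show thesis
  proof (rule that[OF K(1)])
    fix z assume z: "z \<in> disc" "z \<noteq> 0" and pos: "0 < emeasure dA (Carleson_square z)"
    define Q where "Q = Carleson_square z"
    have Qs: "Q \<in> sets dA" by (simp add: Q_def)
    have Qb: "Q \<in> sets borel" "Q \<subseteq> disc" unfolding Q_def using Carleson_square_subset_disc by auto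
    have F: "?F Q \<le> ennreal K"
      using SUP_upper[of Q "Carleson_square ` (disc - {0})" ?F] z K(2) by (auto simp: s_def Q_def intro: order_trans)
    have eQ: "emeasure dA Q = ennreal (1/pi) * emeasure lebesgue Q"
      using Qb unfolding dA_def
      by (subst emeasure_scale_measure) (auto simp: emeasure_restrict_space sets_restrict_space)
    have "emeasure lebesgue Q \<le> emeasure lebesgue disc" using Qb by (intro emeasure_mono) auto
    also have "\<dots> < \<infinity>" by (simp add: emeasure_ball)
    finally have "emeasure lebesgue Q = ennreal (measure lebesgue Q)" by (intro emeasure_eq_ennreal_measure) auto
    then have m: "0 < measure lebesgue Q" using pos eQ unfolding Q_def[symmetric] by (auto simp: zero_less_measure_iff intro: ccontr)
    define A where "A = (measure lebesgue Q)\<^sup>2"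
    have A: "0 < A" using m by (simp add: A_def)
    have VQ: "emeasure V Q = ennreal (measure V Q)" "0 < measure V Q"
      using pos_measure(1)[OF Qs] pos by (auto simp: V.emeasure_eq_measure Q_def)
    have fin: "emeasure S Q \<noteq> \<infinity>"
    proof
      assume "emeasure S Q = \<infinity>"
      then have "?F Q = \<infinity>" using A VQ by (simp add: A_def[symmetric] ennpowr_def ennreal_mult_top ennreal_mult_eq_top_iff)
      then show False using F by (simp add: top_unique)
    qed
    then have SQ: "emeasure S Q = ennreal (measure S Q)" by (intro emeasure_eq_ennreal_measure) auto
    have "?F Q = ennreal (measure V Q / A * (measure S Q / A) powr (q - 1))"
      unfolding VQ(1) SQ A_def[symmetric] using A
      by (simp add: ennpowr_def ennreal_mult[symmetric] ennreal_neq_top)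
    with F have "measure V Q / A * (measure S Q / A) powr (q - 1) \<le> K"
      using K(1) by (simp add: ennreal_le_iff)
    then have "measure V Q * measure S Q powr (q - 1) \<le> K * (A * A powr (q - 1))"
      using A by (simp add: powr_divide field_simps)
    also have "A * A powr (q - 1) = measure lebesgue Q powr (2 * q)"
    proof -
      have "A * A powr (q - 1) = A powr q" using A by (simp add: powr_mult_base)
      moreover have "A = measure lebesgue Q powr 2" using m by (simp add: A_def powr_numeral)
      ultimately show ?thesis by (simp only: powr_powr)
    qed
    finally show "emeasure S (Carleson_square z) < \<infinity> \<and>
      measure V (Carleson_square z) * measure S (Carleson_square z) powr (q - 1) \<le> K * measure lebesgue (Carleson_square z) powr (2 * q)"
      using fin by (simp add: Q_def less_top[symmetric])
  qed
qed

lemma emeasure_dA_0: "emeasure dA {0} = 0"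
proof -
  have "{0} \<in> sets dA" by (rule sets_dA_borel) auto
  moreover have "AE w in dA. w \<notin> {0}" using AE_dA[OF AE_lborel_singleton[of 0]] by simp
  ultimately have "{0} \<in> null_sets dA" using AE_iff_null_sets by blast
  then show ?thesis by auto
qed

lemma emeasure_VS_0: "emeasure V {0} = 0" "emeasure S {0} = 0"
proof -
  have "{0} \<in> null_sets dA" using emeasure_dA_0 by (auto simp: null_sets_def intro!: sets_dA_borel)
  then show "emeasure V {0} = 0" "emeasure S {0} = 0"
    by (auto simp: emeasure_V emeasure_S null_sets_def intro!: nn_integral_null_set)
qed

lemma measure_VS_0: "measure V {0} = 0" "measure S {0} = 0"
  by (simp_all add: measure_def emeasure_VS_0)

lemma ball_pos_dA: "ball \<xi> t \<subseteq> disc \<Longrightarrow> 0 < t \<Longrightarrow> ball \<xi> t \<in> sets dA \<and> 0 < emeasure dA (ball \<xi> t)"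
  by (auto simp: emeasure_dA_ball intro!: sets_dA_borel)

lemma box_pos_dA: "0 < emeasure dA (carleson_box \<beta> n)"
proof -
  define h where "h = (1::real) / 2 ^ n"
  define \<xi> where "\<xi> = of_real (1 - h / 4) * cis \<beta>"
  note bb = ball_subset_box[where n = n and \<beta> = \<beta>, folded h_def, folded \<xi>_def]
  have "ball \<xi> (h / 8) \<subseteq> disc" using bb(2) sector_subset_disc by (fastforce simp: carleson_box_def)
  then have "0 < emeasure dA (ball \<xi> (h / 8))" using ball_pos_dA[of \<xi> "h / 8"] by (simp add: h_def)
  also have "\<dots> \<le> emeasure dA ({0} \<union> carleson_box \<beta> n)"
    using bb(2) by (intro emeasure_mono sets.Un) (auto simp: carleson_box_def intro!: sets_dA_borel)
  also have "\<dots> \<le> emeasure dA {0} + emeasure dA (carleson_box \<beta> n)"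
    by (rule emeasure_subadditive) (auto simp: carleson_box_def intro!: sets_dA_borel)
  finally show ?thesis by (simp add: emeasure_dA_0)
qed

lemma Carleson_pos_dA:
  assumes "z \<in> disc" "z \<noteq> 0"
  shows "0 < emeasure dA (Carleson_square z)"
proof -
  define r where "r = cmod z"
  have r: "0 < r" "r < 1" using assms by (auto simp: r_def)
  obtain n where n: "(1 / 2) ^ n < (1 - r) / 8"
    using real_arch_pow_inv[of "(1 - r) / 8" "1 / 2"] r by auto
  have "pi / 2 ^ n \<le> 4 * (1 / 2) ^ n" using pi_less_4 by (simp add: power_one_over field_simps)
  then have "pi / 2 ^ n < (1 - r) / 2" using n by linarith
  then have "sector (Arg z) n (1 - r) \<subseteq> Carleson_square (of_real r * cis (Arg z))"
    using r by (intro sector_subset_Carleson) auto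
  moreover have "of_real r * cis (Arg z) = z" using rcis_cmod_Arg[of z] by (simp add: rcis_def r_def)
  moreover have "carleson_box (Arg z) n \<subseteq> sector (Arg z) n (1 - r)"
    unfolding carleson_box_def using n r by (intro sector_mono) (auto simp: power_one_over)
  ultimately have "emeasure dA (carleson_box (Arg z) n) \<le> emeasure dA (Carleson_square z)"
    by (intro emeasure_mono) auto
  then show ?thesis using box_pos_dA[of "Arg z" n] by order
qed

text \<open>A sector of aperture \<open>pi/8\<close> is exhausted by sectors inside Carleson squares \<open>Q\<^sub>z\<close> with \<open>z \<rightarrow> 0\<close>.
  As \<open>V(Q\<^sub>z)\<close> stays away from 0, the $B_q$ condition bounds \<open>S(Q\<^sub>z)\<close>.\<close>

lemma finite_S: "finite_measure S"
proof -
  interpret V: finite_measure V by (rule finite_V)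
  obtain K where K: "0 < K" "\<And>z. z \<in> disc \<Longrightarrow> z \<noteq> 0 \<Longrightarrow> 0 < emeasure dA (Carleson_square z) \<Longrightarrow>
    emeasure S (Carleson_square z) < \<infinity> \<and>
    measure V (Carleson_square z) * measure S (Carleson_square z) powr (q - 1) \<le> K * measure lebesgue (Carleson_square z) powr (2 * q)"
    using Carleson_bound by blast
  have sec4: "emeasure S (sector \<beta> 4 1) < \<infinity>" for \<beta>
  proof -
    define z where "z = (\<lambda>n::nat. of_real (1 / (n + 2)) * cis \<beta>)"
    have zn: "cmod (z n) = 1 / (n + 2)" for n
      unfolding z_def norm_mult norm_of_real norm_cis by simp
    have z: "z n \<in> disc" "z n \<noteq> 0" "cmod (z n) = 1 / (n + 2)" for n
    proof -
      have "0 < cmod (z n)" unfolding zn by simp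
      then show "z n \<noteq> 0" by auto
    qed (auto simp: zn)
    \<comment> \<open>The squares grow as \<open>z n\<close> tends to 0, so the first one gives a
      lower bound for all the \<open>V\<close>-masses.\<close>
    define c where "c = measure V (Carleson_square (z 0))"
    have c: "0 < c"
      using pos_measure(1)[OF sets_Carleson_square Carleson_pos_dA[OF z(1,2)], of 0] by (simp add: c_def V.emeasure_eq_measure)
    define B where "B = (K * 9 powr (2 * q) / c) powr (1 / (q - 1))"
    have SB: "emeasure S (Carleson_square (z n)) \<le> ennreal B" for n
    proof -
      have f: "emeasure S (Carleson_square (z n)) < \<infinity>"
        and le: "measure V (Carleson_square (z n)) * measure S (Carleson_square (z n)) powr (q - 1) \<le> K * measure lebesgue (Carleson_square (z n)) powr (2 * q)"
        using K(2)[OF z(1,2) Carleson_pos_dA[OF z(1,2)]] by auto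
      have "(1 - cmod (z n))\<^sup>2 \<le> 1" unfolding z(3) by (intro power_le_one) auto
      then have m9: "measure lebesgue (Carleson_square (z n)) \<le> 9"
        using measure_Carleson_square_le[OF z(1,2), of n] by linarith
      have "c \<le> measure V (Carleson_square (z n))"
        unfolding c_def z_def by (intro V.finite_measure_mono Carleson_square_mono) auto
      then have "c * measure S (Carleson_square (z n)) powr (q - 1) \<le> measure V (Carleson_square (z n)) * measure S (Carleson_square (z n)) powr (q - 1)"
        by (intro mult_right_mono) auto
      also note le
      also have "K * measure lebesgue (Carleson_square (z n)) powr (2 * q) \<le> K * 9 powr (2 * q)"
        using K(1) q1 m9 by (intro mult_left_mono powr_mono2) auto
      finally have "measure S (Carleson_square (z n)) powr (q - 1) \<le> K * 9 powr (2 * q) / c"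
        using c by (simp add: field_simps)
      then have "(measure S (Carleson_square (z n)) powr (q - 1)) powr (1 / (q - 1)) \<le> B"
        unfolding B_def using q1 by (intro powr_mono2) auto
      then have "measure S (Carleson_square (z n)) \<le> B" using q1 by (simp add: powr_powr)
      then show ?thesis using f by (subst emeasure_eq_ennreal_measure) (auto intro: ennreal_leI)
    qed
    define E where "E = (\<lambda>n::nat. sector \<beta> 4 (1 - 1 / (n + 2)))"
    have EU: "sector \<beta> 4 1 = (\<Union>n. E n)"
    proof (intro equalityI subsetI)
      fix w assume w: "w \<in> sector \<beta> 4 1"
      then have "0 < cmod w" by (auto simp: sector_iff)
      then obtain n where "inverse (real (Suc n)) < cmod w" using reals_Archimedean by blast
      moreover have "1 / (real n + 2) \<le> inverse (real (Suc n))" by (simp add: field_simps)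
      ultimately have "1 / (real n + 2) < cmod w" by linarith
      then show "w \<in> (\<Union>n. E n)" using w by (auto simp: E_def sector_iff)
    next
      fix w assume "w \<in> (\<Union>n. E n)"
      then obtain n where n: "w \<in> sector \<beta> 4 (1 - 1 / (real n + 2))" by (auto simp: E_def)
      have "1 - 1 / (real n + 2) \<le> 1" by simp
      then show "w \<in> sector \<beta> 4 1" using sector_mono n by blast
    qed
    have inc: "incseq E"
    proof (rule incseq_SucI)
      fix n
      have "1 - 1 / (real n + 2) \<le> 1 - 1 / (real (Suc n) + 2)" by (simp add: field_simps)
      then show "E n \<subseteq> E (Suc n)" unfolding E_def by (intro sector_mono) simp
    qed
    have "emeasure S (E n) \<le> ennreal B" for n
    proof -
      have "1 / (real n + 2) \<le> 1 / 2" by (simp add: field_simps)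
      \<comment> \<open>Aperture 4 is the widest that fits all the squares: the one at radius 1/2
        has half-aperture 1/4, which lies between \<open>pi / 16\<close> and
        \<open>pi / 8\<close>.\<close>
      moreover have "pi / 2 ^ 4 < 1 / 4" using pi_less_4 by simp
      moreover have "1 / 4 \<le> (1 - 1 / (real n + 2)) / 2" using calculation(1) by simp
      ultimately have "pi / 2 ^ 4 < (1 - 1 / (real n + 2)) / 2" by (meson less_le_trans)
      then have "E n \<subseteq> Carleson_square (z n)"
        unfolding E_def z_def by (intro sector_subset_Carleson) auto
      then have "emeasure S (E n) \<le> emeasure S (Carleson_square (z n))"
        by (intro emeasure_mono) auto
      also note SB
      finally show ?thesis .
    qed
    then have "(SUP n. emeasure S (E n)) \<le> ennreal B" by (intro SUP_least)
    moreover have "(SUP n. emeasure S (E n)) = emeasure S (sector \<beta> 4 1)"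
      unfolding EU by (intro SUP_emeasure_incseq inc) (auto simp: E_def)
    ultimately show ?thesis by (auto simp: order_le_less_trans)
  qed
  \<comment> \<open>Four halvings lead from the full circle to aperture 4; finiteness climbs back by
    subadditivity.\<close>
  have step: "\<forall>\<beta>. emeasure S (sector \<beta> n 1) < \<infinity>" if "\<forall>\<beta>. emeasure S (sector \<beta> (Suc n) 1) < \<infinity>" for n
  proof
    fix \<beta>
    have "emeasure S (sector \<beta> n 1) \<le> emeasure S (sector (\<beta> + pi / 2 ^ Suc n) (Suc n) 1) + emeasure S (sector (\<beta> - pi / 2 ^ Suc n) (Suc n) 1)"
      unfolding sector_halves(1)[OF order_refl, of \<beta> n] by (rule emeasure_subadditive) auto
    also have "\<dots> < \<infinity>" using that by (simp add: ennreal_add_less_top)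
    finally show "emeasure S (sector \<beta> n 1) < \<infinity>" .
  qed
  have "\<forall>\<beta>. emeasure S (sector \<beta> 0 1) < \<infinity>"
    using step[OF step[OF step[OF step]], of 0] sec4 by (simp add: numeral_eq_Suc)
  then have s0: "emeasure S (sector 0 0 1) < \<infinity>" by blast
  have "disc = {0} \<union> sector 0 0 1" using mpi_less_Arg Arg_le_pi by (auto simp: sector_iff)
  then have "emeasure S disc \<le> emeasure S {0} + emeasure S (sector 0 0 1)"
    by (metis emeasure_subadditive sets_VS(2) sets_sector sets_dA_borel centre_in_ball zero_less_one empty_subsetI insert_subset borel_singleton sets.empty_sets)
  then have "emeasure S disc < \<infinity>" using s0 by (simp add: emeasure_VS_0 order_le_less_trans)
  then show ?thesis by (intro finite_measureI) simp
qed

sublocale V: finite_measure V by (rule finite_V)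
sublocale S: finite_measure S by (rule finite_S)

lemma carleson_box_subset_disc: "carleson_box \<beta> n \<subseteq> disc"
  by (simp add: carleson_box_def sector_subset_disc)

lemma sets_box [simp]: "carleson_box \<beta> n \<in> sets dA" by (simp add: carleson_box_def)

lemma box_pos: "0 < measure V (carleson_box \<beta> n)" "0 < measure S (carleson_box \<beta> n)"
  using pos_measure[OF sets_box box_pos_dA, of \<beta> n] by (simp_all add: V.emeasure_eq_measure S.emeasure_eq_measure)

lemma ball_pos:
  assumes "ball \<xi> t \<subseteq> disc" "0 < t"
  shows "0 < measure V (ball \<xi> t)" "0 < measure S (ball \<xi> t)"
  using pos_measure[of "ball \<xi> t"] ball_pos_dA[OF assms] by (simp_all add: V.emeasure_eq_measure S.emeasure_eq_measure)

text \<open>For \<open>n >= 4\<close> the box lies in the Carleson square at radius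
  \<open>1 - 8 / 2 ^ n\<close>, whose half-aperture \<open>4 / 2 ^ n\<close> exceeds
  \<open>pi / 2 ^ n\<close>. Its area is at most \<open>9 * 64 / 4 ^ n\<close>, hence 576. The few
  larger boxes are covered by the total masses, which are finite by now.\<close>

lemma box_bound:
  obtains C where "0 < C" "\<And>\<beta> n. measure V (carleson_box \<beta> n) * measure S (carleson_box \<beta> n) powr (q - 1) \<le> C * (1 / 2 ^ n) powr (4 * q)"
proof -
  obtain K where K: "0 < K" "\<And>z. z \<in> disc \<Longrightarrow> z \<noteq> 0 \<Longrightarrow> 0 < emeasure dA (Carleson_square z) \<Longrightarrow>
    emeasure S (Carleson_square z) < \<infinity> \<and>
    measure V (Carleson_square z) * measure S (Carleson_square z) powr (q - 1) \<le> K * measure lebesgue (Carleson_square z) powr (2 * q)"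
    using Carleson_bound by blast
  define M where "M = measure V disc * measure S disc powr (q - 1)"
  have M: "0 \<le> M" by (simp add: M_def)
  define C where "C = K * 576 powr (2 * q) + M * 8 powr (4 * q)"
  have C: "0 < C" using K M by (simp add: C_def add_pos_nonneg)
  have "measure V (carleson_box \<beta> n) * measure S (carleson_box \<beta> n) powr (q - 1) \<le> C * (1 / 2 ^ n) powr (4 * q)" for \<beta> n
  proof (cases "n \<ge> 4")
    case True
    define l where "l = 8 / (2::real) ^ n"
    have "(2::real) ^ 4 \<le> 2 ^ n" using True by (intro power_increasing) auto
    then have l: "0 < l" "l \<le> 1 / 2" by (auto simp: l_def field_simps)
    define z where "z = of_real (1 - l) * cis \<beta>"
    have zn: "cmod z = 1 - l" using l by (simp only: z_def norm_mult norm_of_real norm_cis) simp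
    have z: "z \<in> disc" "z \<noteq> 0" using zn l by auto
    have "pi / 2 ^ n < l / 2" using pi_less_4 by (simp add: l_def divide_strict_right_mono)
    then have "sector \<beta> n l \<subseteq> Carleson_square z"
      unfolding z_def using l by (intro sector_subset_Carleson) auto
    moreover have "carleson_box \<beta> n \<subseteq> sector \<beta> n l"
      unfolding carleson_box_def l_def by (intro sector_mono) (simp add: divide_right_mono)
    ultimately have sub: "carleson_box \<beta> n \<subseteq> Carleson_square z" by blast
    have "measure V (carleson_box \<beta> n) * measure S (carleson_box \<beta> n) powr (q - 1)
       \<le> measure V (Carleson_square z) * measure S (Carleson_square z) powr (q - 1)"
      using sub q1 by (intro mult_mono powr_mono2 V.finite_measure_mono S.finite_measure_mono) auto
    also have "\<dots> \<le> K * measure lebesgue (Carleson_square z) powr (2 * q)"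
      using K(2)[OF z Carleson_pos_dA[OF z]] by simp
    also have "\<dots> \<le> K * (9 * l\<^sup>2) powr (2 * q)"
      using K(1) q1 measure_Carleson_square_le[OF z] zn by (intro mult_left_mono powr_mono2) auto
    also have "9 * l\<^sup>2 = 576 * (1 / 2 ^ n)\<^sup>2" by (simp add: l_def power_divide)
    also have "\<dots> powr (2 * q) = 576 powr (2 * q) * (1 / 2 ^ n) powr (4 * q)"
    proof -
      have "((1 / 2 ^ n)\<^sup>2) powr (2 * q) = ((1 / 2 ^ n) powr 2) powr (2 * q)" by (simp add: powr_numeral)
      also have "\<dots> = (1 / 2 ^ n) powr (4 * q)" by (simp only: powr_powr) simp
      finally show ?thesis by (simp add: powr_mult)
    qed
    also have "K * (576 powr (2 * q) * (1 / 2 ^ n) powr (4 * q)) \<le> C * (1 / 2 ^ n) powr (4 * q)"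
      using M by (simp add: C_def distrib_right)
    finally show ?thesis .
  next
    case False
    have "measure V (carleson_box \<beta> n) * measure S (carleson_box \<beta> n) powr (q - 1) \<le> M"
      unfolding M_def using q1 carleson_box_subset_disc
      by (intro mult_mono powr_mono2 V.finite_measure_mono S.finite_measure_mono) (auto intro!: sets_dA_borel)
    also have "M \<le> M * (8 powr (4 * q) * (1 / 2 ^ n) powr (4 * q))"
    proof -
      have "(2::real) ^ n \<le> 2 ^ 3" using False by (intro power_increasing) auto
      then have "1 \<le> 8 * (1 / (2::real) ^ n)" by simp
      then have "1 \<le> (8 * (1 / (2::real) ^ n)) powr (4 * q)" using q1 by (intro ge_one_powr_ge_zero) auto
      then have "1 \<le> 8 powr (4 * q) * (1 / (2::real) ^ n) powr (4 * q)" by (simp only: powr_mult)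
      from mult_left_mono[OF this M] show ?thesis by simp
    qed
    also have "\<dots> \<le> C * (1 / 2 ^ n) powr (4 * q)"
      using K(1) by (simp add: C_def distrib_right)
    finally show ?thesis .
  qed
  then show thesis using that C by blast
qed

text \<open>Since \<open>v powr (1/q) * \<sigma> powr (1/r) = (1 - |w|\<^sup>2)\<^sup>2\<close> with \<open>1/q + 1/r = 1\<close>,
  Hoelder's inequality gives a converse to the $B_q$ condition.\<close>

lemma ball_bound:
  assumes b: "ball \<xi> t \<subseteq> disc" "0 < t" "2 * t \<le> 1 - cmod \<xi>"
  shows "t powr (4 * q) \<le> measure V (ball \<xi> t) * measure S (ball \<xi> t) powr (q - 1)"
proof -
  define r where "r = q / (q - 1)"
  have r: "1 < r" "1 / q + 1 / r = 1" using q1 by (auto simp: r_def field_simps)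
  let ?B = "ball \<xi> t"
  have Bs [measurable]: "?B \<in> sets dA" using ball_pos_dA[OF b(1,2)] by simp
  define f where "f = (\<lambda>w. v w powr (1 / q) * indicator ?B w)"
  define g where "g = (\<lambda>w. \<sigma> w powr (1 / r) * indicator ?B w)"
  have ge: "AE w in dA. ennreal (t\<^sup>2) * indicator ?B w \<le> ennreal (f w * g w)"
    using omega(3)
  proof eventually_elim
    case (elim w)
    show ?case
    proof (cases "w \<in> ?B")
      case True
      have "cmod w \<le> cmod \<xi> + dist \<xi> w" using norm_triangle_ineq[of \<xi> "w - \<xi>"] by (simp add: dist_norm norm_minus_commute)
      \<comment> \<open>As \<open>2 * t <= 1 - |\<xi>|\<close>, the ball keeps distance
        \<open>t\<close> to the circle; this bounds \<open>1 - |w|^2\<close> from below on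
        it.\<close>
      then have t1: "t \<le> 1 - cmod w" using True b(3) by simp
      have wd: "w \<in> disc" using True b by auto
      have "(cmod w)\<^sup>2 \<le> cmod w" using wd by (simp add: power2_eq_square mult_left_le)
      then have t2: "t \<le> 1 - (cmod w)\<^sup>2" using t1 by simp
      have "v w powr (1 / q) = \<omega> w powr (1 / q) * (1 - (cmod w)\<^sup>2)\<^sup>2"
        using elim t2 b(2) q1 by (simp add: v_def powr_mult powr_powr powr_numeral)
      moreover have "\<sigma> w powr (1 / r) = \<omega> w powr (- (1 / q))"
        using q1 by (simp add: \<sigma>_def powr_powr r_def)
      ultimately have "v w powr (1 / q) * \<sigma> w powr (1 / r) = (1 - (cmod w)\<^sup>2)\<^sup>2"
        using elim by (simp add: powr_minus)
      moreover have "t\<^sup>2 \<le> (1 - (cmod w)\<^sup>2)\<^sup>2" using t2 b(2) by (intro power_mono) auto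
      ultimately show ?thesis using True by (simp add: f_def g_def ennreal_leI)
    qed simp
  qed
  \<comment> \<open>One factor \<open>t^2\<close> is the area of the ball, the other the lower bound
    of the integrand. Raising to the power \<open>q\<close> at the end gives the exponent
    \<open>4 * q\<close>.\<close>
  have "ennreal (t ^ 4) = ennreal (t\<^sup>2) * emeasure dA ?B"
    using b by (simp add: emeasure_dA_ball flip: ennreal_mult power_add)
  also have "\<dots> = (\<integral>\<^sup>+w. ennreal (t\<^sup>2) * indicator ?B w \<partial>dA)" by (simp add: nn_integral_cmult_indicator)
  also have "\<dots> \<le> (\<integral>\<^sup>+w. ennreal (f w * g w) \<partial>dA)" by (rule nn_integral_mono_AE[OF ge])
  also have "\<dots> \<le> ennreal (measure V ?B powr (1 / q) * measure S ?B powr (1 / r))"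
  proof (rule nn_integral_Holder[OF q1 r])
    have "(\<integral>\<^sup>+w. ennreal (f w powr q) \<partial>dA) = (\<integral>\<^sup>+w\<in>?B. ennreal (v w) \<partial>dA)"
      using q1 v_nonneg by (intro nn_integral_cong) (auto simp: f_def powr_powr split: split_indicator)
    then show "(\<integral>\<^sup>+w. ennreal (f w powr q) \<partial>dA) \<le> ennreal (measure V ?B)"
      using Bs by (simp add: emeasure_V[symmetric] V.emeasure_eq_measure)
    have "(\<integral>\<^sup>+w. ennreal (g w powr r) \<partial>dA) = (\<integral>\<^sup>+w\<in>?B. ennreal (\<sigma> w) \<partial>dA)"
      using r sigma_nonneg by (intro nn_integral_cong) (auto simp: g_def powr_powr split: split_indicator)
    then show "(\<integral>\<^sup>+w. ennreal (g w powr r) \<partial>dA) \<le> ennreal (measure S ?B)"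
      using Bs by (simp add: emeasure_S[symmetric] S.emeasure_eq_measure)
    show "f \<in> borel_measurable dA" "g \<in> borel_measurable dA" unfolding f_def g_def by measurable
  qed (auto simp: f_def g_def)
  finally have "t ^ 4 \<le> measure V ?B powr (1 / q) * measure S ?B powr (1 / r)"
    by (subst (asm) ennreal_le_iff) auto
  then have "(t ^ 4) powr q \<le> (measure V ?B powr (1 / q) * measure S ?B powr (1 / r)) powr q"
    using q1 by (intro powr_mono2) auto
  moreover have "(t ^ 4) powr q = t powr (4 * q)"
    using b(2) by (simp add: powr_powr flip: powr_numeral)
  moreover have "(measure V ?B powr (1 / q) * measure S ?B powr (1 / r)) powr q = measure V ?B * measure S ?B powr (q - 1)"
    using q1 by (simp add: powr_mult powr_powr r_def)
  ultimately show ?thesis by simp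
qed

text \<open>The bounds for boxes and for balls enclose the product \<open>V * S^(q - 1)\<close> at
  comparable scales. Since the ball lies in the box, either factor of the ball can be enlarged to
  that of the box and cancelled, which leaves doubling for the other one. The constant
  \<open>64 powr (4 * q)\<close> pays for the ratio of the scales.\<close>

lemma doubling:
  obtains C1 C2 where "carleson_doubling V C1" "carleson_doubling S C2"
proof -
  obtain C where C: "0 < C" "\<And>\<beta> n. measure V (carleson_box \<beta> n) * measure S (carleson_box \<beta> n) powr (q - 1) \<le> C * (1 / 2 ^ n) powr (4 * q)"
    using box_bound by blast
  define D where "D = C * 64 powr (4 * q)"
  have D: "0 < D" using C by (simp add: D_def)
  have key: "measure V (carleson_box \<beta> n) \<le> D * measure V (ball \<xi> t) \<and>
      measure S (carleson_box \<beta> n) \<le> D powr (1 / (q - 1)) * measure S (ball \<xi> t)"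
    if sub: "ball \<xi> t \<subseteq> insert 0 (carleson_box \<beta> n)" and t: "2 * t \<le> 1 - cmod \<xi>" "1 / (64 * 2 ^ n) \<le> t" for \<beta> n \<xi> t
  proof -
    have "(0::real) < 1 / (64 * 2 ^ n)" by simp
    then have t0: "0 < t" using t(2) by linarith
    have bd: "ball \<xi> t \<subseteq> disc"
    proof -
      have "insert 0 (carleson_box \<beta> n) \<subseteq> disc" using carleson_box_subset_disc by simp
      with sub show ?thesis by (rule subset_trans)
    qed
    have m0: "measure \<mu> (ball \<xi> t) \<le> measure \<mu> (carleson_box \<beta> n)" if "\<mu> = V \<or> \<mu> = S" for \<mu>
    proof -
      have s: "{0} \<in> sets dA" by (rule sets_dA_borel) auto
      have "emeasure \<mu> (ball \<xi> t) \<le> emeasure \<mu> ({0} \<union> carleson_box \<beta> n)"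
        using sub that s by (intro emeasure_mono sets.Un) auto
      also have "\<dots> \<le> emeasure \<mu> {0} + emeasure \<mu> (carleson_box \<beta> n)"
        using that s by (intro emeasure_subadditive) auto
      also have "emeasure \<mu> {0} = 0" using that emeasure_VS_0 by auto
      finally show ?thesis using that by (auto simp: V.emeasure_eq_measure S.emeasure_eq_measure)
    qed
    let ?a = "measure V (carleson_box \<beta> n)" and ?b = "measure S (carleson_box \<beta> n)"
    let ?a' = "measure V (ball \<xi> t)" and ?b' = "measure S (ball \<xi> t)"
    note p = box_pos[of \<beta> n] ball_pos[OF bd t0]
    have "?a * ?b powr (q - 1) \<le> C * (1 / 2 ^ n) powr (4 * q)" by (rule C)
    also have "\<dots> \<le> C * (64 * t) powr (4 * q)"
      using C(1) t(2) q1 by (intro mult_left_mono powr_mono2) (auto simp: field_simps)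
    also have "\<dots> = D * t powr (4 * q)" by (simp add: D_def powr_mult)
    also have "\<dots> \<le> D * (?a' * ?b' powr (q - 1))"
      using D by (intro mult_left_mono ball_bound bd t0 t) auto
    finally have main: "?a * ?b powr (q - 1) \<le> D * (?a' * ?b' powr (q - 1))" .
    have "?b' powr (q - 1) \<le> ?b powr (q - 1)" using m0[of S] q1 by (intro powr_mono2) auto
    then have "?a * ?b powr (q - 1) \<le> D * ?a' * ?b powr (q - 1)"
      using main D p by (smt (verit) mult.assoc mult_left_mono mult_pos_pos)
    then have 1: "?a \<le> D * ?a'" using p by simp
    have "?a' \<le> ?a" using m0[of V] by simp
    then have "D * (?a' * ?b' powr (q - 1)) \<le> D * (?a * ?b' powr (q - 1))"
      using D by (intro mult_left_mono mult_right_mono) auto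
    with main have "?a * ?b powr (q - 1) \<le> ?a * (D * ?b' powr (q - 1))" by (simp add: mult_ac)
    then have "?b powr (q - 1) \<le> D * ?b' powr (q - 1)" using p by simp
    then have "(?b powr (q - 1)) powr (1 / (q - 1)) \<le> (D * ?b' powr (q - 1)) powr (1 / (q - 1))"
      using q1 by (intro powr_mono2) auto
    then have "?b \<le> D powr (1 / (q - 1)) * ?b'" using q1 by (simp add: powr_mult powr_powr)
    with 1 show ?thesis by blast
  qed
  have "carleson_doubling V (max 2 D)"
  proof
    fix \<beta> n \<xi> t assume "ball \<xi> t \<subseteq> insert 0 (carleson_box \<beta> n)" "2 * t \<le> 1 - cmod \<xi>" "1 / (64 * 2 ^ n) \<le> t"
    then have "measure V (carleson_box \<beta> n) \<le> D * measure V (ball \<xi> t)" using key by blast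
    also have "\<dots> \<le> max 2 D * measure V (ball \<xi> t)" by (intro mult_right_mono) auto
    finally show "measure V (carleson_box \<beta> n) \<le> max 2 D * measure V (ball \<xi> t)" .
  qed (auto simp: measure_VS_0 ball_pos)
  moreover have "carleson_doubling S (max 2 (D powr (1 / (q - 1))))"
  proof
    fix \<beta> n \<xi> t assume "ball \<xi> t \<subseteq> insert 0 (carleson_box \<beta> n)" "2 * t \<le> 1 - cmod \<xi>" "1 / (64 * 2 ^ n) \<le> t"
    then have "measure S (carleson_box \<beta> n) \<le> D powr (1 / (q - 1)) * measure S (ball \<xi> t)" using key by blast
    also have "\<dots> \<le> max 2 (D powr (1 / (q - 1))) * measure S (ball \<xi> t)" by (intro mult_right_mono) auto
    finally show "measure S (carleson_box \<beta> n) \<le> max 2 (D powr (1 / (q - 1))) * measure S (ball \<xi> t)" .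
  qed (auto simp: measure_VS_0 ball_pos)
  ultimately show thesis by (rule that)
qed

text \<open>With \<open>r = |1 - cnj z w|\<close> the triangle inequality puts
  \<open>near w (4 * r)\<close> into \<open>near z (5 * r)\<close>. Up to the origin both sets thus
  lie in one box of height at most \<open>10 * r\<close>, to which \<open>box_bound\<close>
  applies.\<close>

lemma near_bound:
  obtains C where "0 < C" "\<And>z w. z \<in> disc \<Longrightarrow> w \<in> disc \<Longrightarrow>
    measure V (near w (4 * cmod (1 - cnj z * w))) * measure S (near z (4 * cmod (1 - cnj z * w))) powr (q - 1)
      \<le> C * cmod (1 - cnj z * w) powr (4 * q)"
proof -
  obtain C where C: "0 < C" "\<And>\<beta> n. measure V (carleson_box \<beta> n) * measure S (carleson_box \<beta> n) powr (q - 1) \<le> C * (1 / 2 ^ n) powr (4 * q)"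
    using box_bound by blast
  have "measure V (near w (4 * cmod (1 - cnj z * w))) * measure S (near z (4 * cmod (1 - cnj z * w))) powr (q - 1)
      \<le> C * 10 powr (4 * q) * cmod (1 - cnj z * w) powr (4 * q)"
    if z: "z \<in> disc" and w: "w \<in> disc" for z w
  proof -
    define r where "r = cmod (1 - cnj z * w)"
    have r: "0 < r" using one_minus_cnj_mult_nz[OF z w] by (simp add: r_def)
    obtain n where n: "1 / 2 ^ n \<le> 10 * r" "n = 0 \<or> 5 * r \<le> 1 / 2 ^ n"
    proof (cases "5 * r \<le> 1")
      case True
      define L where "L = log 2 (1 / (5 * r))"
      define n where "n = nat \<lfloor>L\<rfloor>"
      have "0 \<le> L" using True r by (simp add: L_def)
      then have "real n \<le> L" "L < real n + 1" unfolding n_def by linarith+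
      then have a: "2 powr real n \<le> 1 / (5 * r)" "1 / (5 * r) < 2 powr (real n + 1)"
        using r by (auto simp: L_def le_log_iff log_less_iff)
      have b: "2 powr (real n + 1) = 2 * 2 ^ n" by (simp add: powr_add powr_realpow)
      have "5 * r \<le> 1 / 2 ^ n" using a(1) r by (simp add: powr_realpow field_simps)
      moreover have "1 / 2 ^ n \<le> 10 * r" using a(2) r unfolding b by (simp add: field_simps)
      ultimately show ?thesis by (intro that[of n]) auto
    qed (auto intro!: that[of 0])
    have sub5: "near z (5 * r) \<subseteq> insert 0 (carleson_box (Arg z) n)"
    proof (cases "n = 0")
      case True
      have "insert 0 (carleson_box (Arg z) n) = disc"
        using True mpi_less_Arg Arg_le_pi by (auto simp: carleson_box_def sector_iff)
      then show ?thesis using near_subset_disc by simp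
    next
      case False
      then show ?thesis using near_subset_box[OF z] n(2) by (force simp: near_def)
    qed
    have "near w (4 * r) \<subseteq> near z (5 * r)"
    proof
      fix u assume u: "u \<in> near w (4 * r)"
      then have "u \<in> disc" "cmod (1 - cnj w * u) < 4 * r" by (auto simp: near_def)
      then show "u \<in> near z (5 * r)"
        using cmod_one_minus_triangle[OF z w, of u] unfolding near_def r_def by auto
    qed
    then have subs: "near w (4 * r) \<subseteq> insert 0 (carleson_box (Arg z) n)" "near z (4 * r) \<subseteq> insert 0 (carleson_box (Arg z) n)"
      using sub5 near_mono[of "4 * r" "5 * r" z] r by auto
    have m: "measure \<mu> (near x (4 * r)) \<le> measure \<mu> (carleson_box (Arg z) n)"
      if "\<mu> = V \<or> \<mu> = S" "near x (4 * r) \<subseteq> insert 0 (carleson_box (Arg z) n)" for \<mu> x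
    proof -
      have s: "{0} \<in> sets dA" by (rule sets_dA_borel) auto
      have "emeasure \<mu> (near x (4 * r)) \<le> emeasure \<mu> ({0} \<union> carleson_box (Arg z) n)"
        using that s by (intro emeasure_mono sets.Un) auto
      also have "\<dots> \<le> emeasure \<mu> {0} + emeasure \<mu> (carleson_box (Arg z) n)"
        using that s by (intro emeasure_subadditive) auto
      also have "emeasure \<mu> {0} = 0" using that emeasure_VS_0 by auto
      finally show ?thesis using that by (auto simp: V.emeasure_eq_measure S.emeasure_eq_measure)
    qed
    have "measure V (near w (4 * r)) * measure S (near z (4 * r)) powr (q - 1)
       \<le> measure V (carleson_box (Arg z) n) * measure S (carleson_box (Arg z) n) powr (q - 1)"
      using q1 by (intro mult_mono powr_mono2 m subs) auto
    also have "\<dots> \<le> C * (1 / 2 ^ n) powr (4 * q)" by (rule C)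
    also have "\<dots> \<le> C * (10 * r) powr (4 * q)"
      using C(1) n(1) q1 by (intro mult_left_mono powr_mono2) auto
    also have "\<dots> = C * 10 powr (4 * q) * r powr (4 * q)" by (simp add: powr_mult)
    finally show ?thesis by (simp only: r_def)
  qed
  then show thesis using C(1) by (intro that[of "C * 10 powr (4 * q)"]) auto
qed

end

section \<open>The weighted inequality for the Berezin kernel\<close>

text \<open>The measure is an integral over \<open>u\<close> of an indicator that is jointly
  measurable in \<open>z\<close>, \<open>w\<close> and \<open>u\<close>.\<close>

lemma measurable_measure_near:
  assumes \<mu>: "finite_measure \<mu>" "sets \<mu> = sets dA"
  shows "(\<lambda>(z, w). measure \<mu> (near z (4 * cmod (1 - cnj z * w)))) \<in> borel_measurable (dA \<Otimes>\<^sub>M dA)"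
proof -
  interpret finite_measure \<mu> by fact
  have [measurable]: "cnj \<in> borel_measurable borel"
    by (intro borel_measurable_continuous_onI continuous_intros)
  have sp: "space \<mu> = disc" using sets_eq_imp_space_eq[OF \<mu>(2)] by simp
  have idm: "(\<lambda>x. x) \<in> measurable dA borel" by (rule borel_imp_measurable_dA) simp
  then have idmu: "(\<lambda>x. x) \<in> measurable \<mu> borel"
    by (simp add: measurable_cong_sets[OF \<mu>(2) refl])
  have m: "(\<lambda>p. ((fst (fst p), snd (fst p)), snd p)) \<in> measurable ((dA \<Otimes>\<^sub>M dA) \<Otimes>\<^sub>M \<mu>) ((borel \<Otimes>\<^sub>M borel) \<Otimes>\<^sub>M borel)"
    by (intro measurable_Pair measurable_compose[OF measurable_fst measurable_compose[OF measurable_fst idm]]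
        measurable_compose[OF measurable_fst measurable_compose[OF measurable_snd idm]] measurable_compose[OF measurable_snd idmu])
  define F where "F = (\<lambda>p u. if cmod (1 - cnj (fst p) * u) < 4 * cmod (1 - cnj (fst p) * snd p) then 1 else (0::ennreal))"
  have "(\<lambda>p. \<integral>\<^sup>+u. F p u \<partial>\<mu>) \<in> borel_measurable (dA \<Otimes>\<^sub>M dA)"
  proof (rule borel_measurable_nn_integral)
    show "(\<lambda>(p, u). F p u) \<in> borel_measurable ((dA \<Otimes>\<^sub>M dA) \<Otimes>\<^sub>M \<mu>)"
    proof -
      have "(\<lambda>x. F (fst x) (snd x)) \<in> borel_measurable ((borel \<Otimes>\<^sub>M borel) \<Otimes>\<^sub>M borel)"
        unfolding F_def by measurable
      from measurable_compose[OF m this] show ?thesis by (simp add: split_beta')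
    qed
  qed
  moreover have "(\<integral>\<^sup>+u. F p u \<partial>\<mu>) = emeasure \<mu> (near (fst p) (4 * cmod (1 - cnj (fst p) * snd p)))" for p
  proof -
    have "(\<integral>\<^sup>+u. F p u \<partial>\<mu>) = (\<integral>\<^sup>+u. indicator (near (fst p) (4 * cmod (1 - cnj (fst p) * snd p))) u \<partial>\<mu>)"
      by (intro nn_integral_cong) (auto simp: F_def near_def sp)
    also have "\<dots> = emeasure \<mu> (near (fst p) (4 * cmod (1 - cnj (fst p) * snd p)))"
      by (rule nn_integral_indicator) (simp add: \<mu>(2))
    finally show ?thesis .
  qed
  ultimately have "(\<lambda>p. enn2real (emeasure \<mu> (near (fst p) (4 * cmod (1 - cnj (fst p) * snd p))))) \<in> borel_measurable (dA \<Otimes>\<^sub>M dA)"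
    by (intro borel_measurable_enn2real) simp
  then show ?thesis by (simp only: measure_def split_beta')
qed

context bekolle_weight
begin

text \<open>Schur test: in Hoelder's inequality the kernel is split by the auxiliary weight \<open>Y\<close>, and \<open>near_bound\<close>
  turns the power of \<open>Y\<close> that remains into a weight \<open>T\<close> of the same form with \<open>V\<close> in place of \<open>S\<close>.\<close>

theorem berezin_bound:
  obtains K where "0 < K" "\<And>g u. g \<in> borel_measurable dA \<Longrightarrow> (\<And>w. w \<in> disc \<Longrightarrow> 0 \<le> g w) \<Longrightarrow>
    (\<And>z. z \<in> disc \<Longrightarrow> 0 \<le> u z \<and> ennreal (u z) \<le> (\<integral>\<^sup>+w. ennreal (g w / cmod (1 - cnj z * w) ^ 4) \<partial>dA)) \<Longrightarrow>
    (\<integral>\<^sup>+z. ennreal (u z powr q * v z) \<partial>dA) \<le> ennreal K * (\<integral>\<^sup>+w. ennreal (g w powr q * \<omega> w) \<partial>dA)"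
proof -
  obtain C1 C2 where "carleson_doubling V C1" "carleson_doubling S C2" using doubling by blast
  then interpret DV: carleson_doubling V C1 + DS: carleson_doubling S C2 by auto
  interpret P: pair_sigma_finite dA dA by unfold_locales
  \<comment> \<open>The test weight has exponent \<open>\<delta>\<close> on the \<open>S\<close>
    side and, after the power \<open>q - 1\<close>, exponent \<open>\<delta>'\<close> on the
    \<open>V\<close> side. The minimum keeps each within the range of its own
    \<open>schur_integral\<close>.\<close>
  define \<delta> where "\<delta> = min DS.\<delta>0 (DV.\<delta>0 / (q - 1))"
  define \<delta>' where "\<delta>' = \<delta> * (q - 1)"
  have d: "0 < \<delta>" "\<delta> \<le> DS.\<delta>0" using DS.delta0_pos DV.delta0_pos q1 by (auto simp: \<delta>_def)
  have d': "0 < \<delta>'" using d q1 by (simp add: \<delta>'_def)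
  have "\<delta> * (q - 1) \<le> DV.\<delta>0 / (q - 1) * (q - 1)" unfolding \<delta>_def using q1 by (intro mult_right_mono) auto
  then have d'2: "\<delta>' \<le> DV.\<delta>0" using q1 by (simp add: \<delta>'_def)
  obtain K1 where K1: "0 < K1" "\<And>z. z \<in> disc \<Longrightarrow>
    (\<integral>\<^sup>+w. ennreal (((1 - cmod z) / (1 - cmod w)) powr \<delta> / measure S (near z (4 * cmod (1 - cnj z * w)))) \<partial>S) \<le> ennreal K1"
    using DS.schur_integral[OF d] by blast
  obtain K2 where K2: "0 < K2" "\<And>z. z \<in> disc \<Longrightarrow>
    (\<integral>\<^sup>+w. ennreal (((1 - cmod z) / (1 - cmod w)) powr \<delta>' / measure V (near z (4 * cmod (1 - cnj z * w)))) \<partial>V) \<le> ennreal K2"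
    using DV.schur_integral[OF d' d'2] by blast
  obtain C3 where C3: "0 < C3" "\<And>z w. z \<in> disc \<Longrightarrow> w \<in> disc \<Longrightarrow>
    measure V (near w (4 * cmod (1 - cnj z * w))) * measure S (near z (4 * cmod (1 - cnj z * w))) powr (q - 1)
      \<le> C3 * cmod (1 - cnj z * w) powr (4 * q)"
    using near_bound by blast
  define r where "r = q / (q - 1)"
  have r: "1 < r" "1 / q + 1 / r = 1" "q / r = q - 1" "r / q = 1 / (q - 1)" using q1 by (auto simp: r_def field_simps)
  define Y where "Y = (\<lambda>z w. ((1 - cmod z) / (1 - cmod w)) powr \<delta> / measure S (near z (4 * cmod (1 - cnj z * w))))"
  define T where "T = (\<lambda>z w. ((1 - cmod w) / (1 - cmod z)) powr \<delta>' / measure V (near w (4 * cmod (1 - cnj w * z))))"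
  have idm [measurable]: "(\<lambda>x. x) \<in> measurable dA borel" by (rule borel_imp_measurable_dA) simp
  have [measurable]: "(\<lambda>p. fst p) \<in> measurable (dA \<Otimes>\<^sub>M dA) borel" "(\<lambda>p. snd p) \<in> measurable (dA \<Otimes>\<^sub>M dA) borel"
    by (rule measurable_compose[OF measurable_fst idm] measurable_compose[OF measurable_snd idm])+
  have nS: "(\<lambda>p. measure S (near (fst p) (4 * cmod (1 - cnj (fst p) * snd p)))) \<in> borel_measurable (dA \<Otimes>\<^sub>M dA)"
    using measurable_measure_near[OF finite_S sets_VS(2)] by (simp add: split_beta')
  have nV: "(\<lambda>p. measure V (near (snd p) (4 * cmod (1 - cnj (snd p) * fst p)))) \<in> borel_measurable (dA \<Otimes>\<^sub>M dA)"
    using measurable_compose[OF measurable_pair_swap' measurable_measure_near[OF finite_V sets_VS(1)]] by (simp add: split_beta')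
  have Ym: "(\<lambda>p. Y (fst p) (snd p)) \<in> borel_measurable (dA \<Otimes>\<^sub>M dA)"
    unfolding Y_def using nS by measurable
  have Tm [measurable]: "(\<lambda>p. T (fst p) (snd p)) \<in> borel_measurable (dA \<Otimes>\<^sub>M dA)"
    unfolding T_def using nV by measurable
  have Tz: "T z \<in> borel_measurable dA" "Y z \<in> borel_measurable dA" if "z \<in> disc" for z
    using measurable_compose[OF measurable_Pair1' Tm, of z] measurable_compose[OF measurable_Pair1' Ym, of z] that by simp_all
  have pos: "0 < measure S (near z (4 * cmod (1 - cnj z * w)))" "0 < measure V (near w (4 * cmod (1 - cnj w * z)))"
    if "z \<in> disc" "w \<in> disc" for z w
    using that one_minus_cnj_mult_nz[OF that] one_minus_cnj_mult_nz[OF that(2,1)] cmod_one_minus_ge[of z w] cmod_one_minus_ge[of w z]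
    by (auto intro!: DS.measure_near_pos DV.measure_near_pos)
  have Ypos: "0 < Y z w" if "z \<in> disc" "w \<in> disc" for z w
    using pos[OF that] that by (simp add: Y_def)
  have Tpos: "0 < T z w" if "z \<in> disc" "w \<in> disc" for z w
    using pos[OF that] that by (simp add: T_def)
  \<comment> \<open>As \<open>q / r = q - 1\<close>, the power inverts the ratio in \<open>Y\<close>
    and produces \<open>S(near z)^(q - 1)\<close>, which \<open>near_bound\<close> trades for
    \<open>|1 - cnj z w|^(4 q) / V(near w)\<close>; the kernel cancels exactly.\<close>
  have YT: "(1 / cmod (1 - cnj z * w) ^ 4 * Y z w powr (- 1 / r)) powr q \<le> C3 * T z w" if zw: "z \<in> disc" "w \<in> disc" for z w
  proof -
    let ?d = "cmod (1 - cnj z * w)"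
    let ?s = "measure S (near z (4 * ?d))" and ?v = "measure V (near w (4 * ?d))"
    have d0: "0 < ?d" using one_minus_cnj_mult_nz[OF zw] by simp
    have cc: "cmod (1 - cnj w * z) = ?d" by (rule cmod_one_minus_commute)
    have s0: "0 < ?s" "0 < ?v" using pos[OF zw] by (simp_all add: cc)
    have w1: "0 < 1 - cmod w" "0 < 1 - cmod z" using zw by auto
    have "(1 / ?d ^ 4 * Y z w powr (- 1 / r)) powr q = (1 / ?d ^ 4) powr q * (Y z w powr (- 1 / r)) powr q"
      by (rule powr_mult)
    also have "(1 / ?d ^ 4) powr q = 1 / ?d powr (4 * q)"
      using d0 by (simp add: powr_divide powr_powr flip: powr_numeral)
    also have "(Y z w powr (- 1 / r)) powr q = Y z w powr (- (q - 1))"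
      using r(3) by (simp add: powr_powr)
    also have "\<dots> = ((1 - cmod w) / (1 - cmod z)) powr \<delta>' * ?s powr (q - 1)"
    proof -
      have "Y z w powr (- (q - 1)) = ((1 - cmod z) / (1 - cmod w)) powr (- \<delta>') / ?s powr (- (q - 1))"
        unfolding Y_def \<delta>'_def powr_divide powr_powr by (simp only: mult_minus_right)
      also have "\<dots> = ((1 - cmod z) / (1 - cmod w)) powr (- \<delta>') * ?s powr (q - 1)"
        using powr_minus_divide[of ?s "- (q - 1)"] by (simp only: minus_minus times_divide_eq_right mult_1_right)
      also have "((1 - cmod z) / (1 - cmod w)) powr (- \<delta>') = ((1 - cmod w) / (1 - cmod z)) powr \<delta>'"
        using w1 by (simp add: powr_divide powr_minus_divide)
      finally show ?thesis .
    qed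
    also have "1 / ?d powr (4 * q) * (((1 - cmod w) / (1 - cmod z)) powr \<delta>' * ?s powr (q - 1))
        = ((1 - cmod w) / (1 - cmod z)) powr \<delta>' * (?s powr (q - 1) / ?d powr (4 * q))"
      by simp
    also have "\<dots> \<le> ((1 - cmod w) / (1 - cmod z)) powr \<delta>' * (C3 / ?v)"
      using C3(2)[OF zw] s0 d0 by (intro mult_left_mono) (auto simp: field_simps)
    also have "\<dots> = C3 * T z w"
      unfolding T_def cc by (simp only: times_divide_eq_right mult.commute)
    finally show ?thesis .
  qed
  define c where "c = C3 * K1 powr (q - 1)"
  have c: "0 < c" using C3 K1 by (simp add: c_def)
  have "(\<integral>\<^sup>+z. ennreal (u z powr q * v z) \<partial>dA) \<le> ennreal (c * K2) * (\<integral>\<^sup>+w. ennreal (g w powr q * \<omega> w) \<partial>dA)"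
    if g [measurable]: "g \<in> borel_measurable dA" and g0: "\<And>w. w \<in> disc \<Longrightarrow> 0 \<le> g w"
      and u: "\<And>z. z \<in> disc \<Longrightarrow> 0 \<le> u z \<and> ennreal (u z) \<le> (\<integral>\<^sup>+w. ennreal (g w / cmod (1 - cnj z * w) ^ 4) \<partial>dA)" for g u
  proof -
    define X where "X = (\<lambda>z. \<integral>\<^sup>+w. ennreal (g w powr q * \<omega> w * T z w) \<partial>dA)"
    have uX: "ennreal (u z powr q) \<le> ennreal c * X z" if z: "z \<in> disc" for z
    proof (cases "X z = \<infinity>")
      case True
      then show ?thesis using c by (simp add: ennreal_mult_top)
    next
      case False
      then obtain x where x: "X z = ennreal x" "0 \<le> x" by (cases "X z") auto
      note [measurable] = Tz[OF z]
      have dm [measurable]: "(\<lambda>w. cmod (1 - cnj z * w)) \<in> borel_measurable dA" by (rule borel_imp_measurable_dA) measurable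
      \<comment> \<open>The inserted powers of \<open>\<omega>\<close> cancel in the product. They
        are placed so that \<open>f^q\<close> carries the density \<open>\<omega>\<close> and
        \<open>h^r\<close> the density \<open>\<sigma>\<close>.\<close>
      define f where "f = (\<lambda>w. g w * \<omega> w powr (1 / q) * (1 / cmod (1 - cnj z * w) ^ 4 * Y z w powr (- 1 / r)))"
      define h where "h = (\<lambda>w. Y z w powr (1 / r) * \<omega> w powr (- (1 / q)))"
      have "ennreal (u z) \<le> (\<integral>\<^sup>+w. ennreal (g w / cmod (1 - cnj z * w) ^ 4) \<partial>dA)" using u[OF z] by simp
      also have "\<dots> = (\<integral>\<^sup>+w. ennreal (f w * h w) \<partial>dA)"
      proof (rule nn_integral_cong_AE)
        have "AE w in dA. w \<in> disc" by (rule AE_I2) simp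
        with omega(3) show "AE w in dA. ennreal (g w / cmod (1 - cnj z * w) ^ 4) = ennreal (f w * h w)"
        proof eventually_elim
          case (elim w)
          have "Y z w powr (- 1 / r) * Y z w powr (1 / r) = 1" "\<omega> w powr (1 / q) * \<omega> w powr (- (1 / q)) = 1"
            using elim Ypos[OF z, of w] by (simp_all flip: powr_add)
          then have "f w * h w = g w / cmod (1 - cnj z * w) ^ 4"
            unfolding f_def h_def by (simp add: field_simps)
          then show ?case by simp
        qed
      qed
      also have "\<dots> \<le> ennreal ((C3 * x) powr (1 / q) * K1 powr (1 / r))"
      proof (rule nn_integral_Holder[OF q1 r(1,2)])
        show "f \<in> borel_measurable dA" "h \<in> borel_measurable dA" unfolding f_def h_def by measurable
        show "0 \<le> f w" "0 \<le> h w" if "w \<in> space dA" for w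
          using that g0[of w] by (simp_all add: f_def h_def)
        have "(\<integral>\<^sup>+w. ennreal (f w powr q) \<partial>dA) \<le> (\<integral>\<^sup>+w. ennreal C3 * ennreal (g w powr q * \<omega> w * T z w) \<partial>dA)"
        proof (rule nn_integral_mono)
          fix w assume "w \<in> space dA"
          then have w: "w \<in> disc" by simp
          have "f w powr q = (g w * \<omega> w powr (1 / q)) powr q * (1 / cmod (1 - cnj z * w) ^ 4 * Y z w powr (- 1 / r)) powr q"
            unfolding f_def by (rule powr_mult)
          also have "(g w * \<omega> w powr (1 / q)) powr q = g w powr q * \<omega> w"
            using q1 omega(1)[OF w] by (simp add: powr_mult powr_powr)
          also have "g w powr q * \<omega> w * (1 / cmod (1 - cnj z * w) ^ 4 * Y z w powr (- 1 / r)) powr q \<le> g w powr q * \<omega> w * (C3 * T z w)"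
            using omega(1)[OF w] by (intro mult_left_mono YT z w) auto
          finally have "f w powr q \<le> C3 * (g w powr q * \<omega> w * T z w)" by (simp add: mult_ac)
          then show "ennreal (f w powr q) \<le> ennreal C3 * ennreal (g w powr q * \<omega> w * T z w)"
            using C3(1) omega(1)[OF w] Tpos[OF z w] by (subst ennreal_mult[symmetric]) (auto intro: ennreal_leI)
        qed
        also have "\<dots> = ennreal C3 * X z" unfolding X_def by (rule nn_integral_cmult) measurable
        also have "\<dots> = ennreal (C3 * x)" using x C3(1) by (simp add: ennreal_mult)
        finally show "(\<integral>\<^sup>+w. ennreal (f w powr q) \<partial>dA) \<le> ennreal (C3 * x)" .
        have "(\<integral>\<^sup>+w. ennreal (h w powr r) \<partial>dA) = (\<integral>\<^sup>+w. ennreal (\<sigma> w) * ennreal (Y z w) \<partial>dA)"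
        proof (intro nn_integral_cong)
          fix w assume "w \<in> space dA"
          then have w: "w \<in> disc" by simp
          have "h w powr r = Y z w * \<sigma> w"
            unfolding h_def \<sigma>_def using r Ypos[OF z w] by (subst powr_mult) (simp add: powr_powr)
          then show "ennreal (h w powr r) = ennreal (\<sigma> w) * ennreal (Y z w)"
            using Ypos[OF z w] sigma_nonneg[of w] by (simp add: ennreal_mult mult.commute)
        qed
        also have "\<dots> = (\<integral>\<^sup>+w. ennreal (Y z w) \<partial>S)"
          unfolding S_def by (subst nn_integral_density) auto
        also have "\<dots> \<le> ennreal K1" unfolding Y_def by (rule K1(2)[OF z])
        finally show "(\<integral>\<^sup>+w. ennreal (h w powr r) \<partial>dA) \<le> ennreal K1" .
      qed (use x C3 K1 in auto)
      finally have "u z \<le> (C3 * x) powr (1 / q) * K1 powr (1 / r)"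
        by (subst (asm) ennreal_le_iff) auto
      then have "u z powr q \<le> ((C3 * x) powr (1 / q) * K1 powr (1 / r)) powr q"
        using u[OF z] q1 by (intro powr_mono2) auto
      also have "\<dots> = C3 * x * K1 powr (q - 1)"
        using q1 r(3) C3(1) x(2) by (simp add: powr_mult powr_powr)
      also have "\<dots> = c * x" by (simp add: c_def)
      finally show ?thesis using x c by (simp add: ennreal_leI flip: ennreal_mult)
    qed
    have "(\<integral>\<^sup>+z. ennreal (u z powr q * v z) \<partial>dA) \<le> (\<integral>\<^sup>+z. ennreal c * (\<integral>\<^sup>+w. ennreal (g w powr q * \<omega> w * T z w) * ennreal (v z) \<partial>dA) \<partial>dA)"
    proof (rule nn_integral_mono)
      fix z assume "z \<in> space dA"
      then have z: "z \<in> disc" by simp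
      note [measurable] = Tz[OF z]
      have "ennreal (u z powr q * v z) = ennreal (u z powr q) * ennreal (v z)"
        using v_nonneg[OF z] by (simp add: ennreal_mult)
      also have "\<dots> \<le> ennreal c * X z * ennreal (v z)" by (intro mult_right_mono uX z) auto
      also have "\<dots> = ennreal c * (X z * ennreal (v z))" by (rule mult.assoc)
      also have "X z * ennreal (v z) = (\<integral>\<^sup>+w. ennreal (g w powr q * \<omega> w * T z w) * ennreal (v z) \<partial>dA)"
        unfolding X_def by (rule nn_integral_multc[symmetric]) measurable
      finally show "ennreal (u z powr q * v z) \<le> ennreal c * (\<integral>\<^sup>+w. ennreal (g w powr q * \<omega> w * T z w) * ennreal (v z) \<partial>dA)" .
    qed
    also have "\<dots> = ennreal c * (\<integral>\<^sup>+z. (\<integral>\<^sup>+w. ennreal (g w powr q * \<omega> w * T z w) * ennreal (v z) \<partial>dA) \<partial>dA)"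
    proof (rule nn_integral_cmult)
      have "(\<lambda>(z, w). ennreal (g w powr q * \<omega> w * T z w) * ennreal (v z)) \<in> borel_measurable (dA \<Otimes>\<^sub>M dA)"
        unfolding split_beta' by measurable
      then show "(\<lambda>z. \<integral>\<^sup>+w. ennreal (g w powr q * \<omega> w * T z w) * ennreal (v z) \<partial>dA) \<in> borel_measurable dA"
        by (rule dA.borel_measurable_nn_integral)
    qed
    also have "(\<integral>\<^sup>+z. (\<integral>\<^sup>+w. ennreal (g w powr q * \<omega> w * T z w) * ennreal (v z) \<partial>dA) \<partial>dA)
      = (\<integral>\<^sup>+w. (\<integral>\<^sup>+z. ennreal (g w powr q * \<omega> w * T z w) * ennreal (v z) \<partial>dA) \<partial>dA)"
    proof (rule P.Fubini'[symmetric])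
      show "(\<lambda>(z, w). ennreal (g w powr q * \<omega> w * T z w) * ennreal (v z)) \<in> borel_measurable (dA \<Otimes>\<^sub>M dA)"
        unfolding split_beta' by measurable
    qed
    \<comment> \<open>With \<open>w\<close> fixed after Fubini, the integral of \<open>T\<close> in
      \<open>z\<close> against \<open>V\<close> is the second Schur integral, centred at
      \<open>w\<close>.\<close>
    also have "\<dots> \<le> (\<integral>\<^sup>+w. ennreal (g w powr q * \<omega> w) * ennreal K2 \<partial>dA)"
    proof (rule nn_integral_mono)
      fix w assume "w \<in> space dA"
      then have w: "w \<in> disc" by simp
      have Tw [measurable]: "(\<lambda>z. T z w) \<in> borel_measurable dA"
        using measurable_compose[OF measurable_Pair2' Tm, of w] w by simp
      have "(\<integral>\<^sup>+z. ennreal (g w powr q * \<omega> w * T z w) * ennreal (v z) \<partial>dA) = (\<integral>\<^sup>+z. ennreal (g w powr q * \<omega> w) * (ennreal (v z) * ennreal (T z w)) \<partial>dA)"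
      proof (intro nn_integral_cong)
        fix z assume "z \<in> space dA"
        then have z: "z \<in> disc" by simp
        have "ennreal (g w powr q * \<omega> w * T z w) = ennreal (g w powr q * \<omega> w) * ennreal (T z w)"
          using omega(1)[OF w] Tpos[OF z w] by (intro ennreal_mult) auto
        then show "ennreal (g w powr q * \<omega> w * T z w) * ennreal (v z) = ennreal (g w powr q * \<omega> w) * (ennreal (v z) * ennreal (T z w))"
          by (simp add: mult_ac)
      qed
      also have "\<dots> = ennreal (g w powr q * \<omega> w) * (\<integral>\<^sup>+z. ennreal (v z) * ennreal (T z w) \<partial>dA)"
        by (rule nn_integral_cmult) measurable
      also have "(\<integral>\<^sup>+z. ennreal (v z) * ennreal (T z w) \<partial>dA) = (\<integral>\<^sup>+z. ennreal (T z w) \<partial>V)"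
        unfolding V_def by (subst nn_integral_density) auto
      also have "\<dots> \<le> ennreal K2" unfolding T_def by (rule K2(2)[OF w])
      finally show "(\<integral>\<^sup>+z. ennreal (g w powr q * \<omega> w * T z w) * ennreal (v z) \<partial>dA) \<le> ennreal (g w powr q * \<omega> w) * ennreal K2"
        by (simp add: mult_left_mono)
    qed
    also have "\<dots> = (\<integral>\<^sup>+w. ennreal (g w powr q * \<omega> w) \<partial>dA) * ennreal K2"
      by (rule nn_integral_multc) measurable
    finally show ?thesis using c K2(1) by (simp add: ennreal_mult mult_right_mono mult_ac)
  qed
  then show thesis using c K2 by (intro that[of "c * K2"]) auto
qed

end

section \<open>The product and the weight of a sequence\<close>

lemma summable_on_imp_summable_if:
  fixes f :: "nat \<Rightarrow> real"
  assumes "f summable_on I" "\<And>i. i \<in> I \<Longrightarrow> 0 \<le> f i"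
  shows "summable (\<lambda>i. if i \<in> I then f i else 0)" "infsum f I = (\<Sum>i. if i \<in> I then f i else 0)"
proof -
  have "(f has_sum infsum f I) I" using assms(1) by (rule has_sum_infsum)
  also have "(f has_sum infsum f I) I \<longleftrightarrow> ((\<lambda>i. if i \<in> I then f i else 0) has_sum infsum f I) UNIV"
    by (rule has_sum_cong_neutral) auto
  finally have "(\<lambda>i. if i \<in> I then f i else 0) sums infsum f I" by (rule has_sum_imp_sums)
  then show "summable (\<lambda>i. if i \<in> I then f i else 0)" "infsum f I = (\<Sum>i. if i \<in> I then f i else 0)"
    by (auto simp: sums_iff)
qed

definition k_factor :: "complex \<Rightarrow> complex \<Rightarrow> real" where
  "k_factor a z = (cmod z)\<^sup>2 / 2 * ((1 - (cmod a)\<^sup>2)\<^sup>2 / (cmod (1 - cnj a * z))\<^sup>2)"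

text \<open>The term of \<open>cmod_psi_factor\<close> that is independent of \<open>z\<close>. For
  \<open>a = 0\<close> the factor of the product is \<open>z\<close> itself while
  \<open>k_factor 0 z = |z|^2 / 2\<close>; the value \<open>- 1 / 2\<close> balances this.\<close>

definition c_factor :: "complex \<Rightarrow> real" where
  "c_factor a = (if a = 0 then - 1 / 2 else (1 - (cmod a)\<^sup>2) / 2 + ln (cmod a))"

text \<open>The zero-free part of a factor, its zero being left to \<open>mob\<close>; the value is
  \<open>- 1\<close> at \<open>a = 0\<close> because \<open>mob 0 z = - z\<close>.\<close>

definition e_factor :: "complex \<Rightarrow> complex \<Rightarrow> complex" where
  "e_factor a z = (if a = 0 then - 1 else cnj a * exp (1 - cnj a * mob a z))"

lemma psi_factor_mob: "psi_factor a z = mob a z * e_factor a z"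
  by (simp add: psi_factor_def e_factor_def mob_def)

lemma e_factor_nz: "e_factor a z \<noteq> 0"
  by (simp add: e_factor_def)

lemma e_factor_holomorphic: "a \<in> disc \<Longrightarrow> e_factor a holomorphic_on disc"
  unfolding e_factor_def by (cases "a = 0") (auto intro!: holomorphic_intros)

lemma psi_factor_holomorphic: "a \<in> disc \<Longrightarrow> psi_factor a holomorphic_on disc"
  unfolding psi_factor_mob by (intro holomorphic_intros e_factor_holomorphic) auto

lemma psi_factor_eq_0_iff: "a \<in> disc \<Longrightarrow> z \<in> disc \<Longrightarrow> psi_factor a z = 0 \<longleftrightarrow> z = a"
  using one_minus_cnj_mult_nz[of a z] by (auto simp: psi_factor_mob e_factor_nz mob_def)

text \<open>This is the genus-1 primary factor \<open>(1 - u) * exp u\<close> at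
  \<open>u = 1 - cnj a * mob a z\<close>, which is of order \<open>1 - |a|\<close>. Such a factor
  differs from 1 by \<open>O(|u|^2)\<close>, so square summability suffices for convergence.\<close>

lemma psi_factor_weierstrass:
  assumes "a \<in> disc" "z \<in> disc" "a \<noteq> 0"
  shows "psi_factor a z = weierstrass_factor 1 ((1 - (cmod a)\<^sup>2) / (1 - cnj a * z))"
proof -
  have nz: "1 - cnj a * z \<noteq> 0" using one_minus_cnj_mult_nz[OF assms(1,2)] by simp
  have "1 - cnj a * ((a - z) / (1 - cnj a * z)) = (1 - a * cnj a) / (1 - cnj a * z)"
    using nz by (simp add: field_simps)
  also have "1 - a * cnj a = of_real (1 - (cmod a)\<^sup>2)" using complex_norm_square[of a] by simp
  finally have e: "1 - cnj a * ((a - z) / (1 - cnj a * z)) = of_real (1 - (cmod a)\<^sup>2) / (1 - cnj a * z)" .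
  have e': "cnj a * ((a - z) / (1 - cnj a * z)) = 1 - of_real (1 - (cmod a)\<^sup>2) / (1 - cnj a * z)"
    unfolding e[symmetric] by simp
  have "psi_factor a z = (cnj a * ((a - z) / (1 - cnj a * z))) * exp (1 - cnj a * ((a - z) / (1 - cnj a * z)))"
    using assms(3) by (simp only: psi_factor_def if_False)
  also have "\<dots> = (1 - of_real (1 - (cmod a)\<^sup>2) / (1 - cnj a * z)) * exp (of_real (1 - (cmod a)\<^sup>2) / (1 - cnj a * z))"
    unfolding e by (simp only: e')
  finally show ?thesis by (simp add: weierstrass_factor_def)
qed

lemma cmod_psi_factor:
  assumes a: "a \<in> disc" and z: "z \<in> disc"
  shows "cmod (psi_factor a z) = exp (c_factor a + k_factor a z) * (cmod (mob a z) * exp ((1 - (cmod (mob a z))\<^sup>2) / 2))"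
proof (cases "a = 0")
  case True
  have "exp (- 1 / 2 + (cmod z)\<^sup>2 / 2) * exp ((1 - (cmod z)\<^sup>2) / 2) = 1"
    unfolding exp_add[symmetric] by (simp add: field_simps)
  then show ?thesis using True by (simp add: psi_factor_def c_factor_def k_factor_def mob_def)
next
  case False
  define d where "d = (cmod (1 - cnj a * z))\<^sup>2"
  have d: "0 < d" using one_minus_cnj_mult_nz[OF a z] by (simp add: d_def)
  define u where "u = of_real (1 - (cmod a)\<^sup>2) / (1 - cnj a * z)"
  have nz: "1 - cnj a * z \<noteq> 0" using one_minus_cnj_mult_nz[OF a z] by simp
  have "1 - cnj a * mob a z = (1 - a * cnj a) / (1 - cnj a * z)"
    unfolding mob_def using nz by (simp add: field_simps)
  also have "1 - a * cnj a = of_real (1 - (cmod a)\<^sup>2)" using complex_norm_square[of a] by simp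
  finally have u: "1 - cnj a * mob a z = u" by (simp add: u_def)
  have "Re u = (1 - (cmod a)\<^sup>2) * Re (1 - cnj a * z) / d"
    unfolding u_def d_def by (simp add: Re_divide cmod_power2)
  \<comment> \<open>From \<open>|1 - x|^2 = 1 - 2 * Re x + |x|^2\<close> with
    \<open>x = cnj a * z\<close>. It splits \<open>2 * Re u\<close> into \<open>1 - |a|^2\<close>,
    \<open>1 - |mob a z|^2\<close> and \<open>2 * k_factor a z\<close>.\<close>
  moreover have "2 * Re (1 - cnj a * z) = 1 + d - (cmod a)\<^sup>2 * (cmod z)\<^sup>2"
  proof -
    have "d = 1 - 2 * Re (cnj a * z) + (cmod (cnj a * z))\<^sup>2"
      unfolding d_def cmod_power2 by (simp add: power2_eq_square algebra_simps)
    then show ?thesis by (simp add: norm_mult power_mult_distrib)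
  qed
  ultimately have "2 * Re u = (1 - (cmod a)\<^sup>2) * (1 + d - (cmod a)\<^sup>2 * (cmod z)\<^sup>2) / d"
    by (metis (no_types) mult.left_commute times_divide_eq_right)
  also have "\<dots> = (1 - (cmod a)\<^sup>2) + (1 - (cmod a)\<^sup>2) * (1 - (cmod a)\<^sup>2 * (cmod z)\<^sup>2) / d"
    using d by (simp add: field_simps)
  also have "1 - (cmod a)\<^sup>2 * (cmod z)\<^sup>2 = (1 - (cmod z)\<^sup>2) + (cmod z)\<^sup>2 * (1 - (cmod a)\<^sup>2)"
    by (simp add: algebra_simps)
  also have "(1 - (cmod a)\<^sup>2) * ((1 - (cmod z)\<^sup>2) + (cmod z)\<^sup>2 * (1 - (cmod a)\<^sup>2)) / d
     = (1 - (cmod a)\<^sup>2) * (1 - (cmod z)\<^sup>2) / d + (cmod z)\<^sup>2 * ((1 - (cmod a)\<^sup>2)\<^sup>2 / d)"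
    by (simp add: distrib_left add_divide_distrib power2_eq_square mult_ac)
  also have "(1 - (cmod a)\<^sup>2) * (1 - (cmod z)\<^sup>2) / d = 1 - (cmod (mob a z))\<^sup>2"
    using one_minus_mob[OF a z] by (simp add: d_def)
  finally have Re2: "2 * Re u = (1 - (cmod a)\<^sup>2) + ((1 - (cmod (mob a z))\<^sup>2) + (cmod z)\<^sup>2 * ((1 - (cmod a)\<^sup>2)\<^sup>2 / d))" .
  have half: "x = p / 2 + m / 2 + n / 2" if "2 * x = p + (n + m)" for x p m n :: real
    using that by simp
  have "k_factor a z = ((cmod z)\<^sup>2 * ((1 - (cmod a)\<^sup>2)\<^sup>2 / d)) / 2" by (simp add: k_factor_def d_def)
  with half[OF Re2] have Re: "Re u = (1 - (cmod a)\<^sup>2) / 2 + k_factor a z + (1 - (cmod (mob a z))\<^sup>2) / 2"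
    by (simp only:)
  have "cmod (psi_factor a z) = cmod (mob a z) * (cmod a * exp (Re u))"
    using False by (simp add: psi_factor_mob e_factor_def u norm_mult norm_exp_eq_Re)
  also have "cmod a = exp (ln (cmod a))" using False by simp
  also have "exp (ln (cmod a)) * exp (Re u) = exp (c_factor a + k_factor a z) * exp ((1 - (cmod (mob a z))\<^sup>2) / 2)"
    unfolding exp_add[symmetric] Re using False by (simp add: c_factor_def)
  finally show ?thesis by (simp add: mult_ac)
qed

text \<open>Both bounds come from \<open>ln x <= x - 1\<close>, at \<open>|a|^2\<close> and at
  \<open>1 / |a|\<close>. In the second, the remainder has a double zero at \<open>|a| = 1\<close>,
  so that the \<open>c_factor\<close> values are summable along a square summable sequence.\<close>

lemma c_factor_bounds:
  assumes "a \<in> disc"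
  shows "c_factor a \<le> 0" "1 / 2 \<le> cmod a \<Longrightarrow> \<bar>c_factor a\<bar> \<le> 3 * (1 - cmod a)\<^sup>2"
proof -
  have le: "c_factor a \<le> 0"
  proof (cases "a = 0")
    case False
    have "2 * ln (cmod a) = ln ((cmod a)\<^sup>2)" using False by (simp add: ln_realpow)
    also have "\<dots> \<le> (cmod a)\<^sup>2 - 1" using False by (intro ln_le_minus_one) simp
    finally show ?thesis by (simp add: c_factor_def False field_simps)
  qed (simp add: c_factor_def)
  then show "c_factor a \<le> 0" .
  assume h: "1 / 2 \<le> cmod a"
  define x where "x = cmod a"
  have x: "1 / 2 \<le> x" "x < 1" using h assms by (auto simp: x_def)
  have "- ln x \<le> 1 / x - 1" using ln_le_minus_one[of "1 / x"] x by (simp add: ln_div)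
  then have "- c_factor a \<le> 1 / x - 1 - (1 - x\<^sup>2) / 2"
    using h by (auto simp: c_factor_def x_def)
  also have "\<dots> = (1 - x)\<^sup>2 * ((2 + x) / (2 * x))"
    using x by (simp add: field_simps power2_eq_square)
  also have "\<dots> \<le> (1 - x)\<^sup>2 * 3"
    using x by (intro mult_left_mono) (auto simp: field_simps)
  finally show "\<bar>c_factor a\<bar> \<le> 3 * (1 - cmod a)\<^sup>2" using le by (simp add: x_def)
qed

lemma exp_le_mob: "cmod (mob a z) * exp ((1 - (cmod (mob a z))\<^sup>2) / 2) \<le> 1"
proof (cases "mob a z = 0")
  case False
  define x where "x = cmod (mob a z)"
  have x: "0 < x" using False by (simp add: x_def)
  have "2 * ln x = ln (x\<^sup>2)" using x by (simp add: ln_realpow)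
  also have "\<dots> \<le> x\<^sup>2 - 1" using x by (intro ln_le_minus_one) simp
  finally have "ln x + (1 - x\<^sup>2) / 2 \<le> 0" by (simp add: field_simps)
  then have "exp (ln x + (1 - x\<^sup>2) / 2) \<le> 1" by simp
  then show ?thesis using x by (simp add: exp_add x_def)
qed simp

lemma cmod_psi_factor_le:
  assumes "a \<in> disc" "z \<in> disc"
  shows "cmod (psi_factor a z) \<le> exp (k_factor a z)"
proof -
  have "cmod (psi_factor a z) \<le> exp (c_factor a + k_factor a z) * 1"
    unfolding cmod_psi_factor[OF assms] by (intro mult_left_mono exp_le_mob) auto
  also have "\<dots> \<le> exp (k_factor a z)" using c_factor_bounds(1)[OF assms(1)] by simp
  finally show ?thesis .
qed

lemma k_factor_nonneg: "0 \<le> k_factor a z" by (simp add: k_factor_def)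

lemma one_minus_sq_le: "a \<in> disc \<Longrightarrow> 1 - (cmod a)\<^sup>2 \<le> (1 - cmod a) * 2"
proof -
  assume "a \<in> disc"
  have "1 - (cmod a)\<^sup>2 = (1 - cmod a) * (1 + cmod a)" by (simp add: power2_eq_square algebra_simps)
  also have "\<dots> \<le> (1 - cmod a) * 2" using \<open>a \<in> disc\<close> by (intro mult_left_mono) auto
  finally show ?thesis .
qed

text \<open>The primary factor differs from 1 by at most \<open>3 |u|^2\<close> when
  \<open>|u| <= 1/2\<close>, and \<open>|u| <= 2 (1 - |a|) / (1 - R)\<close>; hence 12. The
  closeness of \<open>a\<close> to the circle ensures both \<open>|u| <= 1/2\<close> and
  \<open>a \<noteq> 0\<close>.\<close>

lemma psi_factor_minus_1_le:
  assumes a: "a \<in> disc" and z: "cmod z \<le> R" "R < 1" and small: "1 - cmod a \<le> (1 - R) / 4"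
  shows "cmod (psi_factor a z - 1) \<le> 12 / (1 - R)\<^sup>2 * (1 - cmod a)\<^sup>2"
proof -
  have zd: "z \<in> disc" using z by simp
  have "0 \<le> R" using z norm_ge_zero order_trans by blast
  then have a0: "a \<noteq> 0" using small by auto
  define u where "u = of_real (1 - (cmod a)\<^sup>2) / (1 - cnj a * z)"
  have d: "1 - R \<le> cmod (1 - cnj a * z)"
    using cmod_one_minus_ge(2)[of a z] a zd z by simp
  note n = one_minus_sq_le[OF a]
  have "0 \<le> 1 - (cmod a)\<^sup>2" using a by (simp add: power_le_one)
  then have "cmod u = (1 - (cmod a)\<^sup>2) / cmod (1 - cnj a * z)"
    unfolding u_def norm_divide norm_of_real by simp
  also have "\<dots> \<le> ((1 - cmod a) * 2) / (1 - R)"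
    using n d z a by (intro frac_le) auto
  finally have u: "cmod u \<le> ((1 - cmod a) * 2) / (1 - R)" .
  also have "\<dots> \<le> 1 / 2" using small z by (simp add: field_simps)
  finally have "cmod (weierstrass_factor 1 u - 1) \<le> 3 * cmod u ^ Suc 1"
    by (rule weierstrass_factor_bound)
  also have "cmod u ^ Suc 1 \<le> (((1 - cmod a) * 2) / (1 - R)) ^ Suc 1"
    using u by (intro power_mono) auto
  also have "(((1 - cmod a) * 2) / (1 - R)) ^ Suc 1 = 4 * (1 - cmod a)\<^sup>2 / (1 - R)\<^sup>2"
    by (simp only: power_mult_distrib power_divide Suc_1) simp
  finally show ?thesis
    unfolding psi_factor_weierstrass[OF a zd a0] u_def[symmetric] by simp
qed

definition psi_term :: "zseq \<Rightarrow> nat \<Rightarrow> complex \<Rightarrow> complex" where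
  "psi_term Z i z = (if i \<in> fst Z then psi_factor (snd Z i) z else 1)"

lemma psi_seq_eq: "psi_seq Z z = (\<Prod>i. psi_term Z i z)"
  by (simp add: psi_seq_def psi_term_def)

lemma psi_term_holomorphic: "seq_in_disc Z \<Longrightarrow> psi_term Z i holomorphic_on disc"
  unfolding psi_term_def by (cases "i \<in> fst Z") (auto simp: seq_in_disc_def intro!: psi_factor_holomorphic)

lemma square_summable_summable:
  assumes "square_summable Z"
  shows "summable (\<lambda>i. if i \<in> fst Z then (1 - cmod (snd Z i))\<^sup>2 else 0)"
  using assms unfolding square_summable_def by (intro summable_on_imp_summable_if) auto

lemma eventually_close:
  assumes sq: "square_summable Z" and Z: "seq_in_disc Z" and e: "0 < e"
  shows "eventually (\<lambda>i. i \<in> fst Z \<longrightarrow> 1 - cmod (snd Z i) \<le> e) sequentially"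
proof -
  have "(\<lambda>i. if i \<in> fst Z then (1 - cmod (snd Z i))\<^sup>2 else 0) \<longlonglongrightarrow> 0"
    by (rule summable_LIMSEQ_zero[OF square_summable_summable[OF sq]])
  then have "eventually (\<lambda>i. (if i \<in> fst Z then (1 - cmod (snd Z i))\<^sup>2 else 0) < e\<^sup>2) sequentially"
    using e by (intro order_tendstoD) auto
  then show ?thesis
  proof eventually_elim
    case (elim i)
    then show ?case using e power2_less_imp_less[of "1 - cmod (snd Z i)" e] by auto
  qed
qed

section \<open>Convergence of the product and of the weight\<close>

context
  fixes Z :: zseq
  assumes Z: "seq_in_disc Z" and sq: "square_summable Z"
begin

lemma psi_uniform:
  assumes R: "0 < R" "R < 1"
  shows "uniformly_convergent_on (cball 0 R) (\<lambda>N z. \<Prod>i<N. psi_term Z i z)"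
    and "\<And>z. z \<in> cball 0 R \<Longrightarrow> summable (\<lambda>i. cmod (psi_term Z i z - 1))"
proof -
  define M where "M = (\<lambda>i. 12 / (1 - R)\<^sup>2 * (if i \<in> fst Z then (1 - cmod (snd Z i))\<^sup>2 else 0))"
  have M: "summable M" unfolding M_def by (intro summable_mult square_summable_summable sq)
  \<comment> \<open>The estimate of a factor holds for points close to the circle, that is, for all
    but finitely many indices.\<close>
  have ev: "\<forall>\<^sub>F i in sequentially. \<forall>z\<in>cball 0 R. cmod (psi_term Z i z - 1) \<le> M i"
  proof -
    have "eventually (\<lambda>i. i \<in> fst Z \<longrightarrow> 1 - cmod (snd Z i) \<le> (1 - R) / 4) sequentially"
      using R by (intro eventually_close sq Z) auto
    then show ?thesis
  proof eventually_elim
    case (elim i)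
    show ?case
    proof safe
      fix z :: complex assume "z \<in> cball 0 R"
      then have "cmod z \<le> R" by simp
      then show "cmod (psi_term Z i z - 1) \<le> M i"
        using psi_factor_minus_1_le[of "snd Z i" z R] elim Z R by (auto simp: M_def psi_term_def seq_in_disc_def)
    qed
  qed
  qed
  show "uniformly_convergent_on (cball 0 R) (\<lambda>N z. \<Prod>i<N. psi_term Z i z)"
  proof (rule uniformly_convergent_on_prod')
    show "uniformly_convergent_on (cball 0 R) (\<lambda>N z. \<Sum>i<N. cmod (psi_term Z i z - 1))"
      by (rule Weierstrass_m_test'_ev[OF _ M]) (use ev in simp)
    show "continuous_on (cball 0 R) (psi_term Z i)" for i
      using holomorphic_on_imp_continuous_on[OF psi_term_holomorphic[OF Z, of i]]
      by (rule continuous_on_subset) (use R in auto)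
  qed simp
  show "summable (\<lambda>i. cmod (psi_term Z i z - 1))" if "z \<in> cball 0 R" for z
    by (rule summable_comparison_test_ev[OF _ M]) (use ev that in \<open>auto elim!: eventually_mono\<close>)
qed

lemma psi_convergent: "z \<in> disc \<Longrightarrow> convergent_prod (\<lambda>i. psi_term Z i z)"
  using psi_uniform(2)[of "(1 + cmod z) / 2" z]
  by (intro abs_convergent_prod_imp_convergent_prod summable_imp_abs_convergent_prod) (auto simp: add_pos_nonneg)

lemma psi_has_prod: "z \<in> disc \<Longrightarrow> (\<lambda>i. psi_term Z i z) has_prod psi_seq Z z"
  unfolding psi_seq_eq by (rule convergent_prod_has_prod[OF psi_convergent])

lemma psi_tendsto: "z \<in> disc \<Longrightarrow> (\<lambda>N. \<Prod>i<N. psi_term Z i z) \<longlonglongrightarrow> psi_seq Z z"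
  using convergent_prod_LIMSEQ[OF psi_convergent, of z]
  unfolding psi_seq_eq by (subst filterlim_sequentially_Suc[symmetric]) (simp add: lessThan_Suc_atMost)

lemma psi_eq_0_iff: "z \<in> disc \<Longrightarrow> psi_seq Z z = 0 \<longleftrightarrow> (\<exists>i\<in>fst Z. snd Z i = z)"
  using has_prod_eq_0_iff[OF psi_has_prod, of z] psi_factor_eq_0_iff[of _ z] Z
  by (auto simp: psi_term_def seq_in_disc_def image_iff split: if_splits)

lemma psi_holomorphic: "psi_seq Z holomorphic_on disc"
proof (rule holomorphic_uniform_sequence[OF open_ball])
  show "(\<lambda>z. \<Prod>i<N. psi_term Z i z) holomorphic_on disc" for N
    by (intro holomorphic_intros psi_term_holomorphic[OF Z])
next
  fix z :: complex assume z: "z \<in> disc"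
  define R where "R = (1 + cmod z) / 2"
  have R: "0 < R" "R < 1" "cmod z < R" using z by (auto simp: R_def add_pos_nonneg)
  obtain g where g: "uniform_limit (cball 0 R) (\<lambda>N z. \<Prod>i<N. psi_term Z i z) g sequentially"
    using psi_uniform(1)[OF R(1,2)] by (auto simp: uniformly_convergent_on_def)
  have "g w = psi_seq Z w" if "w \<in> cball 0 R" for w
    using tendsto_uniform_limitI[OF g that] psi_tendsto[of w] that R(2)
    by (auto intro: LIMSEQ_unique)
  with g have "uniform_limit (cball 0 R) (\<lambda>N z. \<Prod>i<N. psi_term Z i z) (psi_seq Z) sequentially"
    by (subst (asm) uniform_limit_cong') auto
  moreover have sub: "cball z (R - cmod z) \<subseteq> cball 0 R" by (auto simp: cball_subset_cball_iff)
  ultimately have "uniform_limit (cball z (R - cmod z)) (\<lambda>N z. \<Prod>i<N. psi_term Z i z) (psi_seq Z) sequentially"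
    by (rule uniform_limit_on_subset)
  moreover have "cball z (R - cmod z) \<subseteq> disc" using sub R(2) by (auto dest!: subsetD)
  ultimately show "\<exists>d>0. cball z d \<subseteq> disc \<and> uniform_limit (cball z d) (\<lambda>N z. \<Prod>i<N. psi_term Z i z) (psi_seq Z) sequentially"
    using R(3) by (intro exI[of _ "R - cmod z"]) auto
qed

lemma k_summable_on:
  assumes "z \<in> disc"
  shows "(\<lambda>i. k_factor (snd Z i) z) summable_on fst Z" "k_seq Z z = (\<Sum>\<^sub>\<infinity>i\<in>fst Z. k_factor (snd Z i) z)"
proof -
  define q where "q = (\<lambda>i. (1 - (cmod (snd Z i))\<^sup>2)\<^sup>2 / (cmod (1 - cnj (snd Z i) * z))\<^sup>2)"
  have kq: "(\<lambda>i. k_factor (snd Z i) z) = (\<lambda>i. (cmod z)\<^sup>2 / 2 * q i)" by (simp add: k_factor_def q_def)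
  have "q summable_on fst Z"
  proof (rule summable_on_comparison_test)
    show "(\<lambda>i. 4 / (1 - cmod z)\<^sup>2 * (1 - cmod (snd Z i))\<^sup>2) summable_on fst Z"
      using sq unfolding square_summable_def by (rule summable_on_cmult_right)
    fix i assume "i \<in> fst Z"
    then have a: "snd Z i \<in> disc" using Z by (simp add: seq_in_disc_def)
    have "(1 - (cmod (snd Z i))\<^sup>2)\<^sup>2 / (cmod (1 - cnj (snd Z i) * z))\<^sup>2 \<le> ((1 - cmod (snd Z i)) * 2)\<^sup>2 / (1 - cmod z)\<^sup>2"
      using assms a by (intro frac_le power_mono one_minus_sq_le cmod_one_minus_ge) (auto simp: power_le_one)
    also have "((1 - cmod (snd Z i)) * 2)\<^sup>2 = 4 * (1 - cmod (snd Z i))\<^sup>2" by (simp only: power_mult_distrib) simp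
    finally show "q i \<le> 4 / (1 - cmod z)\<^sup>2 * (1 - cmod (snd Z i))\<^sup>2" by (simp add: q_def)
    show "0 \<le> q i" by (simp add: q_def)
  qed
  then show "(\<lambda>i. k_factor (snd Z i) z) summable_on fst Z"
    unfolding kq by (rule summable_on_cmult_right)
  show "k_seq Z z = (\<Sum>\<^sub>\<infinity>i\<in>fst Z. k_factor (snd Z i) z)"
    unfolding kq infsum_cmult_right' by (simp only: k_seq_def q_def)
qed

lemma k_summable:
  assumes "z \<in> disc"
  shows "summable (\<lambda>i. if i \<in> fst Z then k_factor (snd Z i) z else 0)"
    "k_seq Z z = (\<Sum>i. if i \<in> fst Z then k_factor (snd Z i) z else 0)"
  using summable_on_imp_summable_if[OF k_summable_on(1)[OF assms] k_factor_nonneg] k_summable_on(2)[OF assms] by auto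

text \<open>\<open>W\<close> becomes a limit of partial products over the same indices as
  \<open>psi_seq\<close>, so that factorwise comparisons pass to the limit.\<close>

lemma W_tendsto: "z \<in> disc \<Longrightarrow> (\<lambda>N. \<Prod>i<N. if i \<in> fst Z then exp (k_factor (snd Z i) z) else 1) \<longlonglongrightarrow> W_seq Z z"
proof -
  assume z: "z \<in> disc"
  have "(\<lambda>N. \<Sum>i<N. if i \<in> fst Z then k_factor (snd Z i) z else 0) \<longlonglongrightarrow> k_seq Z z"
    using summable_LIMSEQ[OF k_summable(1)[OF z]] k_summable(2)[OF z] by simp
  then have "(\<lambda>N. exp (\<Sum>i<N. if i \<in> fst Z then k_factor (snd Z i) z else 0)) \<longlonglongrightarrow> exp (k_seq Z z)"
    by (rule tendsto_exp)
  also have "(\<lambda>N. exp (\<Sum>i<N. if i \<in> fst Z then k_factor (snd Z i) z else 0))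
      = (\<lambda>N. \<Prod>i<N. if i \<in> fst Z then exp (k_factor (snd Z i) z) else 1)"
    by (intro ext, subst exp_sum) (auto intro!: prod.cong)
  finally show ?thesis by (simp add: W_seq_def)
qed

lemma cmod_psi_le_W:
  assumes z: "z \<in> disc"
  shows "cmod (psi_seq Z z) \<le> W_seq Z z"
proof (rule LIMSEQ_le[OF tendsto_norm[OF psi_tendsto[OF z]] W_tendsto[OF z]])
  have "cmod (psi_term Z i z) \<le> (if i \<in> fst Z then exp (k_factor (snd Z i) z) else 1)" for i
    using cmod_psi_factor_le[of "snd Z i" z] z Z by (auto simp: psi_term_def seq_in_disc_def)
  then show "\<exists>N. \<forall>n\<ge>N. cmod (\<Prod>i<n. psi_term Z i z) \<le> (\<Prod>i<n. if i \<in> fst Z then exp (k_factor (snd Z i) z) else 1)"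
    unfolding prod_norm[symmetric] by (auto intro!: prod_mono)
qed

lemma W_measurable: "(\<lambda>z. W_seq Z z) \<in> borel_measurable dA"
proof -
  have [measurable]: "cnj \<in> borel_measurable borel"
    by (intro borel_measurable_continuous_onI continuous_intros)
  have "(\<lambda>z. exp (\<Sum>i. if i \<in> fst Z then k_factor (snd Z i) z else 0)) \<in> borel_measurable dA"
  proof (rule borel_imp_measurable_dA)
    have "(\<lambda>z. if i \<in> fst Z then k_factor (snd Z i) z else 0) \<in> borel_measurable borel" for i
      unfolding k_factor_def by (cases "i \<in> fst Z") simp_all
    then show "(\<lambda>z. exp (\<Sum>i. if i \<in> fst Z then k_factor (snd Z i) z else 0)) \<in> borel_measurable borel"
      by measurable
  qed
  then show ?thesis
    by (rule measurable_cong[THEN iffD1, rotated]) (simp add: W_seq_def k_summable(2))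
qed

lemma c_summable: "summable (\<lambda>i. if i \<in> fst Z then c_factor (snd Z i) else 0)"
proof (rule summable_comparison_test_ev)
  show "summable (\<lambda>i. 3 * (if i \<in> fst Z then (1 - cmod (snd Z i))\<^sup>2 else 0))"
    by (intro summable_mult square_summable_summable sq)
  show "\<forall>\<^sub>F i in sequentially. norm (if i \<in> fst Z then c_factor (snd Z i) else 0) \<le> 3 * (if i \<in> fst Z then (1 - cmod (snd Z i))\<^sup>2 else 0)"
  proof -
    have "eventually (\<lambda>i. i \<in> fst Z \<longrightarrow> 1 - cmod (snd Z i) \<le> 1 / 2) sequentially"
      by (intro eventually_close sq Z) auto
    then show ?thesis
    proof eventually_elim
      case (elim i)
      then show ?case using c_factor_bounds(2)[of "snd Z i"] Z by (auto simp: seq_in_disc_def)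
    qed
  qed
qed

end

section \<open>Orders of zeros\<close>

text \<open>Near each point the powers of \<open>u - w\<close> cancel and \<open>f / p\<close>
  extends holomorphically. \<open>remove_sings\<close> depends on \<open>f / p\<close> alone, so the
  local extensions are restrictions of one function.\<close>

lemma holomorphic_divide_zorder:
  assumes f: "f holomorphic_on disc" and p: "p holomorphic_on disc"
    and nz: "\<exists>z\<in>disc. f z \<noteq> 0" "\<exists>z\<in>disc. p z \<noteq> 0"
    and ord: "\<And>w. w \<in> disc \<Longrightarrow> zorder p w \<le> zorder f w"
  shows "\<exists>G. G holomorphic_on disc \<and> (\<forall>w\<in>disc. f w = G w * p w)"
proof -
  define h where "h = (\<lambda>w. f w / p w)"
  have loc: "\<exists>r>0. ball w r \<subseteq> disc \<and> remove_sings h holomorphic_on ball w r \<and> f w = remove_sings h w * p w" if w: "w \<in> disc" for w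
  proof -
    define m n where "m = nat (zorder f w)" and "n = nat (zorder p w)"
    obtain r1 where r1: "r1 > 0" "cball w r1 \<subseteq> disc" "zor_poly f w holomorphic_on cball w r1"
        "\<And>u. u \<in> cball w r1 \<Longrightarrow> f u = zor_poly f w u * (u - w) ^ m \<and> zor_poly f w u \<noteq> 0"
      using zorder_exist_zero[OF f open_ball connected_ball w nz(1)] unfolding m_def by blast
    obtain r2 where r2: "r2 > 0" "cball w r2 \<subseteq> disc" "zor_poly p w holomorphic_on cball w r2"
        "\<And>u. u \<in> cball w r2 \<Longrightarrow> p u = zor_poly p w u * (u - w) ^ n \<and> zor_poly p w u \<noteq> 0"
      using zorder_exist_zero[OF p open_ball connected_ball w nz(2)] unfolding n_def by blast
    have nm: "n \<le> m" using ord[OF w] unfolding m_def n_def by (rule nat_mono)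
    define r where "r = min r1 r2"
    have r: "0 < r" "ball w r \<subseteq> disc" "\<And>u. u \<in> ball w r \<Longrightarrow> u \<in> cball w r1 \<and> u \<in> cball w r2"
      using r1 r2 by (auto simp: r_def)
    define H where "H = (\<lambda>u. zor_poly f w u / zor_poly p w u * (u - w) ^ (m - n))"
    have H: "H holomorphic_on ball w r"
      unfolding H_def using r(3) r2(4)
      by (intro holomorphic_intros holomorphic_on_subset[OF r1(3)] holomorphic_on_subset[OF r2(3)]) auto
    have hH: "h u = H u" if "u \<in> ball w r" "u \<noteq> w" for u
    proof -
      have "(u - w) ^ m = (u - w) ^ (m - n) * (u - w) ^ n" using nm by (simp flip: power_add)
      then show ?thesis using r1(4)[of u] r2(4)[of u] r(3)[OF that(1)] that(2) by (simp add: h_def H_def)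
    qed
    have fH: "f u = H u * p u" if "u \<in> ball w r" for u
    proof -
      have "(u - w) ^ m = (u - w) ^ (m - n) * (u - w) ^ n" using nm by (simp flip: power_add)
      then show ?thesis using r1(4)[of u] r2(4)[of u] r(3)[OF that] by (simp add: H_def)
    qed
    have rs: "remove_sings h u = H u" if u: "u \<in> ball w r" for u
    proof (rule remove_sings_eqI)
      \<comment> \<open>\<open>h\<close> and \<open>H\<close> may differ at \<open>w\<close>. Around
        a point \<open>u \<noteq> w\<close> that point is cut away; for \<open>u = w\<close> the
        limit ignores it.\<close>
      have "eventually (\<lambda>x. x \<in> ball w r - {w} \<union> {u}) (nhds u) \<or> u = w"
      proof (cases "u = w")
        case False
        have "open (ball w r - {w})" by (simp add: open_delete)
        then have "eventually (\<lambda>x. x \<in> ball w r - {w}) (nhds u)"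
          using False u by (intro eventually_nhds_in_open) auto
        then show ?thesis by (intro disjI1) (auto elim!: eventually_mono)
      qed simp
      then have "eventually (\<lambda>x. h x = H x) (at u)"
      proof
        assume "eventually (\<lambda>x. x \<in> ball w r - {w} \<union> {u}) (nhds u)"
        then show ?thesis unfolding eventually_at_filter by eventually_elim (auto intro: hH)
      next
        assume "u = w"
        then show ?thesis
          using eventually_nhds_in_open[OF open_ball u] unfolding eventually_at_filter
          by (auto intro: hH elim!: eventually_mono)
      qed
      moreover have "H \<midarrow>u\<rightarrow> H u"
        using holomorphic_on_imp_continuous_on[OF H] u by (simp add: continuous_on_eq_continuous_at isContD)
      ultimately show "h \<midarrow>u\<rightarrow> H u" by (simp add: tendsto_cong)
    qed
    have "remove_sings h holomorphic_on ball w r"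
      using H by (rule holomorphic_transform) (simp add: rs)
    then show ?thesis using r fH[of w] rs[of w] by (intro exI[of _ r]) auto
  qed
  have "remove_sings h holomorphic_on disc"
  proof (rule analytic_imp_holomorphic)
    show "remove_sings h analytic_on disc"
      unfolding analytic_on_def using loc by blast
  qed
  then show ?thesis using loc by blast
qed

lemma zorder_mob:
  assumes "a \<in> disc" "w \<in> disc"
  shows "zorder (mob a) w = (if w = a then 1 else 0)"
proof (cases "w = a")
  case True
  have "zorder (mob a) a = 1"
  proof (rule zorder_eqI[of disc a "\<lambda>w. - 1 / (1 - cnj a * w)"])
    show "(\<lambda>w. - 1 / (1 - cnj a * w)) holomorphic_on disc"
      using one_minus_cnj_mult_nz[OF assms(1)] by (intro holomorphic_intros) auto
    show "- 1 / (1 - cnj a * a) \<noteq> 0" using one_minus_cnj_mult_nz[OF assms(1) assms(1)] by simp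
    show "mob a w = - 1 / (1 - cnj a * w) * (w - a) powi 1" for w
      by (simp add: mob_def diff_divide_distrib right_diff_distrib)
  qed (use assms in auto)
  then show ?thesis using True by simp
next
  case False
  have "zorder (mob a) w = 0"
  proof (rule zorder_eq_0I)
    have "mob a holomorphic_on disc" using assms by (intro holomorphic_intros) auto
    then show "mob a analytic_on {w}" using assms(2) analytic_at open_ball by blast
    show "mob a w \<noteq> 0" using False one_minus_cnj_mult_nz[OF assms] by (simp add: mob_def)
  qed
  then show ?thesis using False by simp
qed

lemma analytic_disc: "f holomorphic_on disc \<Longrightarrow> w \<in> disc \<Longrightarrow> f analytic_on {w}"
  using analytic_at open_ball by blast

lemma eventually_nz_disc:
  assumes "f holomorphic_on disc" "\<exists>z\<in>disc. f z \<noteq> 0" "w \<in> disc"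
  shows "eventually (\<lambda>z. f z \<noteq> 0) (at w)"
proof -
  obtain b where b: "b \<in> disc" "f b \<noteq> 0" using assms(2) by blast
  show ?thesis
    using non_zero_neighbour_alt[OF assms(1) open_ball connected_ball assms(3) b] by (rule eventually_mono) simp
qed

lemma zorder_prod_mob:
  assumes I: "finite I" and a: "\<And>i. i \<in> I \<Longrightarrow> a i \<in> disc" and w: "w \<in> disc"
  shows "zorder (\<lambda>z. \<Prod>i\<in>I. mob (a i) z) w = int (card {i \<in> I. a i = w})"
proof -
  have hol: "mob (a i) holomorphic_on disc" if "i \<in> I" for i
    using a[OF that] by (intro holomorphic_intros) auto
  have "eventually (\<lambda>z. \<forall>i\<in>I. mob (a i) z \<noteq> 0) (at w)"
  proof (intro eventually_ball_finite[OF I] ballI)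
    fix i assume i: "i \<in> I"
    define b :: complex where "b = (if a i = 0 then 1 / 2 else 0)"
    have b: "b \<in> disc" "b \<noteq> a i" by (auto simp: b_def)
    then have "mob (a i) b \<noteq> 0" using one_minus_cnj_mult_nz[OF a[OF i] b(1)] by (auto simp: mob_def)
    then show "eventually (\<lambda>z. mob (a i) z \<noteq> 0) (at w)"
      using b(1) by (intro eventually_nz_disc[OF hol[OF i] _ w]) auto
  qed
  then have "eventually (\<lambda>z. (\<Prod>i\<in>I. mob (a i) z) \<noteq> 0) (at w)"
    using I by (auto elim!: eventually_mono)
  then have "zorder (\<lambda>z. \<Prod>i\<in>I. mob (a i) z) w = (\<Sum>i\<in>I. zorder (mob (a i)) w)"
    by (intro zorder_prod_analytic analytic_disc[OF hol w])
  also have "\<dots> = (\<Sum>i\<in>I. if a i = w then 1 else 0)"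
    by (intro sum.cong refl) (use zorder_mob[OF a w] in auto)
  also have "\<dots> = int (card {i \<in> I. a i = w})"
    using I by (simp add: sum.If_cases Int_def)
  finally show ?thesis .
qed

text \<open>Finitely many zeros are divided out at a time, because this is used before square
  summability, and with it the infinite product, is available.\<close>

lemma factor_zeros:
  assumes f: "f holomorphic_on disc" "\<exists>z\<in>disc. f z \<noteq> 0" and van: "vanishes_on f Z" and Z: "seq_in_disc Z"
    and J: "finite J" "J \<subseteq> fst Z"
  shows "\<exists>G. G holomorphic_on disc \<and> (\<forall>w\<in>disc. f w = G w * (\<Prod>i\<in>J. mob (snd Z i) w))"
proof (rule holomorphic_divide_zorder[OF f(1) _ f(2)])
  have a: "snd Z i \<in> disc" if "i \<in> J" for i using Z that J by (auto simp: seq_in_disc_def)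
  show "(\<lambda>w. \<Prod>i\<in>J. mob (snd Z i) w) holomorphic_on disc"
    using a by (intro holomorphic_intros) auto
  have "uncountable disc" by (rule uncountable_ball) simp
  moreover have "countable (snd Z ` J)" using J by (simp add: countable_finite)
  ultimately have "\<not> disc \<subseteq> snd Z ` J" using countable_subset by blast
  then obtain b where b: "b \<in> disc" "b \<notin> snd Z ` J" by (meson subsetI)
  have "(\<Prod>i\<in>J. mob (snd Z i) b) \<noteq> 0"
    using J b one_minus_cnj_mult_nz[OF a b(1)] by (auto simp: mob_def)
  then show "\<exists>z\<in>disc. (\<Prod>i\<in>J. mob (snd Z i) z) \<noteq> 0" using b by blast
  fix w assume w: "w \<in> disc"
  have o: "finite (occurrences Z w)" "int (card (occurrences Z w)) \<le> zorder f w"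
    using van f(2) w by (auto simp: vanishes_on_def)
  have "{i \<in> J. snd Z i = w} \<subseteq> occurrences Z w" using J by (auto simp: occurrences_def)
  then have "card {i \<in> J. snd Z i = w} \<le> card (occurrences Z w)" using o by (intro card_mono)
  then show "zorder (\<lambda>w. \<Prod>i\<in>J. mob (snd Z i) w) w \<le> zorder f w"
    using zorder_prod_mob[OF J(1) a w] o(2) by simp
qed

text \<open>\<open>jensen_disc\<close> with \<open>|G z|\<close> expressed by \<open>|f z|\<close>.
  The factors now have the shape that \<open>cmod_psi_factor\<close> produces.\<close>

lemma jensen_factor_estimate:
  assumes G: "G holomorphic_on disc" and I: "finite I" and a: "\<And>i. i \<in> I \<Longrightarrow> a i \<in> disc" "\<And>i. i \<in> I \<Longrightarrow> a i \<noteq> z"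
    and z: "z \<in> disc" and s: "0 < s" and f: "\<And>u. u \<in> disc \<Longrightarrow> f u = G u * (\<Prod>i\<in>I. mob (a i) u)"
  shows "ennreal ((cmod (f z) * (\<Prod>i\<in>I. 1 / (cmod (mob (a i) z) * exp ((1 - (cmod (mob (a i) z))\<^sup>2) / 2)))) powr s)
    \<le> (\<integral>\<^sup>+w. ennreal (cmod (f w) powr s * ((1 - (cmod z)\<^sup>2)\<^sup>2 / cmod (1 - cnj z * w) ^ 4)) \<partial>dA)"
proof -
  have nz: "cmod (mob (a i) z) \<noteq> 0" if "i \<in> I" for i
    using a[OF that] one_minus_cnj_mult_nz[OF a(1)[OF that] z] by (simp add: mob_def)
  have "cmod (f z) * (\<Prod>i\<in>I. 1 / (cmod (mob (a i) z) * exp ((1 - (cmod (mob (a i) z))\<^sup>2) / 2)))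
     = cmod (G z) * (\<Prod>i\<in>I. cmod (mob (a i) z) * (1 / (cmod (mob (a i) z) * exp ((1 - (cmod (mob (a i) z))\<^sup>2) / 2))))"
    unfolding f[OF z] norm_mult prod_norm[symmetric] prod.distrib by (simp only: mult.assoc)
  also have "(\<Prod>i\<in>I. cmod (mob (a i) z) * (1 / (cmod (mob (a i) z) * exp ((1 - (cmod (mob (a i) z))\<^sup>2) / 2))))
     = (\<Prod>i\<in>I. exp (- (1 - (cmod (mob (a i) z))\<^sup>2) / 2))"
  proof (rule prod.cong)
    fix i assume "i \<in> I"
    then show "cmod (mob (a i) z) * (1 / (cmod (mob (a i) z) * exp ((1 - (cmod (mob (a i) z))\<^sup>2) / 2))) = exp (- (1 - (cmod (mob (a i) z))\<^sup>2) / 2)"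
      using nz by (simp only: minus_divide_left[symmetric] exp_minus inverse_eq_divide) simp
  qed simp
  finally show ?thesis using jensen_disc[OF G I a z s f] by simp
qed

text \<open>The second-order term matters because the first-order terms cancel in
  \<open>zero_factor_ge\<close>.\<close>

lemma ln_one_minus_le:
  fixes y :: real
  assumes "0 \<le> y" "y < 1"
  shows "ln (1 - y) \<le> - y - y\<^sup>2 / 2"
proof -
  have "(\<lambda>x. - x - x\<^sup>2 / 2 - ln (1 - x)) 0 \<le> (\<lambda>x. - x - x\<^sup>2 / 2 - ln (1 - x)) y"
  proof (rule DERIV_nonneg_imp_nondecreasing[OF assms(1)])
    fix x assume x: "0 \<le> x" "x \<le> y"
    then have "((\<lambda>x. - x - x\<^sup>2 / 2 - ln (1 - x)) has_real_derivative (x\<^sup>2 / (1 - x))) (at x)"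
      using assms by (auto intro!: derivative_eq_intros simp: field_simps power2_eq_square)
    moreover have "0 \<le> x\<^sup>2 / (1 - x)" using x assms by simp
    ultimately show "\<exists>d. ((\<lambda>x. - x - x\<^sup>2 / 2 - ln (1 - x)) has_real_derivative d) (at x) \<and> 0 \<le> d" by blast
  qed
  then show ?thesis by simp
qed

text \<open>With \<open>x = |mob a z|\<close> and \<open>y = 1 - x^2\<close>, the linear terms of
  \<open>ln x + y / 2\<close> cancel and at most \<open>- y^2 / 4\<close> remains. As
  \<open>|1 - cnj a z| <= 2\<close>, \<open>y\<close> is at least
  \<open>(1 - |a|) (1 - |z|^2) / 4\<close>, which gives 64 = 4 * 16.\<close>

lemma zero_factor_ge:
  assumes a: "a \<in> disc" and z: "z \<in> disc" "a \<noteq> z"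
  shows "exp ((1 - (cmod z)\<^sup>2)\<^sup>2 / 64 * (1 - cmod a)\<^sup>2) \<le> 1 / (cmod (mob a z) * exp ((1 - (cmod (mob a z))\<^sup>2) / 2))"
proof -
  define x where "x = cmod (mob a z)"
  have x0: "0 < x" using z one_minus_cnj_mult_nz[OF a z(1)] by (simp add: x_def mob_def)
  define y where "y = 1 - x\<^sup>2"
  have "x < 1" using mob_in_disc[OF a z(1)] by (simp add: x_def)
  then have y: "0 \<le> y" "y < 1" using x0 by (auto simp: y_def power_le_one)
  have "2 * ln x = ln (1 - y)" using x0 by (simp add: y_def ln_realpow)
  also have "\<dots> \<le> - y - y\<^sup>2 / 2" by (rule ln_one_minus_le[OF y])
  finally have 1: "ln x + y / 2 \<le> - (y\<^sup>2 / 4)" by (simp add: field_simps)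
  have d: "0 < cmod (1 - cnj a * z)" "(cmod (1 - cnj a * z))\<^sup>2 \<le> 2\<^sup>2"
    using one_minus_cnj_mult_nz[OF a z(1)] cmod_one_minus_ge(3)[of a z] a z power_mono[of "cmod (1 - cnj a * z)" 2 2] by simp_all
  have za: "0 \<le> 1 - (cmod z)\<^sup>2" "0 \<le> 1 - cmod a" using a z by (auto simp: power_le_one)
  have aa: "1 - cmod a \<le> 1 - (cmod a)\<^sup>2" using a by (simp add: power2_eq_square mult_left_le)
  have "(1 - cmod a) * (1 - (cmod z)\<^sup>2) / 4 \<le> (1 - (cmod a)\<^sup>2) * (1 - (cmod z)\<^sup>2) / (cmod (1 - cnj a * z))\<^sup>2"
    using d za aa by (intro frac_le mult_right_mono mult_nonneg_nonneg) auto
  also have "\<dots> = y" using one_minus_mob[OF a z(1)] by (simp add: y_def x_def)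
  finally have "((1 - cmod a) * (1 - (cmod z)\<^sup>2) / 4)\<^sup>2 \<le> y\<^sup>2"
    using za by (intro power_mono) auto
  then have "(1 - (cmod z)\<^sup>2)\<^sup>2 / 64 * (1 - cmod a)\<^sup>2 \<le> y\<^sup>2 / 4"
    by (simp only: power_mult_distrib power_divide) (simp add: field_simps)
  also have "\<dots> \<le> - (ln x + y / 2)" using 1 by simp
  finally have "exp ((1 - (cmod z)\<^sup>2)\<^sup>2 / 64 * (1 - cmod a)\<^sup>2) \<le> exp (- (ln x + y / 2))" by simp
  also have "\<dots> = 1 / (x * exp (y / 2))" using x0 by (simp only: exp_minus exp_add exp_ln inverse_eq_divide)
  finally show ?thesis by (simp add: x_def y_def)
qed

lemma seq_sub:
  assumes "seq_in_disc (I, a)" "J \<subseteq> I"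
  shows "seq_in_disc (J, a)"
  using assms by (auto simp: seq_in_disc_def)

lemma square_summable_sub:
  assumes "square_summable (I, a)" "J \<subseteq> I"
  shows "square_summable (J, a)"
  using assms summable_on_subset_banach[of _ I J] by (auto simp: square_summable_def)

lemma psi_split:
  assumes Z: "seq_in_disc (I, a)" "square_summable (I, a)" and z: "z \<in> disc"
  shows "psi_seq (I, a) z = psi_seq (I \<inter> A, a) z * psi_seq (I - A, a) z"
proof -
  have c: "convergent_prod (\<lambda>i. psi_term (I \<inter> A, a) i z)" "convergent_prod (\<lambda>i. psi_term (I - A, a) i z)"
    by (intro psi_convergent seq_sub[OF Z(1)] square_summable_sub[OF Z(2)] z; blast)+
  have "psi_seq (I, a) z = (\<Prod>i. psi_term (I \<inter> A, a) i z * psi_term (I - A, a) i z)"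
    unfolding psi_seq_eq by (rule arg_cong[of _ _ prodinf]) (auto simp: psi_term_def)
  also have "\<dots> = psi_seq (I \<inter> A, a) z * psi_seq (I - A, a) z"
    unfolding psi_seq_eq by (rule prodinf_mult[OF c, symmetric])
  finally show ?thesis .
qed

lemma psi_finite: "finite J \<Longrightarrow> psi_seq (J, a) z = (\<Prod>i\<in>J. psi_factor (a i) z)"
  unfolding psi_seq_eq by (subst prodinf_finite[of J]) (auto simp: psi_term_def)

lemma psi_finite_mob:
  assumes Z: "seq_in_disc (I, a)" "square_summable (I, a)" and J: "finite J" "J \<subseteq> I" and z: "z \<in> disc"
  shows "psi_seq (I, a) z = (psi_seq (I - J, a) z * (\<Prod>i\<in>J. e_factor (a i) z)) * (\<Prod>i\<in>J. mob (a i) z)"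
proof -
  have "I \<inter> J = J" using J by auto
  then have "psi_seq (I, a) z = psi_seq (J, a) z * psi_seq (I - J, a) z"
    using psi_split[OF Z z, of J] by simp
  also have "psi_seq (J, a) z = (\<Prod>i\<in>J. mob (a i) z) * (\<Prod>i\<in>J. e_factor (a i) z)"
    using J by (simp add: psi_finite psi_factor_mob prod.distrib)
  finally show ?thesis by (simp add: mult_ac)
qed

text \<open>Square summability lets the points accumulate only at the circle.\<close>

lemma finite_occurrences:
  assumes Z: "seq_in_disc Z" "square_summable Z" and w: "w \<in> disc"
  shows "finite (occurrences Z w)"
proof -
  obtain N where N: "\<And>i. N \<le> i \<Longrightarrow> i \<in> fst Z \<Longrightarrow> 1 - cmod (snd Z i) \<le> (1 - cmod w) / 2"
    using eventually_close[OF Z(2,1), of "(1 - cmod w) / 2"] w by (auto simp: eventually_sequentially)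
  have "occurrences Z w \<subseteq> {..<N}"
  proof
    fix i assume i: "i \<in> occurrences Z w"
    show "i \<in> {..<N}"
    proof (rule ccontr)
      assume "i \<notin> {..<N}"
      then show False using N[of i] i w by (auto simp: occurrences_def)
    qed
  qed
  then show ?thesis by (rule finite_subset) simp
qed

text \<open>The finitely many factors that vanish at \<open>w\<close> are split off. The remaining
  product does not vanish there, so the order is counted on a finite product of \<open>mob\<close>
  factors.\<close>

lemma zorder_psi:
  assumes Z: "seq_in_disc Z" "square_summable Z" and w: "w \<in> disc"
  shows "zorder (psi_seq Z) w = int (card (occurrences Z w))"
proof -
  obtain I a where Ia: "Z = (I, a)" by (cases Z)
  define J where "J = occurrences Z w"
  have J: "finite J" "J \<subseteq> I" using finite_occurrences[OF Z w] by (auto simp: J_def occurrences_def Ia)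
  have aJ: "a i = w" if "i \<in> J" for i using that by (auto simp: J_def occurrences_def Ia)
  have aI: "a i \<in> disc" if "i \<in> I" for i using Z(1) that by (auto simp: seq_in_disc_def Ia)
  define g where "g = (\<lambda>z. psi_seq (I - J, a) z * (\<Prod>i\<in>J. e_factor (a i) z))"
  define p where "p = (\<lambda>z. \<Prod>i\<in>J. mob (a i) z)"
  have sub: "seq_in_disc (I - J, a)" "square_summable (I - J, a)"
    using Z by (auto simp: Ia intro: seq_sub square_summable_sub)
  have ghol: "g holomorphic_on disc"
    unfolding g_def using J aI by (intro holomorphic_intros psi_holomorphic sub e_factor_holomorphic) auto
  have phol: "p holomorphic_on disc"
    unfolding p_def using J aI by (intro holomorphic_intros) auto
  have "psi_seq (I - J, a) w \<noteq> 0"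
    using psi_eq_0_iff[OF sub w] by (auto simp: J_def occurrences_def Ia)
  then have gw: "g w \<noteq> 0" using J by (simp add: g_def e_factor_nz)
  have eq: "psi_seq Z z = g z * p z" if "z \<in> disc" for z
    using psi_finite_mob[OF Z[unfolded Ia] J that] by (simp add: Ia g_def p_def)
  have ev_disc: "eventually (\<lambda>z. z \<in> disc) (nhds w)" using w by (intro eventually_nhds_in_open) auto
  have "zorder (psi_seq Z) w = zorder (\<lambda>z. g z * p z) w"
    using ev_disc by (intro zorder_cong) (auto simp: eventually_at_filter eq elim!: eventually_mono)
  also have "\<dots> = zorder g w + zorder p w"
  proof (rule zorder_times_analytic[OF analytic_disc[OF ghol w] analytic_disc[OF phol w]])
    have "eventually (\<lambda>z. g z \<noteq> 0) (at w)" using gw w by (intro eventually_nz_disc[OF ghol]) auto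
    moreover have "eventually (\<lambda>z. p z \<noteq> 0) (at w)"
    proof -
      define b :: complex where "b = (if w = 0 then 1 / 2 else 0)"
      have b: "b \<in> disc" "b \<noteq> w" by (auto simp: b_def)
      then have "p b \<noteq> 0" using J aJ one_minus_cnj_mult_nz[OF w b(1)] by (auto simp: p_def mob_def)
      then show ?thesis using b w by (intro eventually_nz_disc[OF phol]) auto
    qed
    ultimately show "eventually (\<lambda>z. g z * p z \<noteq> 0) (at w)" by eventually_elim simp
  qed
  also have "zorder g w = 0" by (rule zorder_eq_0I[OF analytic_disc[OF ghol w] gw])
  also have "zorder p w = int (card {i \<in> J. a i = w})"
    unfolding p_def using J aI by (intro zorder_prod_mob w) auto
  also have "{i \<in> J. a i = w} = J" using aJ by auto
  finally show ?thesis by (simp add: J_def)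
qed

lemma psi_nonzero:
  assumes "seq_in_disc Z" "square_summable Z"
  shows "\<exists>z\<in>disc. psi_seq Z z \<noteq> 0"
proof -
  have "uncountable disc" by (rule uncountable_ball) simp
  then have "\<not> disc \<subseteq> range (snd Z)" by (meson countable_subset countableI_type countable_image)
  then show ?thesis using psi_eq_0_iff[OF assms] by blast
qed

lemma AE_psi_nonzero:
  assumes Z: "seq_in_disc Z" "square_summable Z"
  shows "AE z in dA. psi_seq Z z \<noteq> 0"
proof -
  have "countable (cmod ` range (snd Z))" by (intro countable_image) simp
  from AE_dA_cmod_notin[OF this] have "AE z in dA. cmod z \<notin> cmod ` range (snd Z)" .
  moreover have "AE z in dA. z \<in> disc" by (rule AE_I2) simp
  ultimately show ?thesis
  proof eventually_elim
    case (elim z)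
    then show ?case using psi_eq_0_iff[OF Z elim(2)] by (auto simp: image_iff)
  qed
qed

lemma holo_disc_measurable:
  assumes "f \<in> holo_disc"
  shows "f \<in> borel_measurable borel" "f \<in> borel_measurable dA"
proof -
  have "f = (\<lambda>z. if z \<in> disc then f z else 0)" using assms by (auto simp: holo_disc_def fun_eq_iff)
  also have "\<dots> \<in> borel_measurable borel"
    using assms by (intro borel_measurable_continuous_on_if) (auto simp: holo_disc_def intro!: holomorphic_on_imp_continuous_on)
  finally show "f \<in> borel_measurable borel" .
  then show "f \<in> borel_measurable dA" by (rule borel_imp_measurable_dA)
qed

section \<open>Zero sets of weighted Bergman spaces\<close>

context bekolle_weight
begin

lemma Lp_iff:
  assumes h: "h \<in> borel_measurable dA"
  shows "h \<in> Lp p \<omega> \<longleftrightarrow> (\<integral>\<^sup>+z. ennreal (cmod (h z) powr p * \<omega> z) \<partial>dA) < \<infinity>"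
proof -
  note [measurable] = h
  have "(\<integral>\<^sup>+z. ennreal (norm (cmod (h z) powr p * \<omega> z)) \<partial>dA) = (\<integral>\<^sup>+z. ennreal (cmod (h z) powr p * \<omega> z) \<partial>dA)"
    by (intro nn_integral_cong) (simp add: omega(1))
  then show ?thesis by (simp add: Lp_def integrable_iff_bounded)
qed

lemma Lp_norm_eq:
  assumes h: "h \<in> borel_measurable dA"
  shows "Lp_norm p \<omega> h = enn2real (\<integral>\<^sup>+z. ennreal (cmod (h z) powr p * \<omega> z) \<partial>dA) powr (1 / p)"
proof -
  note [measurable] = h
  have "(\<integral>z. cmod (h z) powr p * \<omega> z \<partial>dA) = enn2real (\<integral>\<^sup>+z. ennreal (cmod (h z) powr p * \<omega> z) \<partial>dA)"
    by (rule integral_eq_nn_integral) (auto intro!: AE_I2 simp: omega(1))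
  then show ?thesis by (simp add: Lp_norm_def)
qed

text \<open>For \<open>p < 1\<close> the triangle inequality fails;
  \<open>|x - y|^p <= 2^p (|x|^p + |y|^p)\<close> holds for all \<open>p > 0\<close>.\<close>

lemma Lp_diff:
  assumes p: "0 < p" and f: "f \<in> Lp p \<omega>" and g: "g \<in> Lp p \<omega>"
  shows "(\<lambda>z. g z - f z) \<in> Lp p \<omega>"
proof -
  have [measurable]: "f \<in> borel_measurable dA" "g \<in> borel_measurable dA" using f g by (auto simp: Lp_def)
  have fin: "(\<integral>\<^sup>+z. ennreal (cmod (f z) powr p * \<omega> z) \<partial>dA) < \<infinity>" "(\<integral>\<^sup>+z. ennreal (cmod (g z) powr p * \<omega> z) \<partial>dA) < \<infinity>"
    using f g Lp_iff by auto
  have pt: "cmod (x - y) powr p \<le> 2 powr p * (cmod x powr p + cmod y powr p)" for x y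
  proof -
    have "cmod (x - y) \<le> 2 * max (cmod x) (cmod y)" using norm_triangle_ineq4[of x y] by linarith
    then have "cmod (x - y) powr p \<le> (2 * max (cmod x) (cmod y)) powr p" using p by (intro powr_mono2) auto
    also have "\<dots> = 2 powr p * max (cmod x) (cmod y) powr p" by (rule powr_mult)
    also have "max (cmod x) (cmod y) powr p \<le> cmod x powr p + cmod y powr p" by (auto simp: max_def)
    finally show ?thesis by simp
  qed
  have "(\<integral>\<^sup>+z. ennreal (cmod (g z - f z) powr p * \<omega> z) \<partial>dA)
     \<le> (\<integral>\<^sup>+z. ennreal (2 powr p) * (ennreal (cmod (g z) powr p * \<omega> z) + ennreal (cmod (f z) powr p * \<omega> z)) \<partial>dA)"
  proof (rule nn_integral_mono)
    fix z assume "z \<in> space dA"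
    then have w: "0 \<le> \<omega> z" using omega(1) by simp
    have "cmod (g z - f z) powr p * \<omega> z \<le> (2 powr p * (cmod (g z) powr p + cmod (f z) powr p)) * \<omega> z"
      using w by (intro mult_right_mono pt)
    also have "\<dots> = 2 powr p * (cmod (g z) powr p * \<omega> z + cmod (f z) powr p * \<omega> z)" by (simp add: algebra_simps)
    finally have "ennreal (cmod (g z - f z) powr p * \<omega> z) \<le> ennreal (2 powr p * (cmod (g z) powr p * \<omega> z + cmod (f z) powr p * \<omega> z))"
      by (rule ennreal_leI)
    also have "\<dots> = ennreal (2 powr p) * (ennreal (cmod (g z) powr p * \<omega> z) + ennreal (cmod (f z) powr p * \<omega> z))"
      using w by (simp add: ennreal_mult ennreal_plus)
    finally show "ennreal (cmod (g z - f z) powr p * \<omega> z) \<le> ennreal (2 powr p) * (ennreal (cmod (g z) powr p * \<omega> z) + ennreal (cmod (f z) powr p * \<omega> z))" .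
  qed
  also have "\<dots> = ennreal (2 powr p) * ((\<integral>\<^sup>+z. ennreal (cmod (g z) powr p * \<omega> z) \<partial>dA) + (\<integral>\<^sup>+z. ennreal (cmod (f z) powr p * \<omega> z) \<partial>dA))"
    by (simp add: nn_integral_cmult nn_integral_add)
  also have "\<dots> < \<infinity>" using fin by (simp add: ennreal_mult_less_top ennreal_add_less_top)
  finally show ?thesis by (subst Lp_iff) auto
qed

lemma Lp_norm_le:
  assumes p: "0 < p" and K: "0 \<le> K" and h: "h \<in> borel_measurable dA" and g: "g \<in> borel_measurable dA" "g \<in> Lp p \<omega>"
    and le: "(\<integral>\<^sup>+z. ennreal (cmod (h z) powr p * \<omega> z) \<partial>dA) \<le> ennreal K * (\<integral>\<^sup>+z. ennreal (cmod (g z) powr p * \<omega> z) \<partial>dA)"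
  shows "h \<in> Lp p \<omega>" "Lp_norm p \<omega> h \<le> K powr (1 / p) * Lp_norm p \<omega> g"
proof -
  have fin: "(\<integral>\<^sup>+z. ennreal (cmod (g z) powr p * \<omega> z) \<partial>dA) < \<infinity>" using g Lp_iff by auto
  then have fin': "ennreal K * (\<integral>\<^sup>+z. ennreal (cmod (g z) powr p * \<omega> z) \<partial>dA) < \<infinity>" by (simp add: ennreal_mult_less_top)
  show "h \<in> Lp p \<omega>" unfolding Lp_iff[OF h] using le fin' by (rule le_less_trans)
  have "enn2real (\<integral>\<^sup>+z. ennreal (cmod (h z) powr p * \<omega> z) \<partial>dA) \<le> enn2real (ennreal K * (\<integral>\<^sup>+z. ennreal (cmod (g z) powr p * \<omega> z) \<partial>dA))"
    using le fin' by (intro enn2real_mono) auto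
  also have "\<dots> = K * enn2real (\<integral>\<^sup>+z. ennreal (cmod (g z) powr p * \<omega> z) \<partial>dA)"
    using K by (simp add: enn2real_mult)
  finally have "enn2real (\<integral>\<^sup>+z. ennreal (cmod (h z) powr p * \<omega> z) \<partial>dA) powr (1 / p)
     \<le> (K * enn2real (\<integral>\<^sup>+z. ennreal (cmod (g z) powr p * \<omega> z) \<partial>dA)) powr (1 / p)"
    using p by (intro powr_mono2) auto
  also have "\<dots> = K powr (1 / p) * enn2real (\<integral>\<^sup>+z. ennreal (cmod (g z) powr p * \<omega> z) \<partial>dA) powr (1 / p)"
    by (rule powr_mult)
  finally show "Lp_norm p \<omega> h \<le> K powr (1 / p) * Lp_norm p \<omega> g"
    by (simp only: Lp_norm_eq[OF h] Lp_norm_eq[OF g(1)])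
qed

text \<open>\<open>|f|^(p/q)\<close> is in \<open>L^q(\<omega>)\<close>, hence integrable with
  respect to \<open>dA\<close> by Hoelder's inequality and the finiteness of \<open>S\<close>. For
  fixed \<open>z\<close> the kernel is at most \<open>(1 - |z|)^(-4)\<close>.\<close>

lemma kernel_finite:
  assumes p: "0 < p" and f: "f \<in> Bergman p \<omega>" and z: "z \<in> disc"
  shows "(\<integral>\<^sup>+w. ennreal (cmod (f w) powr (p / q) / cmod (1 - cnj z * w) ^ 4) \<partial>dA) < \<infinity>"
proof -
  define r where "r = q / (q - 1)"
  have r: "1 < r" "1 / q + 1 / r = 1" "r / q = 1 / (q - 1)" using q1 by (auto simp: r_def field_simps)
  have fm: "f \<in> borel_measurable dA" using f holo_disc_measurable by (auto simp: Bergman_def)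
  note [measurable] = fm
  define M where "M = enn2real (\<integral>\<^sup>+z. ennreal (cmod (f z) powr p * \<omega> z) \<partial>dA)"
  have M: "(\<integral>\<^sup>+z. ennreal (cmod (f z) powr p * \<omega> z) \<partial>dA) = ennreal M" "0 \<le> M"
    using f Lp_iff[OF fm] by (auto simp: Bergman_def M_def)
  define g where "g = (\<lambda>w. cmod (f w) powr (p / q) * \<omega> w powr (1 / q))"
  define h where "h = (\<lambda>w. \<omega> w powr (- (1 / q)))"
  have "(\<integral>\<^sup>+w. ennreal (g w * h w) \<partial>dA) \<le> ennreal (M powr (1 / q) * measure S disc powr (1 / r))"
  proof (rule nn_integral_Holder[OF q1 r(1,2)])
    show "g \<in> borel_measurable dA" "h \<in> borel_measurable dA" unfolding g_def h_def by measurable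
    have "(\<integral>\<^sup>+w. ennreal (g w powr q) \<partial>dA) = (\<integral>\<^sup>+z. ennreal (cmod (f z) powr p * \<omega> z) \<partial>dA)"
      using q1 omega(1) by (intro nn_integral_cong) (simp add: g_def powr_mult powr_powr)
    then show "(\<integral>\<^sup>+w. ennreal (g w powr q) \<partial>dA) \<le> ennreal M" using M by simp
    have "(\<integral>\<^sup>+w. ennreal (h w powr r) \<partial>dA) = (\<integral>\<^sup>+w\<in>disc. ennreal (\<sigma> w) \<partial>dA)"
      using r(3) by (intro nn_integral_cong) (simp add: h_def \<sigma>_def powr_powr)
    also have "\<dots> = emeasure S disc" by (rule emeasure_S[symmetric]) (auto intro!: sets_dA_borel)
    finally show "(\<integral>\<^sup>+w. ennreal (h w powr r) \<partial>dA) \<le> ennreal (measure S disc)" by (simp add: S.emeasure_eq_measure)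
  qed (use M in \<open>auto simp: g_def h_def\<close>)
  then have fin: "(\<integral>\<^sup>+w. ennreal (g w * h w) \<partial>dA) < \<infinity>" by (simp add: le_less_trans)
  have "(\<integral>\<^sup>+w. ennreal (cmod (f w) powr (p / q) / cmod (1 - cnj z * w) ^ 4) \<partial>dA)
     \<le> (\<integral>\<^sup>+w. ennreal (1 / (1 - cmod z) ^ 4) * ennreal (g w * h w) \<partial>dA)"
  proof (rule nn_integral_mono_AE)
    have "AE w in dA. w \<in> disc" by (rule AE_I2) simp
    with omega(3) show "AE w in dA. ennreal (cmod (f w) powr (p / q) / cmod (1 - cnj z * w) ^ 4) \<le> ennreal (1 / (1 - cmod z) ^ 4) * ennreal (g w * h w)"
    proof eventually_elim
      case (elim w)
      have "\<omega> w powr (1 / q) * \<omega> w powr (- (1 / q)) = 1" using elim by (simp flip: powr_add)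
      then have gh: "g w * h w = cmod (f w) powr (p / q)" by (simp add: g_def h_def mult.assoc)
      have "(1 - cmod z) ^ 4 \<le> cmod (1 - cnj z * w) ^ 4"
        using cmod_one_minus_ge(1)[of z w] z elim by (intro power_mono) auto
      then have "cmod (f w) powr (p / q) / cmod (1 - cnj z * w) ^ 4 \<le> cmod (f w) powr (p / q) / (1 - cmod z) ^ 4"
        using z by (intro divide_left_mono mult_pos_pos) (auto simp: one_minus_cnj_mult_nz[OF z elim(2)])
      then show ?case using z by (subst ennreal_mult[symmetric]) (auto simp: gh intro!: ennreal_leI)
    qed
  qed
  also have "\<dots> = ennreal (1 / (1 - cmod z) ^ 4) * (\<integral>\<^sup>+w. ennreal (g w * h w) \<partial>dA)"
    by (rule nn_integral_cmult) (simp add: g_def h_def)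
  also have "\<dots> < \<infinity>" using fin by (simp add: ennreal_mult_less_top)
  finally show ?thesis .
qed

lemma berezin_kernel:
  fixes f :: "complex \<Rightarrow> complex"
  assumes f: "f \<in> borel_measurable dA" and z: "z \<in> disc"
  shows "(\<integral>\<^sup>+w. ennreal (cmod (f w) powr s * ((1 - (cmod z)\<^sup>2)\<^sup>2 / cmod (1 - cnj z * w) ^ 4)) \<partial>dA)
    = ennreal ((1 - (cmod z)\<^sup>2)\<^sup>2) * (\<integral>\<^sup>+w. ennreal (cmod (f w) powr s / cmod (1 - cnj z * w) ^ 4) \<partial>dA)"
proof -
  note [measurable] = f
  have [measurable]: "(\<lambda>w. cmod (1 - cnj z * w)) \<in> borel_measurable dA" by (rule borel_imp_measurable_dA) measurable
  have "(\<integral>\<^sup>+w. ennreal (cmod (f w) powr s * ((1 - (cmod z)\<^sup>2)\<^sup>2 / cmod (1 - cnj z * w) ^ 4)) \<partial>dA)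
    = (\<integral>\<^sup>+w. ennreal ((1 - (cmod z)\<^sup>2)\<^sup>2) * ennreal (cmod (f w) powr s / cmod (1 - cnj z * w) ^ 4) \<partial>dA)"
    by (intro nn_integral_cong, subst ennreal_mult[symmetric]) auto
  also have "\<dots> = ennreal ((1 - (cmod z)\<^sup>2)\<^sup>2) * (\<integral>\<^sup>+w. ennreal (cmod (f w) powr s / cmod (1 - cnj z * w) ^ 4) \<partial>dA)"
    by (rule nn_integral_cmult) measurable
  finally show ?thesis .
qed

lemma Bergman_square_summable:
  assumes p: "0 < p" and f: "f \<in> Bergman p \<omega>" "\<exists>z\<in>disc. f z \<noteq> 0" and van: "vanishes_on f Z" and Z: "seq_in_disc Z"
  shows "square_summable Z"
proof -
  define s where "s = p / q"
  have s: "0 < s" using p q1 by (simp add: s_def)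
  have fh: "f holomorphic_on disc" using f by (auto simp: Bergman_def holo_disc_def)
  have fm: "f \<in> borel_measurable dA" using f holo_disc_measurable by (auto simp: Bergman_def)
  obtain z where z: "z \<in> disc" "f z \<noteq> 0" using f(2) by blast
  define B where "B = (\<integral>\<^sup>+w. ennreal (cmod (f w) powr s * ((1 - (cmod z)\<^sup>2)\<^sup>2 / cmod (1 - cnj z * w) ^ 4)) \<partial>dA)"
  have "B < \<infinity>" unfolding B_def berezin_kernel[OF fm z(1)] using kernel_finite[OF p f(1) z(1)]
    by (simp add: ennreal_mult_less_top s_def)
  then obtain b where b: "B = ennreal b" "0 \<le> b" by (cases B) auto
  define c where "c = (1 - (cmod z)\<^sup>2)\<^sup>2 / 64"
  have "(cmod z)\<^sup>2 < 1" using z by (simp add: abs_square_less_1)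
  then have c: "0 < c" by (simp add: c_def)
  define L where "L = b powr (1 / s) / cmod (f z)"
  \<comment> \<open>The bound \<open>L\<close> does not depend on \<open>J\<close>, so it carries
    over to the whole sequence.\<close>
  have bound: "c * (\<Sum>i\<in>J. (1 - cmod (snd Z i))\<^sup>2) \<le> L" if J: "finite J" "J \<subseteq> fst Z" for J
  proof -
    have a: "snd Z i \<in> disc" if "i \<in> J" for i using Z J that by (auto simp: seq_in_disc_def)
    have az: "snd Z i \<noteq> z" if "i \<in> J" for i
    proof
      assume e: "snd Z i = z"
      have "finite (occurrences Z z)" "int (card (occurrences Z z)) \<le> zorder f z"
        using van f(2) z(1) by (auto simp: vanishes_on_def)
      moreover have "i \<in> occurrences Z z" using e that J by (auto simp: occurrences_def)
      moreover have "zorder f z = 0" by (rule zorder_eq_0I[OF analytic_disc[OF fh z(1)] z(2)])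
      ultimately show False by auto
    qed
    obtain G where G: "G holomorphic_on disc" "\<And>w. w \<in> disc \<Longrightarrow> f w = G w * (\<Prod>i\<in>J. mob (snd Z i) w)"
      using factor_zeros[OF fh f(2) van Z J] by blast
    have "ennreal ((cmod (f z) * (\<Prod>i\<in>J. 1 / (cmod (mob (snd Z i) z) * exp ((1 - (cmod (mob (snd Z i) z))\<^sup>2) / 2)))) powr s) \<le> ennreal b"
      unfolding b(1)[symmetric] B_def by (rule jensen_factor_estimate[OF G(1) J(1) a az z(1) s G(2)])
    then have "(cmod (f z) * (\<Prod>i\<in>J. 1 / (cmod (mob (snd Z i) z) * exp ((1 - (cmod (mob (snd Z i) z))\<^sup>2) / 2)))) powr s \<le> b"
      using b(2) by (simp add: ennreal_le_iff)
    then have "((cmod (f z) * (\<Prod>i\<in>J. 1 / (cmod (mob (snd Z i) z) * exp ((1 - (cmod (mob (snd Z i) z))\<^sup>2) / 2)))) powr s) powr (1 / s) \<le> b powr (1 / s)"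
      using s by (intro powr_mono2) auto
    then have "cmod (f z) * (\<Prod>i\<in>J. 1 / (cmod (mob (snd Z i) z) * exp ((1 - (cmod (mob (snd Z i) z))\<^sup>2) / 2))) \<le> b powr (1 / s)"
      using s by (simp add: powr_powr prod_nonneg)
    then have le: "(\<Prod>i\<in>J. 1 / (cmod (mob (snd Z i) z) * exp ((1 - (cmod (mob (snd Z i) z))\<^sup>2) / 2))) \<le> L"
      using z(2) by (simp add: L_def field_simps)
    \<comment> \<open>\<open>t <= exp t\<close> turns the sum into a product to which every zero
      contributes the factor of \<open>zero_factor_ge\<close>.\<close>
    have "c * (\<Sum>i\<in>J. (1 - cmod (snd Z i))\<^sup>2) \<le> exp (c * (\<Sum>i\<in>J. (1 - cmod (snd Z i))\<^sup>2))"
      using exp_ge_add_one_self[of "c * (\<Sum>i\<in>J. (1 - cmod (snd Z i))\<^sup>2)"] by linarith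
    also have "\<dots> = (\<Prod>i\<in>J. exp (c * (1 - cmod (snd Z i))\<^sup>2))" using J by (simp add: exp_sum sum_distrib_left)
    also have "\<dots> \<le> (\<Prod>i\<in>J. 1 / (cmod (mob (snd Z i) z) * exp ((1 - (cmod (mob (snd Z i) z))\<^sup>2) / 2)))"
      unfolding c_def using a az z by (intro prod_mono conjI zero_factor_ge) auto
    also note le
    finally show ?thesis .
  qed
  show ?thesis unfolding square_summable_def
  proof (rule nonneg_bdd_above_summable_on)
    show "bdd_above (sum (\<lambda>i. (1 - cmod (snd Z i))\<^sup>2) ` {F. F \<subseteq> fst Z \<and> finite F})"
    proof (rule bdd_aboveI2)
      fix F assume "F \<in> {F. F \<subseteq> fst Z \<and> finite F}"
      then have "c * (\<Sum>i\<in>F. (1 - cmod (snd Z i))\<^sup>2) \<le> L" by (intro bound) auto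
      then show "(\<Sum>i\<in>F. (1 - cmod (snd Z i))\<^sup>2) \<le> L / c" using c by (simp add: field_simps)
    qed
  qed simp
qed

end

text \<open>Jensen's estimate treats the first \<open>n\<close> points, with a right-hand side that
  does not involve \<open>n\<close>. In the limit the partial products of \<open>exp k_a\<close>
  become \<open>W\<close>, and the partial products of the factors cancel the modulus of the full
  product.\<close>

lemma W_le_kernel:
  assumes Z: "seq_in_disc Z" "square_summable Z" and F: "F holomorphic_on disc" and s: "0 < s"
    and z: "z \<in> disc" "psi_seq Z z \<noteq> 0"
  shows "ennreal ((exp (\<Sum>i. if i \<in> fst Z then c_factor (snd Z i) else 0) * cmod (F z) * W_seq Z z) powr s)
    \<le> (\<integral>\<^sup>+w. ennreal (cmod (F w * psi_seq Z w) powr s * ((1 - (cmod z)\<^sup>2)\<^sup>2 / cmod (1 - cnj z * w) ^ 4)) \<partial>dA)"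
    (is "_ \<le> ?B")
proof -
  obtain I a where Ia: "Z = (I, a)" by (cases Z)
  have aI: "a i \<in> disc" if "i \<in> I" for i using Z(1) that by (auto simp: seq_in_disc_def Ia)
  have az: "a i \<noteq> z" if "i \<in> I" for i using psi_eq_0_iff[OF Z z(1)] z(2) that by (auto simp: Ia)
  \<comment> \<open>By \<open>cmod_psi_factor\<close> the quotient for a single point is the
    reciprocal of \<open>|mob| * exp ((1 - |mob|^2) / 2)\<close>, so \<open>X n\<close> is the
    quantity in \<open>jensen_factor_estimate\<close> for the points with index below
    \<open>n\<close>.\<close>
  define X where "X = (\<lambda>n. cmod (F z * psi_seq Z z)
     * (exp (\<Sum>i<n. if i \<in> fst Z then c_factor (snd Z i) else 0)
        * (\<Prod>i<n. if i \<in> fst Z then exp (k_factor (snd Z i) z) else 1)) / cmod (\<Prod>i<n. psi_term Z i z))"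
  have "X \<longlonglongrightarrow> cmod (F z * psi_seq Z z)
     * (exp (\<Sum>i. if i \<in> fst Z then c_factor (snd Z i) else 0) * W_seq Z z) / cmod (psi_seq Z z)"
    unfolding X_def
    by (intro tendsto_intros summable_LIMSEQ c_summable[OF Z] W_tendsto[OF Z] psi_tendsto[OF Z]) (use z in auto)
  also have "cmod (F z * psi_seq Z z)
     * (exp (\<Sum>i. if i \<in> fst Z then c_factor (snd Z i) else 0) * W_seq Z z) / cmod (psi_seq Z z)
     = exp (\<Sum>i. if i \<in> fst Z then c_factor (snd Z i) else 0) * cmod (F z) * W_seq Z z"
    using z by (simp add: norm_mult)
  finally have lim: "X \<longlonglongrightarrow> exp (\<Sum>i. if i \<in> fst Z then c_factor (snd Z i) else 0) * cmod (F z) * W_seq Z z" .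
  have X: "ennreal (X n powr s) \<le> ?B" for n
  proof -
    define J where "J = I \<inter> {..<n}"
    have J: "finite J" "J \<subseteq> I" by (auto simp: J_def)
    define G where "G = (\<lambda>w. F w * (psi_seq (I - J, a) w * (\<Prod>i\<in>J. e_factor (a i) w)))"
    have sub: "seq_in_disc (I - J, a)" "square_summable (I - J, a)"
      using Z by (auto simp: Ia intro: seq_sub square_summable_sub)
    have G: "G holomorphic_on disc"
      unfolding G_def using J aI by (intro holomorphic_intros F psi_holomorphic sub e_factor_holomorphic) auto
    have eq: "F w * psi_seq Z w = G w * (\<Prod>i\<in>J. mob (a i) w)" if "w \<in> disc" for w
      unfolding G_def Ia psi_finite_mob[OF Z[unfolded Ia] J that] by (simp only: mult.assoc)
    have J_prod: "(\<Prod>i<n. if i \<in> I then g i else 1) = prod g J" for g :: "nat \<Rightarrow> 'c::comm_monoid_mult"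
      unfolding J_def by (subst prod.inter_restrict[symmetric]) (auto simp: Int_commute)
    have J_sum: "(\<Sum>i<n. if i \<in> I then g i else 0) = sum g J" for g :: "nat \<Rightarrow> real"
      unfolding J_def by (subst sum.inter_restrict[symmetric]) (auto simp: Int_commute)
    have e: "exp (\<Sum>i<n. if i \<in> I then c_factor (snd Z i) else 0) = (\<Prod>i\<in>J. exp (c_factor (a i)))"
      using J by (simp add: J_sum exp_sum Ia)
    have "X n = cmod (F z * psi_seq Z z)
       * ((\<Prod>i\<in>J. exp (c_factor (a i) + k_factor (a i) z)) / (\<Prod>i\<in>J. cmod (psi_factor (a i) z)))"
      by (simp add: X_def Ia psi_term_def J_prod e prod.distrib exp_add prod_norm)
    also have "(\<Prod>i\<in>J. exp (c_factor (a i) + k_factor (a i) z)) / (\<Prod>i\<in>J. cmod (psi_factor (a i) z))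
      = (\<Prod>i\<in>J. 1 / (cmod (mob (a i) z) * exp ((1 - (cmod (mob (a i) z))\<^sup>2) / 2)))"
      unfolding prod_dividef[symmetric] using J aI z by (intro prod.cong refl) (auto simp: cmod_psi_factor)
    finally have "X n = cmod (F z * psi_seq Z z) * (\<Prod>i\<in>J. 1 / (cmod (mob (a i) z) * exp ((1 - (cmod (mob (a i) z))\<^sup>2) / 2)))" .
    moreover have "a i \<in> disc" "a i \<noteq> z" if "i \<in> J" for i using aI az J that by blast+
    note jensen_factor_estimate[OF G J(1) this z(1) s eq]
    ultimately show ?thesis by simp
  qed
  have nn: "0 \<le> X n" for n by (auto simp: X_def intro!: divide_nonneg_nonneg mult_nonneg_nonneg prod_nonneg)
  have "(\<lambda>n. X n powr s) \<longlonglongrightarrow> (exp (\<Sum>i. if i \<in> fst Z then c_factor (snd Z i) else 0) * cmod (F z) * W_seq Z z) powr s"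
    using s by (intro tendsto_powr2 lim tendsto_const) (auto simp: nn)
  from tendsto_ennrealI[OF this] show ?thesis by (rule LIMSEQ_le_const2) (use X in blast)
qed

context bekolle_weight
begin

text \<open>\<open>W_le_kernel\<close> is inserted into \<open>berezin_bound\<close> with
  \<open>g = |F \<psi>|^s\<close>. The constant depends on \<open>Z\<close> through the sum of the
  \<open>c_factor\<close> values, but not on \<open>F\<close>; this uniformity yields continuity of
  the quotient map.\<close>

lemma W_norm_bound:
  assumes p: "0 < p" and Z: "seq_in_disc Z" "square_summable Z"
  obtains C where "0 < C" "\<And>F. F \<in> holo_disc \<Longrightarrow> (\<lambda>z. F z * psi_seq Z z) \<in> Bergman p \<omega> \<Longrightarrow>
    (\<integral>\<^sup>+z. ennreal (cmod (F z * W_seq Z z) powr p * \<omega> z) \<partial>dA)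
      \<le> ennreal C * (\<integral>\<^sup>+z. ennreal (cmod (F z * psi_seq Z z) powr p * \<omega> z) \<partial>dA)"
proof -
  obtain K where K: "0 < K" "\<And>g u. g \<in> borel_measurable dA \<Longrightarrow> (\<And>w. w \<in> disc \<Longrightarrow> 0 \<le> g w) \<Longrightarrow>
    (\<And>z. z \<in> disc \<Longrightarrow> 0 \<le> u z \<and> ennreal (u z) \<le> (\<integral>\<^sup>+w. ennreal (g w / cmod (1 - cnj z * w) ^ 4) \<partial>dA)) \<Longrightarrow>
    (\<integral>\<^sup>+z. ennreal (u z powr q * v z) \<partial>dA) \<le> ennreal K * (\<integral>\<^sup>+w. ennreal (g w powr q * \<omega> w) \<partial>dA)"
    by (rule berezin_bound) blast
  define s where "s = p / q"
  have s: "0 < s" "s * q = p" using p q1 by (auto simp: s_def)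
  define E where "E = exp (\<Sum>i. if i \<in> fst Z then c_factor (snd Z i) else 0)"
  have E: "0 < E" by (simp add: E_def)
  have bound: "(\<integral>\<^sup>+z. ennreal (cmod (F z * W_seq Z z) powr p * \<omega> z) \<partial>dA)
      \<le> ennreal (K / E powr p) * (\<integral>\<^sup>+z. ennreal (cmod (F z * psi_seq Z z) powr p * \<omega> z) \<partial>dA)"
    if F: "F \<in> holo_disc" and f: "(\<lambda>z. F z * psi_seq Z z) \<in> Bergman p \<omega>" for F
  proof -
    have [measurable]: "F \<in> borel_measurable dA" "(\<lambda>z. F z * psi_seq Z z) \<in> borel_measurable dA"
        "(\<lambda>z. W_seq Z z) \<in> borel_measurable dA"
      using F f holo_disc_measurable W_measurable[OF Z] by (auto simp: Bergman_def)
    define H where "H = (\<lambda>z. (E * cmod (F z) * W_seq Z z) powr s)"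
    define u where "u = (\<lambda>z. if psi_seq Z z = 0 then 0 else H z / (1 - (cmod z)\<^sup>2)\<^sup>2)"
    define g where "g = (\<lambda>w. cmod (F w * psi_seq Z w) powr s)"
    have W0: "0 < W_seq Z z" for z by (simp add: W_seq_def)
    have "(\<integral>\<^sup>+z. ennreal (u z powr q * v z) \<partial>dA) \<le> ennreal K * (\<integral>\<^sup>+w. ennreal (g w powr q * \<omega> w) \<partial>dA)"
    proof (rule K(2))
      show "g \<in> borel_measurable dA" unfolding g_def by measurable
      show "0 \<le> g w" for w by (simp add: g_def)
      show "0 \<le> u z \<and> ennreal (u z) \<le> (\<integral>\<^sup>+w. ennreal (g w / cmod (1 - cnj z * w) ^ 4) \<partial>dA)"
        if z: "z \<in> disc" for z
      proof
        show "0 \<le> u z" by (simp add: u_def H_def)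
        show "ennreal (u z) \<le> (\<integral>\<^sup>+w. ennreal (g w / cmod (1 - cnj z * w) ^ 4) \<partial>dA)"
        proof (cases "psi_seq Z z = 0")
          case False
          define D where "D = (1 - (cmod z)\<^sup>2)\<^sup>2"
          have "(cmod z)\<^sup>2 < 1" using z by (simp add: abs_square_less_1)
          then have D: "0 < D" by (simp add: D_def)
          have "ennreal (H z) \<le> ennreal D * (\<integral>\<^sup>+w. ennreal (g w / cmod (1 - cnj z * w) ^ 4) \<partial>dA)"
            using W_le_kernel[OF Z _ s(1) z False, of F] F
            unfolding berezin_kernel[OF \<open>(\<lambda>z. F z * psi_seq Z z) \<in> borel_measurable dA\<close> z]
            by (simp add: H_def E_def D_def g_def holo_disc_def)
          then have "ennreal (1 / D) * ennreal (H z) \<le> ennreal (1 / D) * (ennreal D * (\<integral>\<^sup>+w. ennreal (g w / cmod (1 - cnj z * w) ^ 4) \<partial>dA))"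
            by (rule mult_left_mono) simp
          also have "\<dots> = (\<integral>\<^sup>+w. ennreal (g w / cmod (1 - cnj z * w) ^ 4) \<partial>dA)"
            using D by (simp add: mult.assoc[symmetric] ennreal_mult[symmetric])
          finally show ?thesis using False D by (simp add: u_def D_def[symmetric] ennreal_mult[symmetric] H_def)
        qed (simp add: u_def)
      qed
    qed
    also have "(\<integral>\<^sup>+w. ennreal (g w powr q * \<omega> w) \<partial>dA) = (\<integral>\<^sup>+z. ennreal (cmod (F z * psi_seq Z z) powr p * \<omega> z) \<partial>dA)"
      by (simp add: g_def powr_powr s(2))
    also have "(\<integral>\<^sup>+z. ennreal (u z powr q * v z) \<partial>dA) = (\<integral>\<^sup>+z. ennreal (E powr p) * ennreal (cmod (F z * W_seq Z z) powr p * \<omega> z) \<partial>dA)"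
    proof (rule nn_integral_cong_AE)
      have "AE z in dA. z \<in> disc" by (rule AE_I2) simp
      with AE_psi_nonzero[OF Z] show "AE z in dA. ennreal (u z powr q * v z) = ennreal (E powr p) * ennreal (cmod (F z * W_seq Z z) powr p * \<omega> z)"
      proof eventually_elim
        case (elim z)
        have "(cmod z)\<^sup>2 < 1" using elim by (simp add: abs_square_less_1)
        then have D: "0 < 1 - (cmod z)\<^sup>2" by simp
        then have "((1 - (cmod z)\<^sup>2)\<^sup>2) powr q = (1 - (cmod z)\<^sup>2) powr (2 * q)"
          by (simp add: powr_powr flip: powr_numeral)
        then have "u z powr q * v z = (E * cmod (F z) * W_seq Z z) powr p * \<omega> z"
          using elim D by (simp add: u_def v_def H_def powr_divide powr_powr s(2))
        also have "(E * cmod (F z) * W_seq Z z) powr p = E powr p * cmod (F z * W_seq Z z) powr p"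
          using W0[of z] by (simp add: norm_mult mult.assoc powr_mult)
        finally show ?case using omega(1)[of z] elim by (simp add: ennreal_mult[symmetric] mult.assoc)
      qed
    qed
    also have "\<dots> = ennreal (E powr p) * (\<integral>\<^sup>+z. ennreal (cmod (F z * W_seq Z z) powr p * \<omega> z) \<partial>dA)"
      by (rule nn_integral_cmult) measurable
    finally have "ennreal (E powr p) * (\<integral>\<^sup>+z. ennreal (cmod (F z * W_seq Z z) powr p * \<omega> z) \<partial>dA)
       \<le> ennreal K * (\<integral>\<^sup>+z. ennreal (cmod (F z * psi_seq Z z) powr p * \<omega> z) \<partial>dA)" .
    then have "ennreal (1 / E powr p) * (ennreal (E powr p) * (\<integral>\<^sup>+z. ennreal (cmod (F z * W_seq Z z) powr p * \<omega> z) \<partial>dA))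
       \<le> ennreal (1 / E powr p) * (ennreal K * (\<integral>\<^sup>+z. ennreal (cmod (F z * psi_seq Z z) powr p * \<omega> z) \<partial>dA))"
      by (rule mult_left_mono) simp
    then show ?thesis using E K(1) by (simp add: mult.assoc[symmetric] ennreal_mult[symmetric])
  qed
  show thesis by (rule that[OF _ bound]) (use E K in auto)
qed

lemma psi_norm_bound:
  assumes F: "F \<in> holo_disc" and Z: "seq_in_disc Z" "square_summable Z" and p: "0 < p"
  shows "(\<integral>\<^sup>+z. ennreal (cmod (F z * psi_seq Z z) powr p * \<omega> z) \<partial>dA)
      \<le> (\<integral>\<^sup>+z. ennreal (cmod (F z * W_seq Z z) powr p * \<omega> z) \<partial>dA)"
proof (rule nn_integral_mono)
  fix z assume "z \<in> space dA"
  then have z: "z \<in> disc" by simp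
  have "cmod (F z * psi_seq Z z) \<le> cmod (F z * W_seq Z z)"
    using cmod_psi_le_W[OF Z z] by (simp add: norm_mult W_seq_def mult_left_mono)
  then show "ennreal (cmod (F z * psi_seq Z z) powr p * \<omega> z) \<le> ennreal (cmod (F z * W_seq Z z) powr p * \<omega> z)"
    using p omega(1)[of z] z by (intro ennreal_leI mult_right_mono powr_mono2) auto
qed

end

section \<open>Multiplication and division by the product\<close>

lemma holo_disc_mult_psi:
  assumes "F \<in> holo_disc" "seq_in_disc Z" "square_summable Z"
  shows "(\<lambda>z. F z * psi_seq Z z) \<in> holo_disc"
  using assms(1) psi_holomorphic[OF assms(2,3)] by (auto simp: holo_disc_def intro!: holomorphic_intros)

lemma divide_psi_mult:
  assumes F: "F \<in> holo_disc" and Z: "seq_in_disc Z" "square_summable Z"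
  shows "divide_psi Z (\<lambda>z. F z * psi_seq Z z) = F"
proof
  fix z
  show "divide_psi Z (\<lambda>z. F z * psi_seq Z z) z = F z"
  proof (cases "z \<in> disc")
    case True
    have hol: "F holomorphic_on disc" using F by (simp add: holo_disc_def)
    have "eventually (\<lambda>w. psi_seq Z w \<noteq> 0) (at z)"
      by (rule eventually_nz_disc[OF psi_holomorphic[OF Z] psi_nonzero[OF Z] True])
    then have ev: "eventually (\<lambda>w. F w = F w * psi_seq Z w / psi_seq Z w) (at z)" by eventually_elim simp
    have "isCont F z"
      using holomorphic_on_imp_continuous_on[OF hol] True by (simp only: continuous_on_eq_continuous_at[OF open_ball])
    then have "F \<midarrow>z\<rightarrow> F z" by (rule isContD)
    then have "(\<lambda>w. F w * psi_seq Z w / psi_seq Z w) \<midarrow>z\<rightarrow> F z" using tendsto_cong[OF ev] by blast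
    then have "remove_sings (\<lambda>w. F w * psi_seq Z w / psi_seq Z w) z = F z" by (rule remove_sings_eqI)
    then show ?thesis using True by (simp only: divide_psi_def if_True)
  next
    case False
    then show ?thesis using F by (auto simp: divide_psi_def holo_disc_def)
  qed
qed

lemma factor_psi:
  assumes f: "f \<in> holo_disc" "vanishes_on f Z" and Z: "seq_in_disc Z" "square_summable Z"
  shows "\<exists>F\<in>holo_disc. f = (\<lambda>z. F z * psi_seq Z z)"
proof (cases "\<exists>z\<in>disc. f z \<noteq> 0")
  case True
  have "\<exists>G. G holomorphic_on disc \<and> (\<forall>w\<in>disc. f w = G w * psi_seq Z w)"
  proof (rule holomorphic_divide_zorder[OF _ psi_holomorphic[OF Z] True psi_nonzero[OF Z]])
    show "f holomorphic_on disc" using f by (simp add: holo_disc_def)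
    show "zorder (psi_seq Z) w \<le> zorder f w" if "w \<in> disc" for w
      using f(2) True that zorder_psi[OF Z that] by (auto simp: vanishes_on_def)
  qed
  then obtain G where G: "G holomorphic_on disc" "\<And>w. w \<in> disc \<Longrightarrow> f w = G w * psi_seq Z w" by blast
  define F where "F = (\<lambda>z. if z \<in> disc then G z else 0)"
  have "F holomorphic_on disc" by (rule holomorphic_transform[OF G(1)]) (simp add: F_def)
  then have "F \<in> holo_disc" by (simp add: holo_disc_def F_def)
  moreover have "f = (\<lambda>z. F z * psi_seq Z z)"
    using f(1) G(2) by (auto simp: fun_eq_iff F_def holo_disc_def)
  ultimately show ?thesis by blast
next
  case False
  then have "f = (\<lambda>z. 0 * psi_seq Z z)" using f(1) by (auto simp: fun_eq_iff holo_disc_def)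
  moreover have "(\<lambda>z. 0) \<in> holo_disc" by (simp add: holo_disc_def)
  ultimately show ?thesis by (intro bexI[of _ "\<lambda>z. 0"]) auto
qed

lemma mult_psi_nonzero:
  assumes F: "F holomorphic_on disc" "\<exists>z\<in>disc. F z \<noteq> 0" and Z: "seq_in_disc Z" "square_summable Z" and w: "w \<in> disc"
  shows "eventually (\<lambda>z. F z * psi_seq Z z \<noteq> 0) (at w)"
  using eventually_nz_disc[OF F w] eventually_nz_disc[OF psi_holomorphic[OF Z] psi_nonzero[OF Z] w]
  by eventually_elim simp

lemma mult_psi_nonzero_point:
  assumes F: "F holomorphic_on disc" "\<exists>z\<in>disc. F z \<noteq> 0" and Z: "seq_in_disc Z" "square_summable Z"
  shows "\<exists>z\<in>disc. F z * psi_seq Z z \<noteq> 0"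
proof -
  have "eventually (\<lambda>z. z \<in> disc) (at (0::complex))" by (rule eventually_at_in_open') auto
  with mult_psi_nonzero[OF F Z, of 0] have "eventually (\<lambda>z. z \<in> disc \<and> F z * psi_seq Z z \<noteq> 0) (at 0)"
    by (auto elim: eventually_elim2)
  then have "\<exists>z. z \<in> disc \<and> F z * psi_seq Z z \<noteq> 0" by (rule eventually_happens'[rotated]) simp
  then show ?thesis by blast
qed

lemma zorder_mult_psi:
  assumes F: "F holomorphic_on disc" "\<exists>z\<in>disc. F z \<noteq> 0" and Z: "seq_in_disc Z" "square_summable Z" and w: "w \<in> disc"
  shows "zorder (\<lambda>z. F z * psi_seq Z z) w = zorder F w + int (card (occurrences Z w))"
  using zorder_times_analytic[OF analytic_disc[OF F(1) w] analytic_disc[OF psi_holomorphic[OF Z] w] mult_psi_nonzero[OF F Z w]]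
  by (simp add: zorder_psi[OF Z w])

lemma vanishes_mult_psi:
  assumes F: "F \<in> holo_disc" and Z: "seq_in_disc Z" "square_summable Z"
  shows "vanishes_on (\<lambda>z. F z * psi_seq Z z) Z"
proof (cases "\<exists>z\<in>disc. F z \<noteq> 0")
  case True
  have hol: "F holomorphic_on disc" using F by (simp add: holo_disc_def)
  have "0 \<le> zorder F w" if w: "w \<in> disc" for w
    by (rule zorder_ge_0[OF analytic_disc[OF hol w]]) (intro eventually_frequently eventually_nz_disc[OF hol True w], simp)
  then show ?thesis using zorder_mult_psi[OF hol True Z] finite_occurrences[OF Z] by (simp add: vanishes_on_def)
qed (simp add: vanishes_on_def)

lemma is_zero_seq_mult_psi_iff:
  assumes F: "F holomorphic_on disc" "\<exists>z\<in>disc. F z \<noteq> 0" and Z: "seq_in_disc Z" "square_summable Z"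
  shows "is_zero_seq (\<lambda>z. F z * psi_seq Z z) Z \<longleftrightarrow> (\<forall>z\<in>disc. F z \<noteq> 0)"
proof -
  have "zorder F w = 0 \<longleftrightarrow> F w \<noteq> 0" if w: "w \<in> disc" for w
    by (rule zorder_eq_0_iff[OF analytic_disc[OF F(1) w]])
       (intro eventually_frequently eventually_nz_disc[OF F w], simp)
  then show ?thesis
    unfolding is_zero_seq_def using zorder_mult_psi[OF F Z] finite_occurrences[OF Z] Z(1) by auto
qed

lemma is_zero_seq_imp_vanishes: "is_zero_seq f Z \<Longrightarrow> vanishes_on f Z"
  by (auto simp: is_zero_seq_def vanishes_on_def)

text \<open>A zero \<open>w\<close> of order \<open>m\<close> is represented by the pairs
  \<open>(w, 0)\<close> to \<open>(w, m - 1)\<close>. There are countably many pairs in all, and an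
  injection into the natural numbers supplies the index set.\<close>

lemma ex_zero_seq:
  assumes f: "f holomorphic_on disc" "\<exists>z\<in>disc. f z \<noteq> 0"
  shows "\<exists>Y. is_zero_seq f Y"
proof -
  define P where "P = {(w, k). w \<in> disc \<and> int k < zorder f w}"
  have z0: "f w = 0" if "(w, k) \<in> P" for w k
    using that zorder_eq_0I[OF analytic_disc[OF f(1), of w]] by (auto simp: P_def)
  have "countable {w \<in> disc. f w = 0}" using countable_zeros_disc f by blast
  then have "countable ({w \<in> disc. f w = 0} \<times> (UNIV :: nat set))" by simp
  moreover have "P \<subseteq> {w \<in> disc. f w = 0} \<times> UNIV" using z0 by (auto simp: P_def)
  ultimately have P: "countable P" by (rule countable_subset[rotated])
  define Y where "Y = (to_nat_on P ` P, \<lambda>n. fst (from_nat_into P n))"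
  have inj: "inj_on (to_nat_on P) P" using P by (rule inj_on_to_nat_on)
  have occ: "occurrences Y w = to_nat_on P ` ({w} \<times> {..<nat (zorder f w)})" if w: "w \<in> disc" for w
  proof -
    have "occurrences Y w = to_nat_on P ` {x \<in> P. fst x = w}"
      using P by (auto simp: occurrences_def Y_def)
    also have "{x \<in> P. fst x = w} = {w} \<times> {..<nat (zorder f w)}" using w by (auto simp: P_def)
    finally show ?thesis .
  qed
  have "is_zero_seq f Y"
    unfolding is_zero_seq_def
  proof (intro conjI ballI)
    show "seq_in_disc Y" using P by (auto simp: seq_in_disc_def Y_def P_def)
    fix w assume w: "w \<in> disc"
    show "finite (occurrences Y w)" unfolding occ[OF w] by simp
    have "{w} \<times> {..<nat (zorder f w)} \<subseteq> P" using w by (auto simp: P_def)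
    then have "card (occurrences Y w) = nat (zorder f w)"
      unfolding occ[OF w] using inj by (subst card_image) (auto intro: inj_on_subset)
    moreover have "0 \<le> zorder f w"
      by (rule zorder_ge_0[OF analytic_disc[OF f(1) w]])
         (intro eventually_frequently eventually_nz_disc[OF f w], simp)
    ultimately show "int (card (occurrences Y w)) = zorder f w" by simp
  qed
  then show ?thesis by blast
qed

text \<open>Multiplicities compare sequences regardless of their order. Injections between the
  occurrences of each point combine to an injection of index sets that preserves the points, and the
  terms of the sum are nonnegative.\<close>

lemma W_le_W:
  assumes Z: "seq_in_disc Z" "square_summable Z" and Y: "seq_in_disc Y" "square_summable Y"
    and le: "\<And>w. w \<in> disc \<Longrightarrow> card (occurrences Z w) \<le> card (occurrences Y w)" and z: "z \<in> disc"
  shows "W_seq Z z \<le> W_seq Y z"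
proof -
  have "\<exists>g. g ` occurrences Z w \<subseteq> occurrences Y w \<and> inj_on g (occurrences Z w)" if "w \<in> disc" for w
    using card_le_inj[OF finite_occurrences[OF Z that] finite_occurrences[OF Y that] le[OF that]] by blast
  then obtain g where g: "\<And>w. w \<in> disc \<Longrightarrow> g w ` occurrences Z w \<subseteq> occurrences Y w"
      "\<And>w. w \<in> disc \<Longrightarrow> inj_on (g w) (occurrences Z w)" by metis
  define h where "h = (\<lambda>i. g (snd Z i) i)"
  have h: "h i \<in> fst Y \<and> snd Y (h i) = snd Z i" if "i \<in> fst Z" for i
  proof -
    have "snd Z i \<in> disc" using Z(1) that by (simp only: seq_in_disc_def)
    then have "g (snd Z i) i \<in> occurrences Y (snd Z i)" using g(1) that by (auto simp: occurrences_def)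
    then show ?thesis by (simp add: occurrences_def h_def)
  qed
  have inj: "inj_on h (fst Z)"
  proof (rule inj_onI)
    fix i j assume ij: "i \<in> fst Z" "j \<in> fst Z" "h i = h j"
    then have s: "snd Z i = snd Z j" using h by metis
    have "snd Z i \<in> disc" using Z(1) ij by (simp only: seq_in_disc_def)
    then have "inj_on (g (snd Z i)) (occurrences Z (snd Z i))" by (rule g(2))
    then show "i = j" using ij s by (auto simp: inj_on_def occurrences_def h_def)
  qed
  have sub: "h ` fst Z \<subseteq> fst Y" using h by blast
  note kY = k_summable_on[OF Y z]
  have "k_seq Z z = (\<Sum>\<^sub>\<infinity>i\<in>fst Z. k_factor (snd Z i) z)" by (rule k_summable_on(2)[OF Z z])
  also have "\<dots> = (\<Sum>\<^sub>\<infinity>i\<in>fst Z. ((\<lambda>j. k_factor (snd Y j) z) \<circ> h) i)"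
    using h by (intro infsum_cong) simp
  also have "\<dots> = (\<Sum>\<^sub>\<infinity>j\<in>h ` fst Z. k_factor (snd Y j) z)" by (rule infsum_reindex[OF inj, symmetric])
  also have "\<dots> \<le> (\<Sum>\<^sub>\<infinity>j\<in>fst Y. k_factor (snd Y j) z)"
    using summable_on_subset_banach[OF kY(1) sub] kY(1) sub k_factor_nonneg
    by (intro infsum_mono_neutral) auto
  also have "\<dots> = k_seq Y z" by (rule kY(2)[symmetric])
  finally show ?thesis by (simp add: W_seq_def)
qed

text \<open>Stated through differences, so that no triangle inequality for \<open>N\<close> or
  \<open>M\<close> is involved.\<close>

lemma cont_between_linear_bound:
  assumes "0 < C" "\<And>f g. f \<in> V \<Longrightarrow> g \<in> V \<Longrightarrow> M (\<lambda>z. T g z - T f z) \<le> C * N (\<lambda>z. g z - f z)"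
  shows "cont_between V N M T"
  unfolding cont_between_def
proof (intro ballI allI impI)
  fix f and \<epsilon> :: real assume f: "f \<in> V" and \<epsilon>: "0 < \<epsilon>"
  show "\<exists>\<delta>>0. \<forall>g\<in>V. N (\<lambda>z. g z - f z) < \<delta> \<longrightarrow> M (\<lambda>z. T g z - T f z) < \<epsilon>"
  proof (intro exI[of _ "\<epsilon> / C"] conjI ballI impI)
    fix g assume g: "g \<in> V" "N (\<lambda>z. g z - f z) < \<epsilon> / C"
    then have "C * N (\<lambda>z. g z - f z) < \<epsilon>" using assms(1) by (simp add: field_simps)
    then show "M (\<lambda>z. T g z - T f z) < \<epsilon>" using assms(2)[OF f g(1)] by linarith
  qed (use assms \<epsilon> in auto)
qed

context bekolle_weight
begin

lemma mult_W_measurable: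
  assumes "F \<in> holo_disc" "seq_in_disc Z" "square_summable Z"
  shows "(\<lambda>z. F z * complex_of_real (W_seq Z z)) \<in> borel_measurable dA"
proof -
  note [measurable] = holo_disc_measurable(2)[OF assms(1)] W_measurable[OF assms(2,3)]
  show ?thesis by measurable
qed

lemma Lp_W_mono:
  assumes p: "0 < p" and F: "F \<in> holo_disc" and Z: "seq_in_disc Z" "square_summable Z" and Y: "seq_in_disc Y" "square_summable Y"
    and le: "\<And>w. w \<in> disc \<Longrightarrow> card (occurrences Z w) \<le> card (occurrences Y w)"
    and Lp: "(\<lambda>z. F z * complex_of_real (W_seq Y z)) \<in> Lp p \<omega>"
  shows "(\<lambda>z. F z * complex_of_real (W_seq Z z)) \<in> Lp p \<omega>"
proof -
  have "(\<integral>\<^sup>+z. ennreal (cmod (F z * W_seq Z z) powr p * \<omega> z) \<partial>dA) \<le> (\<integral>\<^sup>+z. ennreal (cmod (F z * W_seq Y z) powr p * \<omega> z) \<partial>dA)"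
  proof (rule nn_integral_mono)
    fix z assume "z \<in> space dA"
    then have z: "z \<in> disc" by simp
    have "W_seq Z z \<le> W_seq Y z" by (rule W_le_W[OF Z Y le z])
    then have "cmod (F z * W_seq Z z) \<le> cmod (F z * W_seq Y z)"
      by (simp add: norm_mult W_seq_def mult_left_mono)
    then show "ennreal (cmod (F z * W_seq Z z) powr p * \<omega> z) \<le> ennreal (cmod (F z * W_seq Y z) powr p * \<omega> z)"
      using p omega(1)[of z] z by (intro ennreal_leI mult_right_mono powr_mono2) auto
  qed
  also have "\<dots> < \<infinity>" using Lp Lp_iff[OF mult_W_measurable[OF F Y]] by blast
  finally show ?thesis using Lp_iff[OF mult_W_measurable[OF F Z]] by blast
qed

text \<open>One direction is the pointwise bound \<open>|\<psi>| <= W\<close>, the other the Berezin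
  estimate in \<open>W_norm_bound\<close>.\<close>

lemma mult_psi_Bergman_iff:
  assumes p: "0 < p" and F: "F \<in> holo_disc" and Z: "seq_in_disc Z" "square_summable Z"
  shows "(\<lambda>z. F z * psi_seq Z z) \<in> Bergman p \<omega> \<longleftrightarrow> (\<lambda>z. F z * complex_of_real (W_seq Z z)) \<in> Lp p \<omega>"
proof -
  note hd = holo_disc_mult_psi[OF F Z]
  note iff = Lp_iff[OF mult_W_measurable[OF F Z]] Lp_iff[OF holo_disc_measurable(2)[OF hd]]
  show ?thesis
  proof
    assume f: "(\<lambda>z. F z * psi_seq Z z) \<in> Bergman p \<omega>"
    then have fin: "(\<integral>\<^sup>+z. ennreal (cmod (F z * psi_seq Z z) powr p * \<omega> z) \<partial>dA) < \<infinity>" using iff by (simp add: Bergman_def)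
    obtain C where C: "0 < C" "\<And>F. F \<in> holo_disc \<Longrightarrow> (\<lambda>z. F z * psi_seq Z z) \<in> Bergman p \<omega> \<Longrightarrow>
      (\<integral>\<^sup>+z. ennreal (cmod (F z * W_seq Z z) powr p * \<omega> z) \<partial>dA)
        \<le> ennreal C * (\<integral>\<^sup>+z. ennreal (cmod (F z * psi_seq Z z) powr p * \<omega> z) \<partial>dA)"
      by (rule W_norm_bound[OF p Z]) blast
    have "(\<integral>\<^sup>+z. ennreal (cmod (F z * W_seq Z z) powr p * \<omega> z) \<partial>dA)
        \<le> ennreal C * (\<integral>\<^sup>+z. ennreal (cmod (F z * psi_seq Z z) powr p * \<omega> z) \<partial>dA)" by (rule C(2)[OF F f])
    also have "\<dots> < \<infinity>" using fin by (simp add: ennreal_mult_less_top)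
    finally show "(\<lambda>z. F z * complex_of_real (W_seq Z z)) \<in> Lp p \<omega>" using iff(1) by blast
  next
    assume "(\<lambda>z. F z * complex_of_real (W_seq Z z)) \<in> Lp p \<omega>"
    then have "(\<integral>\<^sup>+z. ennreal (cmod (F z * psi_seq Z z) powr p * \<omega> z) \<partial>dA) < \<infinity>"
      using psi_norm_bound[OF F Z p] iff(1) by (meson le_less_trans)
    then show "(\<lambda>z. F z * psi_seq Z z) \<in> Bergman p \<omega>" using iff(2) hd by (simp add: Bergman_def)
  qed
qed

section \<open>The equivalences and the isomorphism\<close>

lemma zero_sets_iff:
  assumes p: "0 < p" and Z: "seq_in_disc Z"
  shows "Z \<in> zero_sets (Bergman p \<omega>) \<longleftrightarrow> square_summable Z \<and>
     (\<exists>F\<in>holo_disc. (\<forall>z\<in>disc. F z \<noteq> 0) \<and> (\<lambda>z. F z * complex_of_real (W_seq Z z)) \<in> Lp p \<omega>)"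
proof
  assume "Z \<in> zero_sets (Bergman p \<omega>)"
  then obtain f where f: "f \<in> Bergman p \<omega>" "\<exists>z\<in>disc. f z \<noteq> 0" "is_zero_seq f Z" by (auto simp: zero_sets_def)
  have van: "vanishes_on f Z" by (rule is_zero_seq_imp_vanishes[OF f(3)])
  have sq: "square_summable Z" by (rule Bergman_square_summable[OF p f(1,2) van Z])
  obtain F where F: "F \<in> holo_disc" "f = (\<lambda>z. F z * psi_seq Z z)"
    using factor_psi[OF _ van Z sq] f(1) by (auto simp: Bergman_def)
  have hol: "F holomorphic_on disc" using F(1) by (simp add: holo_disc_def)
  have nz: "\<exists>z\<in>disc. F z \<noteq> 0" using f(2) F(2) by auto
  have "\<forall>z\<in>disc. F z \<noteq> 0" using is_zero_seq_mult_psi_iff[OF hol nz Z sq] f(3) F(2) by simp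
  moreover have "(\<lambda>z. F z * complex_of_real (W_seq Z z)) \<in> Lp p \<omega>"
    using mult_psi_Bergman_iff[OF p F(1) Z sq] f(1) F(2) by simp
  ultimately show "square_summable Z \<and> (\<exists>F\<in>holo_disc. (\<forall>z\<in>disc. F z \<noteq> 0) \<and> (\<lambda>z. F z * complex_of_real (W_seq Z z)) \<in> Lp p \<omega>)"
    using sq F(1) by blast
next
  assume "square_summable Z \<and> (\<exists>F\<in>holo_disc. (\<forall>z\<in>disc. F z \<noteq> 0) \<and> (\<lambda>z. F z * complex_of_real (W_seq Z z)) \<in> Lp p \<omega>)"
  then obtain F where sq: "square_summable Z" and F: "F \<in> holo_disc" "\<forall>z\<in>disc. F z \<noteq> 0"
      "(\<lambda>z. F z * complex_of_real (W_seq Z z)) \<in> Lp p \<omega>" by blast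
  have hol: "F holomorphic_on disc" using F(1) by (simp add: holo_disc_def)
  have nz: "\<exists>z\<in>disc. F z \<noteq> 0" using F(2) by (intro bexI[of _ 0]) auto
  have "(\<lambda>z. F z * psi_seq Z z) \<in> Bergman p \<omega>" using mult_psi_Bergman_iff[OF p F(1) Z sq] F(3) by simp
  moreover have "\<exists>z\<in>disc. F z * psi_seq Z z \<noteq> 0" by (rule mult_psi_nonzero_point[OF hol nz Z sq])
  moreover have "is_zero_seq (\<lambda>z. F z * psi_seq Z z) Z" using is_zero_seq_mult_psi_iff[OF hol nz Z sq] F(2) by simp
  ultimately show "Z \<in> zero_sets (Bergman p \<omega>)"
    unfolding zero_sets_def mem_Collect_eq by (intro bexI[of _ "\<lambda>z. F z * psi_seq Z z"] conjI)
qed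

lemma zero_sets_subsequence:
  assumes p: "0 < p" and Z: "seq_in_disc Z" "Z \<in> zero_sets (Bergman p \<omega>)" and Y: "subsequence Y Z"
  shows "Y \<in> zero_sets (Bergman p \<omega>)"
proof -
  obtain I a where Ia: "Z = (I, a)" by (cases Z)
  obtain J where Ja: "Y = (J, a)" "J \<subseteq> I" using Y by (cases Y) (auto simp: subsequence_def Ia)
  obtain F where sq: "square_summable Z" and F: "F \<in> holo_disc" "\<forall>z\<in>disc. F z \<noteq> 0"
      "(\<lambda>z. F z * complex_of_real (W_seq Z z)) \<in> Lp p \<omega>" using zero_sets_iff[OF p Z(1)] Z(2) by blast
  have Y': "seq_in_disc Y" "square_summable Y"
    using seq_sub[of I a J] square_summable_sub[of I a J] Z(1) sq Ja by (auto simp: Ia)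
  have "card (occurrences Y w) \<le> card (occurrences Z w)" if "w \<in> disc" for w
    using Ja finite_occurrences[OF Z(1) sq that] by (intro card_mono) (auto simp: occurrences_def Ia)
  then have "(\<lambda>z. F z * complex_of_real (W_seq Y z)) \<in> Lp p \<omega>" by (rule Lp_W_mono[OF p F(1) Y' Z(1) sq _ F(3)])
  then show ?thesis using zero_sets_iff[OF p Y'(1)] Y'(2) F by blast
qed

lemma zero_sets_iff_nonzero:
  assumes p: "0 < p" and Z: "seq_in_disc Z"
  shows "Z \<in> zero_sets (Bergman p \<omega>) \<longleftrightarrow> square_summable Z \<and>
     (\<exists>F\<in>holo_disc. (\<exists>z\<in>disc. F z \<noteq> 0) \<and> (\<lambda>z. F z * complex_of_real (W_seq Z z)) \<in> Lp p \<omega>)"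
proof
  assume "Z \<in> zero_sets (Bergman p \<omega>)"
  then obtain F where F: "square_summable Z" "F \<in> holo_disc" "\<forall>z\<in>disc. F z \<noteq> 0"
      "(\<lambda>z. F z * complex_of_real (W_seq Z z)) \<in> Lp p \<omega>" unfolding zero_sets_iff[OF p Z] by blast
  moreover have "\<exists>z\<in>disc. F z \<noteq> 0" using F(3) by (intro bexI[of _ 0]) auto
  ultimately show "square_summable Z \<and> (\<exists>F\<in>holo_disc. (\<exists>z\<in>disc. F z \<noteq> 0) \<and> (\<lambda>z. F z * complex_of_real (W_seq Z z)) \<in> Lp p \<omega>)"
    by blast
next
  assume "square_summable Z \<and> (\<exists>F\<in>holo_disc. (\<exists>z\<in>disc. F z \<noteq> 0) \<and> (\<lambda>z. F z * complex_of_real (W_seq Z z)) \<in> Lp p \<omega>)"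
  then obtain F where sq: "square_summable Z" and F: "F \<in> holo_disc" "\<exists>z\<in>disc. F z \<noteq> 0"
      "(\<lambda>z. F z * complex_of_real (W_seq Z z)) \<in> Lp p \<omega>" by blast
  have hol: "F holomorphic_on disc" using F(1) by (simp add: holo_disc_def)
  define f where "f = (\<lambda>z. F z * psi_seq Z z)"
  have f: "f \<in> Bergman p \<omega>" using mult_psi_Bergman_iff[OF p F(1) Z sq] F(3) by (simp add: f_def)
  have fnz: "\<exists>z\<in>disc. f z \<noteq> 0" using mult_psi_nonzero_point[OF hol F(2) Z sq] by (simp add: f_def)
  have "f holomorphic_on disc" using f by (simp add: Bergman_def holo_disc_def)
  \<comment> \<open>\<open>F\<close> may have zeros of its own, so \<open>Y\<close> can be longer
    than \<open>Z\<close>, and its enumeration is unrelated to that of \<open>Z\<close>. The two are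
    therefore compared by multiplicities.\<close>
  from ex_zero_seq[OF this fnz] obtain Y where Y: "is_zero_seq f Y" by blast
  then have Yd: "seq_in_disc Y" by (simp add: is_zero_seq_def)
  have "Y \<in> zero_sets (Bergman p \<omega>)" using f fnz Y by (auto simp: zero_sets_def)
  then obtain G where G: "square_summable Y" "G \<in> holo_disc" "\<forall>z\<in>disc. G z \<noteq> 0"
      "(\<lambda>z. G z * complex_of_real (W_seq Y z)) \<in> Lp p \<omega>" unfolding zero_sets_iff[OF p Yd] by blast
  have "card (occurrences Z w) \<le> card (occurrences Y w)" if "w \<in> disc" for w
  proof -
    have "int (card (occurrences Z w)) \<le> zorder f w"
      using vanishes_mult_psi[OF F(1) Z sq] fnz that by (auto simp: vanishes_on_def f_def)
    also have "\<dots> = int (card (occurrences Y w))" using Y that by (simp add: is_zero_seq_def)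
    finally show ?thesis by simp
  qed
  then have "(\<lambda>z. G z * complex_of_real (W_seq Z z)) \<in> Lp p \<omega>" by (rule Lp_W_mono[OF p G(2) Z sq Yd G(1) _ G(4)])
  then show "Z \<in> zero_sets (Bergman p \<omega>)" unfolding zero_sets_iff[OF p Z] using sq G(2,3) by blast
qed

lemma divide_psi_isomorphism:
  assumes p: "0 < p" and Z: "seq_in_disc Z" "square_summable Z"
  shows "continuous_isomorphism
          {f \<in> Bergman p \<omega>. vanishes_on f Z} (Lp_norm p \<omega>)
          {F \<in> holo_disc. (\<lambda>z. F z * complex_of_real (W_seq Z z)) \<in> Lp p \<omega>}
          (\<lambda>F. Lp_norm p \<omega> (\<lambda>z. F z * complex_of_real (W_seq Z z)))
          (divide_psi Z)" (is "continuous_isomorphism ?V ?N ?U ?M ?T")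
proof -
  \<comment> \<open>The inverse of \<open>divide_psi Z\<close>. The two norm estimates give
    continuity in both directions, with constants \<open>C powr (1 / p)\<close> and 1.\<close>
  define m where "m = (\<lambda>F z. F z * psi_seq Z z)"
  have Tm: "?T (m F) = F" if "F \<in> holo_disc" for F
    unfolding m_def by (rule divide_psi_mult[OF that Z])
  have mV: "m F \<in> ?V" if "F \<in> ?U" for F
  proof -
    have F: "F \<in> holo_disc" "(\<lambda>z. F z * complex_of_real (W_seq Z z)) \<in> Lp p \<omega>" using that by blast+
    show ?thesis using mult_psi_Bergman_iff[OF p F(1) Z] F(2) vanishes_mult_psi[OF F(1) Z] unfolding m_def by blast
  qed
  have ex: "\<exists>F\<in>?U. f = m F" if f: "f \<in> ?V" for f
  proof -
    obtain F where F: "F \<in> holo_disc" "f = m F"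
      using factor_psi[OF _ _ Z, of f] f unfolding Bergman_def m_def by blast
    moreover have "F \<in> ?U" using mult_psi_Bergman_iff[OF p F(1) Z] F f unfolding m_def by blast
    ultimately show ?thesis by blast
  qed
  have Uh: "F \<in> holo_disc" if "F \<in> ?U" for F using that by blast
  have bij: "bij_betw ?T ?V ?U"
  proof (rule bij_betw_byWitness[where f' = m])
    show "\<forall>f\<in>?V. m (?T f) = f" using ex Tm[OF Uh] by (metis (no_types, lifting))
    show "\<forall>F\<in>?U. ?T (m F) = F" using Tm[OF Uh] by blast
    show "?T ` ?V \<subseteq> ?U" using ex Tm[OF Uh] by (metis (no_types, lifting) image_subsetI)
    show "m ` ?U \<subseteq> ?V" using mV by blast
  qed
  have inv: "inv_into ?V ?T F = m F" if "F \<in> ?U" for F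
    using inv_into_f_f[OF bij_betw_imp_inj_on[OF bij] mV[OF that]] Tm[OF Uh[OF that]] by simp
  have Ud: "(\<lambda>z. G z - F z) \<in> ?U" if "F \<in> ?U" "G \<in> ?U" for F G
  proof -
    have "(\<lambda>z. G z - F z) \<in> holo_disc" using that by (auto simp: holo_disc_def intro!: holomorphic_intros)
    moreover have "(\<lambda>z. G z * complex_of_real (W_seq Z z) - F z * complex_of_real (W_seq Z z)) \<in> Lp p \<omega>"
      using that by (intro Lp_diff[OF p]) auto
    ultimately show ?thesis by (simp add: left_diff_distrib)
  qed
  have md: "(\<lambda>z. m G z - m F z) = m (\<lambda>z. G z - F z)" for F G by (simp add: m_def left_diff_distrib)
  show ?thesis
    unfolding continuous_isomorphism_def
  proof (intro conjI ballI allI)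
    fix f g assume "f \<in> ?V" "g \<in> ?V"
    then obtain F G where F: "F \<in> ?U" "f = m F" and G: "G \<in> ?U" "g = m G" using ex by blast
    have "(\<lambda>z. F z + G z) \<in> holo_disc" using F G by (auto simp: holo_disc_def intro!: holomorphic_intros)
    from Tm[OF this] have "?T (\<lambda>z. f z + g z) = (\<lambda>z. F z + G z)"
      by (simp add: m_def F G distrib_right)
    then show "?T (\<lambda>z. f z + g z) = (\<lambda>z. ?T f z + ?T g z)" using Tm[OF Uh[OF F(1)]] Tm[OF Uh[OF G(1)]] F G by simp
  next
    fix c f assume "f \<in> ?V"
    then obtain F where F: "F \<in> ?U" "f = m F" using ex by blast
    have "(\<lambda>z. c * F z) \<in> holo_disc" using F by (auto simp: holo_disc_def intro!: holomorphic_intros)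
    from Tm[OF this] have "?T (\<lambda>z. c * f z) = (\<lambda>z. c * F z)"
      by (simp add: m_def F mult.assoc)
    then show "?T (\<lambda>z. c * f z) = (\<lambda>z. c * ?T f z)" using Tm[OF Uh[OF F(1)]] F by simp
  next
    show "bij_betw ?T ?V ?U" by (rule bij)
  next
    obtain C where C: "0 < C" "\<And>F. F \<in> holo_disc \<Longrightarrow> (\<lambda>z. F z * psi_seq Z z) \<in> Bergman p \<omega> \<Longrightarrow>
      (\<integral>\<^sup>+z. ennreal (cmod (F z * W_seq Z z) powr p * \<omega> z) \<partial>dA)
        \<le> ennreal C * (\<integral>\<^sup>+z. ennreal (cmod (F z * psi_seq Z z) powr p * \<omega> z) \<partial>dA)"
      by (rule W_norm_bound[OF p Z]) blast
    show "cont_between ?V ?N ?M ?T"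
    proof (rule cont_between_linear_bound)
      show "0 < C powr (1 / p)" using C(1) by simp
      fix f g assume "f \<in> ?V" "g \<in> ?V"
      then obtain F G where F: "F \<in> ?U" "f = m F" and G: "G \<in> ?U" "g = m G" using ex by blast
      define H where "H = (\<lambda>z. G z - F z)"
      have H: "H \<in> ?U" unfolding H_def by (rule Ud[OF F(1) G(1)])
      have mB: "m H \<in> Bergman p \<omega>" using mV[OF H] by blast
      have "?M H \<le> C powr (1 / p) * ?N (m H)"
      proof (rule Lp_norm_le(2)[OF p])
        show "(\<lambda>z. H z * complex_of_real (W_seq Z z)) \<in> borel_measurable dA" by (rule mult_W_measurable[OF Uh[OF H] Z])
        show "m H \<in> borel_measurable dA" "m H \<in> Lp p \<omega>" using mB by (auto simp: Bergman_def Lp_def)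
        show "(\<integral>\<^sup>+z. ennreal (cmod (H z * W_seq Z z) powr p * \<omega> z) \<partial>dA) \<le> ennreal C * (\<integral>\<^sup>+z. ennreal (cmod (m H z) powr p * \<omega> z) \<partial>dA)"
          using C(2)[OF Uh[OF H]] mB by (simp add: m_def)
      qed (use C in auto)
      moreover have "(\<lambda>z. ?T g z - ?T f z) = H" using Tm[OF Uh[OF F(1)]] Tm[OF Uh[OF G(1)]] F G by (simp add: H_def)
      moreover have "(\<lambda>z. g z - f z) = m H" using F G md by (simp add: H_def)
      ultimately show "?M (\<lambda>z. ?T g z - ?T f z) \<le> C powr (1 / p) * ?N (\<lambda>z. g z - f z)" by (simp add: fun_eq_iff)
    qed
  next
    show "cont_between ?U ?M ?N (inv_into ?V ?T)"
    proof (rule cont_between_linear_bound)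
      show "(0::real) < 1 powr (1 / p)" by simp
      fix F G assume F: "F \<in> ?U" and G: "G \<in> ?U"
      define H where "H = (\<lambda>z. G z - F z)"
      have H: "H \<in> ?U" unfolding H_def by (rule Ud[OF F G])
      have "?N (m H) \<le> 1 powr (1 / p) * ?M H"
      proof (rule Lp_norm_le(2)[OF p])
        show "(\<lambda>z. H z * complex_of_real (W_seq Z z)) \<in> borel_measurable dA" by (rule mult_W_measurable[OF Uh[OF H] Z])
        show "(\<lambda>z. H z * complex_of_real (W_seq Z z)) \<in> Lp p \<omega>" using H by simp
        show "m H \<in> borel_measurable dA" using mV[OF H] by (auto simp: Bergman_def Lp_def)
        show "(\<integral>\<^sup>+z. ennreal (cmod (m H z) powr p * \<omega> z) \<partial>dA) \<le> ennreal 1 * (\<integral>\<^sup>+z. ennreal (cmod (H z * W_seq Z z) powr p * \<omega> z) \<partial>dA)"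
          using psi_norm_bound[OF Uh[OF H] Z p] by (simp add: m_def)
      qed simp
      then show "?N (\<lambda>z. inv_into ?V ?T G z - inv_into ?V ?T F z) \<le> 1 powr (1 / p) * ?M (\<lambda>z. G z - F z)"
        unfolding inv[OF F] inv[OF G] md H_def .
    qed
  qed
qed

end

theorem theorem1:
  fixes p :: real and \<omega> :: "complex \<Rightarrow> real" and Z :: zseq
  assumes "0 < p" and "Binf_weight \<omega>" and "seq_in_disc Z"
  shows
    "(Z \<in> zero_sets (Bergman p \<omega>) \<longleftrightarrow>
        (\<forall>Y. subsequence Y Z \<longrightarrow> Y \<in> zero_sets (Bergman p \<omega>)))
     \<and> (Z \<in> zero_sets (Bergman p \<omega>) \<longleftrightarrow>
        square_summable Z \<and>
        (\<exists>F\<in>holo_disc. (\<forall>z\<in>disc. F z \<noteq> 0) \<and> (\<lambda>z. F z * W_seq Z z) \<in> Lp p \<omega>))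
     \<and> (Z \<in> zero_sets (Bergman p \<omega>) \<longleftrightarrow>
        square_summable Z \<and>
        (\<exists>F\<in>holo_disc. (\<exists>z\<in>disc. F z \<noteq> 0) \<and> (\<lambda>z. F z * W_seq Z z) \<in> Lp p \<omega>))
     \<and> (Z \<in> zero_sets (Bergman p \<omega>) \<longrightarrow>
        continuous_isomorphism
          {f \<in> Bergman p \<omega>. vanishes_on f Z} (Lp_norm p \<omega>)
          {F \<in> holo_disc. (\<lambda>z. F z * W_seq Z z) \<in> Lp p \<omega>}
          (\<lambda>F. Lp_norm p \<omega> (\<lambda>z. F z * W_seq Z z))
          (divide_psi Z))"
proof -
  obtain q where q: "1 < q" "Bq_weight q \<omega>" using assms(2) by (auto simp: Binf_weight_def)
  interpret bekolle_weight q \<omega> using q by unfold_locales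
  \<comment> \<open>With this, (b) yields (a).\<close>
  have "subsequence Z Z" by (simp add: subsequence_def)
  then show ?thesis
    using zero_sets_subsequence[OF assms(1,3)] zero_sets_iff[OF assms(1,3)]
      zero_sets_iff_nonzero[OF assms(1,3)] divide_psi_isomorphism[OF assms(1,3)] by blast
qed

end
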